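(* Let $k_{\max}=k_{\max}(x)$ be a positive-integer-valued function with $\log k_{\max}(x)/\log x\to 0$ as $x\to\infty$ (i.e. $k_{\max}=x^{o(1)}$). Choose $m$ uniformly at random from $\{1,\ldots,x\}$. Then \[ \lim_{x\to\infty}\mathbb{P}\big(\forall\, 8\le k\le k_{\max}:\ G_{f_{m-k,m}}=S_k\big)=1 . \]
   Context: For integers $0\le n<m$ the trimmed exponential is $f_{n,m}(x)=\sum_{j=n}^{m}\frac{x^{j-n}}{j!}\in\mathbb{Q}[x]$, a polynomial of degree $m-n$. For $g\in\mathbb{Q}[x]$ of degree $k$, $G_g$ denotes the Galois group over $\mathbb{Q}$ of the splitting field of $g$, viewed as a permutation group on the roots of $g$ (so $G_g\le S_k$). The event in the claim is understood to include the requirement $m-k\ge 0$ for all $k$ considered, so that all polynomials are defined. *)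

theory Defs
  imports "HOL-Computational_Algebra.Polynomial" "HOL-Combinatorics.Permutations" Complex_Main
begin

definition trimmed_exp :: "nat \<Rightarrow> nat \<Rightarrow> rat poly" where
  "trimmed_exp n m = (\<Sum>j\<in>{n..m}. monom (1 / of_nat (fact j)) (j - n))"

definition croots :: "rat poly \<Rightarrow> complex set" where
  "croots g = {z. poly (map_poly of_rat g) z = 0}"

definition is_subfield :: "complex set \<Rightarrow> bool" where
  "is_subfield K \<longleftrightarrow> 0 \<in> K \<and> 1 \<in> K \<and>
     (\<forall>x\<in>K. \<forall>y\<in>K. x + y \<in> K \<and> x * y \<in> K) \<and>
     (\<forall>x\<in>K. - x \<in> K \<and> inverse x \<in> K)"

definition splitting_field :: "rat poly \<Rightarrow> complex set" where
  "splitting_field g = \<Inter>{K. is_subfield K \<and> croots g \<subseteq> K}"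

text \<open>Field automorphisms of a subfield K of C (they automatically fix Q).\<close>
definition field_auts :: "complex set \<Rightarrow> (complex \<Rightarrow> complex) set" where
  "field_auts K = {\<sigma>. bij_betw \<sigma> K K \<and>
     (\<forall>x\<in>K. \<forall>y\<in>K. \<sigma> (x + y) = \<sigma> x + \<sigma> y \<and> \<sigma> (x * y) = \<sigma> x * \<sigma> y)}"

definition galois_group :: "rat poly \<Rightarrow> (complex \<Rightarrow> complex) set" where
  "galois_group g = (\<lambda>\<sigma>. (\<lambda>z. if z \<in> croots g then \<sigma> z else z)) ` field_auts (splitting_field g)"

definition galois_is_full_symmetric :: "rat poly \<Rightarrow> bool" where
  "galois_is_full_symmetric g \<longleftrightarrow>
     card (croots g) = degree g \<and> galois_group g = {p. p permutes croots g}"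

end

theory Submission
  imports Defs "HOL-Computational_Algebra.Fundamental_Theorem_Algebra" "HOL-Computational_Algebra.Primes"
    "HOL-Real_Asymp.Real_Asymp"
begin

text \<open>Up to the factor \<open>m!\<close>, the coefficient of \<open>x ^ (k - i)\<close> in \<open>f\<^bsub>m-k,m\<^esub>\<close> is the falling factorial
  \<open>m (m - 1) \<dots> (m - i + 1)\<close>, so the Newton polygon at a prime \<open>p\<close> is read off from the integers
  among \<open>m, \<dots>, m - k + 1\<close> that \<open>p\<close> divides. A large prime exactly dividing \<open>m\<close> makes the polynomial Eisenstein
  (transitivity, and an odd discriminant valuation for even \<open>k\<close>); one exactly dividing \<open>m - 1\<close> gives an
  odd discriminant valuation for odd \<open>k\<close>. If some slope is \<open>1/q\<close> along exactly \<open>q\<close> roots, with \<open>q\<close> prime and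
  \<open>k/2 < q < k - 2\<close>, then \<open>q\<close> divides the group order and Jordan's theorem yields the alternating group.

  For bounded \<open>k\<close> such a slope comes from a large prime exactly dividing \<open>m - (k - q)\<close>. For large \<open>k\<close> it
  comes from the prime \<open>q\<close> itself as soon as the residue of \<open>m\<close> modulo \<open>q\<close> is at most \<open>k - q\<close>. That the needed
  primes exist for almost all \<open>m\<close> follows from second moment estimates: divergence of the sum of \<open>1/p\<close>
  over \<open>k\<^sub>m\<^sub>a\<^sub>x < p < x\<^bsup>1/12\<^esup>\<close> in the first case, and in the second case a summable bound over blocks
  \<open>s ^ 4 \<le> k < (s + 1) ^ 4\<close> that share their primes \<open>q\<close>.\<close>

section \<open>Extending p-adic valuations\<close>

text \<open>No completion or decomposition group occurs. What ramification theory would supply is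
  obtained from integrality: a p-adic valuation on the splitting field is integral on nonzero
  rationals, and suitable rationals are produced as expressions fixed by the Galois group. The
  product over an orbit gives transitivity, an elementary symmetric function of a monomial's
  conjugates gives divisibility of a group order by q, and the square root of the discriminant gives
  an odd permutation. The second obstacle is that the range of k grows with x, so an exceptional
  proportion tending to 0 for each single k is not enough. Only the k below a threshold fixed by the
  tolerance may rely on such a bound, whose rate comes from the slowly diverging sum of 1/p. Beyond
  the threshold a block costs the proportion 1/s^2, so the whole tail is small before x is chosen.
  The error terms are powers of the largest prime involved; the exponent 1/12 and the growth
  condition on the range of k keep them below a multiple of the square root of x.\<close>

definition is_subring :: "'a::comm_ring_1 set \<Rightarrow> bool" where
  "is_subring R \<longleftrightarrow> 1 \<in> R \<and> (\<forall>x\<in>R. \<forall>y\<in>R. x - y \<in> R \<and> x * y \<in> R)"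

context
  fixes R :: "'a::comm_ring_1 set"
  assumes R: "is_subring R"
begin

lemma is_subringD:
  shows "1 \<in> R" "0 \<in> R" "x \<in> R \<Longrightarrow> y \<in> R \<Longrightarrow> x - y \<in> R" "x \<in> R \<Longrightarrow> y \<in> R \<Longrightarrow> x * y \<in> R"
    "x \<in> R \<Longrightarrow> - x \<in> R" "x \<in> R \<Longrightarrow> y \<in> R \<Longrightarrow> x + y \<in> R"
proof -
  show 1: "1 \<in> R" and d: "\<And>x y. x \<in> R \<Longrightarrow> y \<in> R \<Longrightarrow> x - y \<in> R"
    and "x \<in> R \<Longrightarrow> y \<in> R \<Longrightarrow> x * y \<in> R" using R by (auto simp: is_subring_def)
  show 0: "0 \<in> R" using d[OF 1 1] by simp
  show m: "x \<in> R \<Longrightarrow> - x \<in> R" for x using d[OF 0, of x] by simp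
  show "x \<in> R \<Longrightarrow> y \<in> R \<Longrightarrow> x + y \<in> R" using d[OF _ m[of y], of x] by simp
qed

lemma is_subring_sum: "(\<And>i. i \<in> A \<Longrightarrow> f i \<in> R) \<Longrightarrow> sum f A \<in> R"
  by (induction A rule: infinite_finite_induct) (auto intro: is_subringD)

lemma is_subring_power: "x \<in> R \<Longrightarrow> x ^ n \<in> R"
  by (induction n) (auto intro: is_subringD)

lemma is_subring_of_nat: "of_nat n \<in> R"
  by (induction n) (auto intro: is_subringD)

lemma is_subring_of_int: "of_int n \<in> R"
  using is_subring_of_nat by (cases n rule: int_cases2) (auto intro: is_subringD)

definition adjoin :: "'a \<Rightarrow> 'a set" where
  "adjoin x = {poly P x | P. \<forall>i. coeff P i \<in> R}"

lemma is_subring_adjoin: "is_subring (adjoin x)"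
  unfolding is_subring_def
proof (intro conjI ballI)
  show "1 \<in> adjoin x"
    unfolding adjoin_def by (rule CollectI, rule exI[of _ 1]) (auto intro: is_subringD simp: one_pCons coeff_pCons split: nat.splits)
next
  fix a b assume "a \<in> adjoin x" "b \<in> adjoin x"
  then obtain P Q where P: "a = poly P x" "\<forall>i. coeff P i \<in> R" and Q: "b = poly Q x" "\<forall>i. coeff Q i \<in> R"
    by (auto simp: adjoin_def)
  show "a - b \<in> adjoin x" unfolding adjoin_def
    by (rule CollectI, rule exI[of _ "P - Q"]) (use P Q in \<open>auto intro: is_subringD\<close>)
  show "a * b \<in> adjoin x" unfolding adjoin_def
    by (rule CollectI, rule exI[of _ "P * Q"]) (use P Q in \<open>auto intro!: is_subringD is_subring_sum simp: coeff_mult\<close>)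
qed

lemma subset_adjoin: "R \<subseteq> adjoin x"
proof
  fix a assume "a \<in> R"
  then show "a \<in> adjoin x" unfolding adjoin_def
    by (intro CollectI exI[of _ "[:a:]"]) (auto intro: is_subringD simp: coeff_pCons split: nat.splits)
qed

lemma self_in_adjoin: "x \<in> adjoin x"
  unfolding adjoin_def
  by (intro CollectI exI[of _ "[:0,1:]"]) (auto intro: is_subringD simp: coeff_pCons split: nat.splits)

end

section \<open>Chevalley's theorem: a maximal subring avoiding a given inverse is a valuation
  ring\<close>

locale maximal_subring =
  fixes R :: "'a::field set" and b :: 'a
  assumes subring: "is_subring R" and b: "b \<in> R" "b \<noteq> 0" "inverse b \<notin> R"
    and maximal: "\<And>S. is_subring S \<Longrightarrow> R \<subseteq> S \<Longrightarrow> inverse b \<notin> S \<Longrightarrow> S = R"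
begin

lemmas closed = is_subringD[OF subring] is_subring_sum[OF subring] is_subring_power[OF subring]
  is_subring_of_nat[OF subring] is_subring_of_int[OF subring]

text \<open>This principal ideal does the work that the maximal ideal does in the usual
  proof.\<close>

definition bR :: "'a set" where "bR = (*) b ` R"

lemma bR_closed: "x \<in> bR \<Longrightarrow> y \<in> bR \<Longrightarrow> x + y \<in> bR" "x \<in> bR \<Longrightarrow> y \<in> bR \<Longrightarrow> x - y \<in> bR"
  "x \<in> bR \<Longrightarrow> y \<in> R \<Longrightarrow> x * y \<in> bR" "x \<in> R \<Longrightarrow> y \<in> bR \<Longrightarrow> x * y \<in> bR" "0 \<in> bR" "x \<in> bR \<Longrightarrow> x \<in> R"
proof -
  assume "x \<in> bR" "y \<in> bR"
  then obtain u w where "x = b * u" "y = b * w" "u \<in> R" "w \<in> R" by (auto simp: bR_def)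
  then show "x + y \<in> bR" "x - y \<in> bR" unfolding bR_def
    by (simp_all add: closed image_iff flip: distrib_left right_diff_distrib)
      (metis closed(6), metis closed(3))
next
  assume "x \<in> bR" "y \<in> R"
  then obtain u where "x = b * u" "u \<in> R" by (auto simp: bR_def)
  then show "x * y \<in> bR" using \<open>y \<in> R\<close> unfolding bR_def
    by (auto intro!: image_eqI[of _ _ "u * y"] closed simp: algebra_simps)
next
  assume "x \<in> R" "y \<in> bR"
  then obtain u where "y = b * u" "u \<in> R" by (auto simp: bR_def)
  then show "x * y \<in> bR" using \<open>x \<in> R\<close> unfolding bR_def
    by (auto intro!: image_eqI[of _ _ "x * u"] closed simp: algebra_simps)
next
  show "0 \<in> bR" unfolding bR_def by (auto intro!: image_eqI[of _ _ 0] closed)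
  show "x \<in> bR \<Longrightarrow> x \<in> R" unfolding bR_def using b closed by auto
qed

lemma one_notin_bR: "1 \<notin> bR"
proof
  assume "1 \<in> bR"
  then obtain u where "u \<in> R" "1 = b * u" by (auto simp: bR_def)
  then have "inverse b = u" using b by (metis inverse_unique)
  then show False using b \<open>u \<in> R\<close> by simp
qed

text \<open>By maximality the larger ring \<open>adjoin R x\<close> contains
  \<open>inverse b\<close>. Multiplying a polynomial expression for it by \<open>b\<close> moves all
  coefficients into \<open>bR\<close>.\<close>

lemma ex_poly_bR:
  assumes "x \<notin> R"
  shows "\<exists>Q. (\<forall>i. coeff Q i \<in> bR) \<and> poly Q x = 1"
proof -
  have "inverse b \<in> adjoin R x"
    using maximal[OF is_subring_adjoin[OF subring] subset_adjoin[OF subring], of x]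
      self_in_adjoin[OF subring, of x] assms by auto
  then obtain P where "inverse b = poly P x" "\<forall>i. coeff P i \<in> R" by (auto simp: adjoin_def[OF subring])
  then show ?thesis using b by (intro exI[of _ "smult b P"]) (auto simp: bR_def field_simps)
qed

text \<open>If \<open>inverse u\<close> were outside \<open>R\<close>, a relation from
  \<open>ex_poly_bR\<close>, multiplied by a power u^n, would put u^n into \<open>bR\<close>. Since
  1 - u^n lies there as well, so would 1.\<close>

lemma inverse_in_R:
  assumes u: "u \<in> R" and "1 - u \<in> bR"
  shows "u \<noteq> 0" "inverse u \<in> R"
proof -
  show u0: "u \<noteq> 0" using assms one_notin_bR by auto
  have pow: "1 - u ^ n \<in> bR" for n
  proof (induction n)
    case (Suc n)
    have "1 - u ^ Suc n = (1 - u ^ n) + u ^ n * (1 - u)" by (simp add: algebra_simps)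
    then show ?case using Suc assms u by (metis bR_closed(1,4) closed(8))
  qed (simp add: bR_closed)
  show "inverse u \<in> R"
  proof (rule ccontr)
    assume "inverse u \<notin> R"
    from ex_poly_bR[OF this] obtain Q where Q: "\<forall>i. coeff Q i \<in> bR" "poly Q (inverse u) = 1" by blast
    have "u ^ degree Q = u ^ degree Q * poly Q (inverse u)" using Q by simp
    also have "\<dots> = (\<Sum>i\<le>degree Q. coeff Q i * u ^ (degree Q - i))"
      unfolding poly_altdef sum_distrib_left
    proof (rule sum.cong)
      fix i assume "i \<in> {..degree Q}"
      then have "u ^ degree Q = u ^ (degree Q - i) * u ^ i" by (simp flip: power_add)
      then show "u ^ degree Q * (coeff Q i * inverse u ^ i) = coeff Q i * u ^ (degree Q - i)"
        using u0 by (simp add: power_inverse)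
    qed simp
    also have "\<dots> \<in> bR"
    proof -
      have "(\<Sum>i\<in>A. coeff Q i * u ^ (degree Q - i)) \<in> bR" for A
        by (induction A rule: infinite_finite_induct) (use Q u in \<open>auto intro!: bR_closed(1,3,5) closed(8)\<close>)
      then show ?thesis .
    qed
    finally have "1 \<in> bR" using bR_closed(1)[OF pow[of "degree Q"]] by fastforce
    then show False using one_notin_bR by simp
  qed
qed

text \<open>The descent in Chevalley's proof. In the relation for \<open>inverse x\<close>, 1 minus
  the constant term is a unit, so the relation expresses x^m through lower powers with coefficients
  in \<open>bR\<close>. Substituting this into the leading term of \<open>Q\<close> yields a
  relation for \<open>x\<close> of smaller degree.\<close>

lemma no_two_relations:
  assumes x: "x \<noteq> 0" and Q: "\<forall>i. coeff Q i \<in> bR" "poly Q x = 1"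
    and min: "\<And>Q'. \<forall>i. coeff Q' i \<in> bR \<Longrightarrow> poly Q' x = 1 \<Longrightarrow> degree Q \<le> degree Q'"
    and Q': "\<forall>i. coeff Q' i \<in> bR" "poly Q' (inverse x) = 1" "degree Q' \<le> degree Q"
  shows False
proof -
  define n m where "n = degree Q" and "m = degree Q'"
  have m0: "m > 0"
  proof (rule ccontr)
    assume "\<not> m > 0"
    then have "Q' = [:coeff Q' 0:]" by (metis coeff_pCons_0 degree_eq_zeroE m_def not_gr_zero)
    then have "1 = coeff Q' 0" using Q' by (metis mult_zero_right poly_0 poly_pCons add.right_neutral)
    then show False using one_notin_bR Q' by metis
  qed
  define u where "u = 1 - coeff Q' 0"
  have u: "u \<noteq> 0" "inverse u \<in> R"
    using inverse_in_R[of u] Q' bR_closed closed unfolding u_def by auto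
  have "1 = coeff Q' 0 + (\<Sum>j=1..m. coeff Q' j * inverse x ^ j)"
  proof -
    have "1 = (\<Sum>j\<le>m. coeff Q' j * inverse x ^ j)" using Q' by (simp add: poly_altdef m_def)
    also have "{..m} = insert 0 {1..m}" by auto
    finally show ?thesis by simp
  qed
  then have "u = (\<Sum>j=1..m. coeff Q' j * inverse x ^ j)" by (simp add: u_def algebra_simps)
  then have "x ^ m * u = x ^ m * (\<Sum>j=1..m. coeff Q' j * inverse x ^ j)" by simp
  also have "\<dots> = (\<Sum>j=1..m. coeff Q' j * x ^ (m - j))"
    unfolding sum_distrib_left
  proof (rule sum.cong)
    fix j assume "j \<in> {1..m}"
    then have "x ^ m = x ^ (m - j) * x ^ j" by (simp flip: power_add)
    then show "x ^ m * (coeff Q' j * inverse x ^ j) = coeff Q' j * x ^ (m - j)"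
      using x by (simp add: power_inverse)
  qed simp
  finally have xm: "x ^ m = (\<Sum>j=1..m. coeff Q' j * inverse u * x ^ (m - j))"
    using u by (simp add: sum_distrib_right[symmetric] field_simps sum_divide_distrib[symmetric])
  define T where "T = (\<Sum>j=1..m. monom (coeff Q' j * inverse u) (m - j))"
  have T: "poly T x = x ^ m" unfolding T_def xm by (simp add: poly_sum poly_monom)
  have Tc: "coeff T i \<in> bR" for i
  proof -
    have "(\<Sum>j\<in>A. coeff (monom (coeff Q' j * inverse u) (m - j)) i) \<in> bR" for A
      by (induction A rule: infinite_finite_induct) (use Q' u in \<open>auto intro!: bR_closed(1,3,5)\<close>)
    then show ?thesis by (simp add: T_def coeff_sum)
  qed
  have Td: "degree T < m" unfolding T_def
    by (rule degree_sum_less) (use m0 in \<open>auto intro: le_less_trans[OF degree_monom_le]\<close>)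
  have mn: "m \<le> n" using Q' by (simp add: m_def n_def)
  define Q2 where "Q2 = Q - monom (coeff Q n) n + monom (coeff Q n) (n - m) * T"
  have "poly Q2 x = 1"
  proof -
    have "x ^ n = x ^ (n - m) * x ^ m" using mn by (simp flip: power_add)
    then show ?thesis by (simp add: Q2_def Q T poly_monom algebra_simps)
  qed
  moreover have "\<forall>i. coeff Q2 i \<in> bR"
  proof
    fix i
    have "coeff (monom (coeff Q n) (n - m) * T) i \<in> bR" unfolding coeff_monom_mult
      using Q Tc bR_closed(3,5,6) by auto
    then show "coeff Q2 i \<in> bR" unfolding Q2_def using Q by (auto intro!: bR_closed(1,2,5))
  qed
  moreover have "degree Q2 < n"
  proof -
    have "degree (Q - monom (coeff Q n) n) < n"
    proof -
      have "degree (Q - monom (coeff Q n) n) \<le> n"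
        by (rule degree_diff_le) (auto simp: n_def degree_monom_le)
      moreover have "coeff (Q - monom (coeff Q n) n) n = 0" by simp
      ultimately show ?thesis using m0 mn
        by (metis degree_0 leading_coeff_0_iff le_neq_implies_less less_le_trans)
    qed
    moreover have "degree (monom (coeff Q n) (n - m) * T) < n"
      using degree_mult_le[of "monom (coeff Q n) (n - m)" T] degree_monom_le[of "coeff Q n" "n - m"] Td mn
      by linarith
    ultimately show ?thesis unfolding Q2_def by (rule degree_add_less)
  qed
  ultimately show False using min[of Q2] by (simp add: n_def)
qed

lemma valuation_ring: "x \<in> R \<or> inverse x \<in> R"
proof (rule ccontr)
  assume neg: "\<not> ?thesis"
  then have x: "x \<noteq> 0" using closed(2) by auto
  define A where "A y = {Q. (\<forall>i. coeff Q i \<in> bR) \<and> poly Q y = 1}" for y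
  have min: "\<exists>Q\<in>A y. \<forall>Q'\<in>A y. degree Q \<le> degree Q'" if "y \<notin> R" for y
  proof -
    have "\<exists>Q. Q \<in> A y" using ex_poly_bR[OF that] by (auto simp: A_def)
    then show ?thesis using ex_has_least_nat[of "\<lambda>Q. Q \<in> A y" _ degree] by blast
  qed
  obtain Q1 where Q1: "Q1 \<in> A x" "\<forall>Q'\<in>A x. degree Q1 \<le> degree Q'" using min neg by blast
  obtain Q2 where Q2: "Q2 \<in> A (inverse x)" "\<forall>Q'\<in>A (inverse x). degree Q2 \<le> degree Q'" using min neg by blast
  \<comment> \<open>The situation is symmetric in \<open>x\<close> and its inverse, so the relation
    of larger degree is the one that gets shortened.\<close>
  show False
  proof (cases "degree Q2 \<le> degree Q1")
    case True
    then show False using no_two_relations[of x Q1 Q2] Q1 Q2 x by (auto simp: A_def)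
  next
    case False
    then show False using no_two_relations[of "inverse x" Q2 Q1] Q1 Q2 x by (auto simp: A_def)
  qed
qed

end

lemma ex_maximal_subring:
  fixes b :: "'a::field"
  assumes "is_subring R0" "b \<in> R0" "b \<noteq> 0" "inverse b \<notin> R0"
  shows "\<exists>R. maximal_subring R b"
proof -
  define F where "F = {S. is_subring S \<and> R0 \<subseteq> S \<and> inverse b \<notin> S}"
  have "\<exists>M\<in>F. \<forall>X\<in>F. M \<subseteq> X \<longrightarrow> X = M"
  proof (rule subset_Zorn_nonempty)
    show "F \<noteq> {}" using assms by (auto simp: F_def)
  next
    fix C assume C: "C \<noteq> {}" "subset.chain F C"
    then have CF: "C \<subseteq> F" and ch: "\<And>x y. x \<in> C \<Longrightarrow> y \<in> C \<Longrightarrow> x \<subseteq> y \<or> y \<subseteq> x"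
      by (auto simp: subset.chain_def)
    have "is_subring (\<Union>C)"
      unfolding is_subring_def
    proof (intro conjI ballI)
      show "1 \<in> \<Union>C" using C CF by (auto simp: F_def is_subring_def)
      fix x y assume "x \<in> \<Union>C" "y \<in> \<Union>C"
      then obtain S where S: "S \<in> C" "x \<in> S" "y \<in> S" using ch by blast
      then have "x - y \<in> S" "x * y \<in> S" using CF by (auto simp: F_def is_subring_def)
      then show "x - y \<in> \<Union>C" "x * y \<in> \<Union>C" using S by auto
    qed
    then show "\<Union>C \<in> F" using C CF by (auto simp: F_def)
  qed
  then obtain M where M: "M \<in> F" "\<forall>X\<in>F. M \<subseteq> X \<longrightarrow> X = M" by blast
  have "maximal_subring M b"
  proof
    show "is_subring M" "b \<in> M" "b \<noteq> 0" "inverse b \<notin> M" using M assms by (auto simp: F_def)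
    fix S assume "is_subring S" "M \<subseteq> S" "inverse b \<notin> S"
    then show "S = M" using M by (auto simp: F_def)
  qed
  then show ?thesis ..
qed

section \<open>The p-adic valuation with rational values attached to a maximal subring\<close>

locale padic_subring = maximal_subring R "of_nat p" for R :: "'a::field_char_0 set" and p :: nat +
  assumes prime: "prime p"
begin

definition unit :: "'a \<Rightarrow> bool" where "unit x \<longleftrightarrow> x \<in> R \<and> inverse x \<in> R \<and> x \<noteq> 0"

lemma unit_1: "unit 1" by (simp add: unit_def closed)

lemma unit_mult: "unit x \<Longrightarrow> unit y \<Longrightarrow> unit (x * y)"
  by (simp add: unit_def closed)

lemma unit_inverse: "unit x \<Longrightarrow> unit (inverse x)" by (simp add: unit_def)

lemma unit_power: "unit x \<Longrightarrow> unit (x ^ n)"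
  by (induction n) (auto intro: unit_1 unit_mult)

lemma p0: "(of_nat p :: 'a) \<noteq> 0" using b by simp

lemma not_unit_mult_p: "y \<in> R \<Longrightarrow> \<not> unit (of_nat p * y)"
proof
  assume y: "y \<in> R" and "unit (of_nat p * y)"
  then have "y * inverse (of_nat p * y) \<in> R" "y \<noteq> 0" by (auto simp: unit_def closed)
  then show False using b by (simp add: field_simps)
qed

lemma unit_powi_p: assumes "unit (of_nat p powi c)" shows "c = 0"
proof -
  have "c \<le> 0" if "unit (of_nat p powi c)" for c
  proof (rule ccontr)
    assume "\<not> c \<le> 0"
    then have "of_nat p powi c = of_nat p * (of_nat p ^ (nat c - 1) :: 'a)"
      by (simp add: power_int_def flip: power_Suc)
    then show False using that not_unit_mult_p[OF closed(8)[OF closed(9)], of p "nat c - 1"] by simp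
  qed
  from this[of c] this[of "-c"] show ?thesis using assms unit_inverse[OF assms]
    by (simp add: power_int_minus)
qed

text \<open>Bezout writes a multiple of \<open>n\<close> as 1 minus a multiple of \<open>p\<close>,
  and elements of this form are units by \<open>inverse_in_R\<close>.\<close>

lemma unit_of_int: assumes "\<not> int p dvd n" shows "unit (of_int n)"
proof -
  have "coprime (int p) n" using prime assms by (simp add: prime_imp_coprime)
  then have "\<exists>u w. u * int p + w * n = 1" using bezout_int[of "int p" n] by simp
  then obtain u w where uw: "u * int p + w * n = 1" by blast
  have "1 - of_int (w * n) \<in> bR"
  proof -
    have "1 - of_int (w * n) = of_nat p * (of_int u :: 'a)"
      by (metis add_diff_cancel_right' mult.commute of_int_1 of_int_diff of_int_mult of_int_of_nat_eq uw)
    then show ?thesis by (auto simp: bR_def closed)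
  qed
  from inverse_in_R[OF closed(10) this] have h: "of_int (w * n) \<noteq> (0::'a)" "inverse (of_int (w * n)) \<in> R" .
  have "of_int w * inverse (of_int (w * n)) \<in> R" by (rule closed(4)[OF closed(10) h(2)])
  also have "of_int w * inverse (of_int (w * n)) = inverse (of_int n :: 'a)" using h(1) by (simp add: field_simps)
  finally have "inverse (of_int n :: 'a) \<in> R" .
  then show ?thesis using h(1) closed(10)[of n] by (simp add: unit_def)
qed

lemma in_R_if_power: assumes "x ^ d \<in> R" "d > 0" shows "x \<in> R"
proof (cases "x \<in> R")
  case False
  then have i: "inverse x \<in> R" and x: "x \<noteq> 0" using valuation_ring closed(2) by auto
  have "inverse x ^ (d - 1) * x ^ d \<in> R" by (rule closed(4)[OF closed(8)[OF i] assms(1)])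
  moreover have "x ^ d = x ^ (d - 1) * x" using assms by (metis Suc_diff_1 power_Suc2)
  ultimately show ?thesis using x by (simp add: field_simps)
qed

text \<open>Encodes that \<open>x\<close> has valuation c/d. No value group is constructed: some
  power of each algebraic element equals a power of \<open>p\<close> up to a unit, so comparison
  with \<open>p\<close> suffices.\<close>

definition has_val :: "'a \<Rightarrow> nat \<Rightarrow> int \<Rightarrow> bool" where
  "has_val x d c \<longleftrightarrow> x \<noteq> 0 \<and> d > 0 \<and> unit (x ^ d / of_nat p powi c)"

lemma has_val_mult:
  assumes "has_val x d c" "has_val y d' c'"
  shows "has_val (x * y) (d * d') (c * int d' + c' * int d)"
proof -
  have "unit ((x ^ d / of_nat p powi c) ^ d' * (y ^ d' / of_nat p powi c') ^ d)"
    using assms by (auto simp: has_val_def intro!: unit_mult unit_power)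
  also have "(x ^ d / of_nat p powi c) ^ d' * (y ^ d' / of_nat p powi c') ^ d =
    (x * y) ^ (d * d') / of_nat p powi (c * int d' + c' * int d)"
    using p0 by (simp add: power_int_add power_divide power_mult_distrib power_int_mult mult.commute flip: power_mult)
  finally show ?thesis using assms by (simp add: has_val_def)
qed

lemma has_val_inverse:
  assumes "has_val x d c" shows "has_val (inverse x) d (- c)"
proof -
  have "unit (inverse (x ^ d / of_nat p powi c))"
    using assms unit_inverse unfolding has_val_def by blast
  also have "inverse (x ^ d / of_nat p powi c) = inverse x ^ d / of_nat p powi (- c)"
    by (simp add: power_int_minus field_simps power_inverse)
  finally show ?thesis using assms by (simp add: has_val_def)
qed

lemma has_val_unique:
  assumes "has_val x d c" "has_val x d' c'"
  shows "c * int d' = c' * int d"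
proof -
  have "has_val 1 (d * d') (c * int d' + - c' * int d)"
  proof -
    have "x * inverse x = 1" using assms by (simp add: has_val_def)
    then show ?thesis using has_val_mult[OF assms(1) has_val_inverse[OF assms(2)]] by (simp only:)
  qed
  then have "unit (inverse (of_nat p powi (c * int d' - c' * int d)))"
    by (simp add: has_val_def inverse_eq_divide)
  then show ?thesis using unit_inverse unit_powi_p by (metis inverse_inverse_eq eq_iff_diff_eq_0)
qed

definition val :: "'a \<Rightarrow> real" where
  "val x = (THE r. \<exists>d c. has_val x d c \<and> r = of_int c / of_nat d)"

lemma val_eq:
  assumes "has_val x d c" shows "val x = of_int c / of_nat d"
  unfolding val_def
proof (rule the_equality)
  show "\<exists>d' c'. has_val x d' c' \<and> of_int c / real d = of_int c' / real d'" using assms by blast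
  fix r :: real assume "\<exists>d c. has_val x d c \<and> r = of_int c / of_nat d"
  then obtain d' c' where h: "has_val x d' c'" "r = of_int c' / of_nat d'" by blast
  from has_val_unique[OF assms h(1)] have "real_of_int c * real d' = real_of_int c' * real d"
    by (metis of_int_mult of_int_of_nat_eq)
  moreover have "d > 0" "d' > 0" using h assms by (auto simp: has_val_def)
  ultimately show "r = of_int c / real d" unfolding h(2) by (simp add: frac_eq_eq)
qed

lemma val_mult:
  assumes "has_val x d c" "has_val y d' c'" shows "val (x * y) = val x + val y"
proof -
  have "d > 0" "d' > 0" using assms by (auto simp: has_val_def)
  then show ?thesis
    unfolding val_eq[OF assms(1)] val_eq[OF assms(2)] val_eq[OF has_val_mult[OF assms]]
    by (simp add: field_simps)
qed

lemma val_inverse: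
  assumes "has_val x d c" shows "val (inverse x) = - val x"
  unfolding val_eq[OF assms] val_eq[OF has_val_inverse[OF assms]] by simp

lemma val_nonneg_iff:
  assumes "has_val x d c" shows "val x \<ge> 0 \<longleftrightarrow> x \<in> R"
proof -
  have d: "d > 0" and x: "x \<noteq> 0" and u: "unit (x ^ d / of_nat p powi c)" using assms by (auto simp: has_val_def)
  have c: "val x \<ge> 0 \<longleftrightarrow> c \<ge> 0" using val_eq[OF assms] d by (simp add: zero_le_divide_iff)
  show ?thesis
  proof (cases "c \<ge> 0")
    case True
    have "x ^ d = (x ^ d / of_nat p powi c) * of_nat p powi c" using p0 by simp
    then have eq: "x ^ d = x ^ d / of_nat p powi c * of_nat p ^ nat c" using True by (simp add: power_int_def)
    have "x ^ d \<in> R" by (subst eq, rule closed(4)[OF _ closed(8)[OF closed(9)]]) (use u in \<open>simp add: unit_def\<close>)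
    then show ?thesis using in_R_if_power d c True by blast
  next
    case False
    have "x \<notin> R"
    proof
      assume "x \<in> R"
      have "x ^ d / of_nat p powi c = x ^ d * of_nat p ^ nat (- c)"
        using False by (simp add: power_int_def field_simps power_inverse)
      also have "nat (- c) = Suc (nat (- c) - 1)" using False by simp
      finally have "x ^ d / of_nat p powi c = of_nat p * (x ^ d * of_nat p ^ (nat (- c) - 1))"
        by (simp add: algebra_simps)
      then show False
        using u not_unit_mult_p[OF closed(4)[OF closed(8)[OF \<open>x \<in> R\<close>] closed(8)[OF closed(9)]]] by simp
    qed
    then show ?thesis using c False by simp
  qed
qed

text \<open>After division by the summand of smaller value, the ultrametric inequality is the
  closure of \<open>R\<close> under addition.\<close>

lemma val_add:
  assumes x: "has_val x d c" and y: "has_val y d' c'" and xy: "has_val (x + y) e f"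
  shows "val (x + y) \<ge> min (val x) (val y)"
proof -
  have *: "val (x + y) \<ge> val x" if x: "has_val x d c" and y: "has_val y d' c'"
    and xy: "has_val (x + y) e f" and le: "val x \<le> val y" for x y d c d' c' e f
  proof -
    note q = has_val_mult[OF y has_val_inverse[OF x]]
    have "val (y * inverse x) \<ge> 0" using val_mult[OF y has_val_inverse[OF x]] val_inverse[OF x] le by simp
    then have "y * inverse x \<in> R" using val_nonneg_iff[OF q] by simp
    then have 1: "1 + y * inverse x \<in> R" by (rule closed(6)[OF closed(1)])
    have eq: "(x + y) * inverse x = 1 + y * inverse x" using x by (simp add: has_val_def field_simps)
    note q2 = has_val_mult[OF xy has_val_inverse[OF x]]
    have "val ((x + y) * inverse x) \<ge> 0" using val_nonneg_iff[OF q2] 1 eq by simp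
    then show ?thesis using val_mult[OF xy has_val_inverse[OF x]] val_inverse[OF x] by simp
  qed
  show ?thesis
  proof (cases "val x \<le> val y")
    case True then show ?thesis using *[OF x y xy] by simp
  next
    case False
    have "has_val (y + x) e f" using xy by (simp add: add.commute)
    from *[OF y x this] False show ?thesis by (simp add: add.commute)
  qed
qed

text \<open>Of two elements one divides the other, so their sum is a multiple of a nonunit.\<close>

lemma nonunits_add:
  assumes "x \<in> R" "y \<in> R" "\<not> unit x" "\<not> unit y" shows "\<not> unit (x + y)"
proof -
  have *: "\<not> unit (x + y)" if "y \<noteq> 0" "x / y \<in> R" "y \<in> R" "\<not> unit y" for x y
  proof
    assume u: "unit (x + y)"
    have "inverse y = (1 + x / y) * inverse (x + y)" using that u by (simp add: unit_def field_simps)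
    moreover have "(1 + x / y) * inverse (x + y) \<in> R" using that u closed(1,4,6) by (auto simp: unit_def)
    ultimately show False using that by (simp add: unit_def)
  qed
  show ?thesis
  proof (cases "x = 0 \<or> y = 0")
    case False
    from valuation_ring[of "x / y"] have "x / y \<in> R \<or> y / x \<in> R" by simp
    then show ?thesis using *[of y x] *[of x y] assms False by (auto simp: add.commute)
  qed (use assms in auto)
qed

lemma of_int_has_val: assumes "n \<noteq> 0" shows "\<exists>c. has_val (of_int n) 1 c"
proof -
  define c where "c = multiplicity (int p) n"
  from prime have np: "\<not> is_unit (int p)" by auto
  obtain m where m: "n = int p ^ c * m" "\<not> int p dvd m"
    using multiplicity_decompose'[OF assms np] unfolding c_def by metis
  have "has_val (of_int n) 1 (int c)"
    using unit_of_int[OF m(2)] m assms p0 by (simp add: has_val_def)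
  then show ?thesis ..
qed

lemma val_of_int: assumes "\<not> int p dvd n" shows "val (of_int n) = 0"
proof -
  have "has_val (of_int n) 1 0" using unit_of_int[OF assms] by (simp add: has_val_def unit_def)
  from val_eq[OF this] show ?thesis by simp
qed

lemma val_p: "val (of_nat p) = 1"
proof -
  have "has_val (of_nat p) 1 1" using p0 unit_1 by (simp add: has_val_def)
  from val_eq[OF this] show ?thesis by simp
qed

lemma dvd_minimum:
  assumes "finite S" "S \<noteq> {}" "\<And>i. i \<in> S \<Longrightarrow> y i \<noteq> 0"
  shows "\<exists>i\<in>S. \<forall>j\<in>S. y j / y i \<in> R"
  using assms
proof (induction S rule: finite_ne_induct)
  case (singleton i) then show ?case by (auto simp: closed)
next
  case (insert k S)
  then obtain i where i: "i \<in> S" "\<forall>j\<in>S. y j / y i \<in> R" by auto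
  have nz: "y i \<noteq> 0" "y k \<noteq> 0" using insert i by auto
  from valuation_ring[of "y k / y i"] consider "y k / y i \<in> R" | "y i / y k \<in> R" by auto
  then show ?case
  proof cases
    case 1 then show ?thesis using i by auto
  next
    case 2
    have "y j / y k \<in> R" if "j \<in> S" for j
    proof -
      have "(y j / y i) * (y i / y k) \<in> R" using 2 i(2) that by (intro closed(4)) auto
      then show ?thesis using nz by simp
    qed
    then show ?thesis using nz closed(1) by (intro bexI[of _ k]) auto
  qed
qed

text \<open>In a vanishing integer polynomial two terms must tie for the smallest value. Their
  quotient is a unit, and it is a power of \<open>x\<close> times a quotient of two integers, whose
  values are known.\<close>

lemma algebraic_has_val:
  assumes x: "algebraic x" "x \<noteq> 0"
  shows "\<exists>d c. has_val x d c"
proof -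
  obtain P where P: "\<And>i. coeff P i \<in> \<int>" "P \<noteq> 0" "poly P x = 0" using x(1) unfolding algebraic_def by auto
  define S where "S = {i. coeff P i \<noteq> 0}"
  have fin: "finite S" unfolding S_def
    by (rule finite_subset[of _ "{..degree P}"]) (auto intro: le_degree)
  have ne: "S \<noteq> {}" using P(2) unfolding S_def by (auto simp: poly_eq_iff)
  define y where "y i = coeff P i * x ^ i" for i
  have y0: "y i \<noteq> 0" if "i \<in> S" for i using that x by (simp add: y_def S_def)
  obtain i where i: "i \<in> S" "\<forall>j\<in>S. y j / y i \<in> R" using dvd_minimum[OF fin ne, of y] y0 by blast
  \<comment> \<open>Otherwise, after division by the minimal term, -1 would be a sum of
    nonunits.\<close>
  have "\<exists>j\<in>S - {i}. unit (y j / y i)"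
  proof (rule ccontr)
    assume neg: "\<not> ?thesis"
    have "(\<Sum>j\<in>S. y j) = (\<Sum>j\<le>degree P. y j)"
      by (rule sum.mono_neutral_left) (auto simp: S_def y_def intro: le_degree)
    then have "0 = (\<Sum>j\<in>S. y j)" using P(3) by (simp add: poly_altdef y_def)
    then have "0 = (\<Sum>j\<in>S. y j / y i)" by (simp flip: sum_divide_distrib)
    also have "\<dots> = 1 + (\<Sum>j\<in>S-{i}. y j / y i)" using i fin y0 by (subst sum.remove[of _ i]) auto
    finally have s: "(\<Sum>j\<in>S-{i}. y j / y i) = - 1" by (metis add_eq_0_iff)
    have "(\<Sum>j\<in>A. y j / y i) \<in> R \<and> \<not> unit (\<Sum>j\<in>A. y j / y i)" if "finite A" "A \<subseteq> S - {i}" for A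
      using that
    proof (induction A rule: finite_induct)
      case (insert j A)
      then show ?case using nonunits_add[of "y j / y i"] neg i closed(6) by auto
    qed (auto simp: unit_def closed)
    from this[of "S - {i}"] fin have "\<not> unit (- 1)" unfolding s by simp
    then show False by (simp add: unit_def closed)
  qed
  then obtain j where j: "j \<in> S" "j \<noteq> i" "unit (y j / y i)" by auto
  \<comment> \<open>The distance of the two tied exponents becomes \<open>d\<close>; the values of
    the two coefficients give \<open>c\<close>.\<close>
  have *: "\<exists>d c. has_val x d c" if ij: "i < j" "i \<in> S" "j \<in> S" and u: "unit (y j / y i)" for i j
  proof -
    obtain a where a: "coeff P i = of_int a" using P(1)[of i] by (auto elim: Ints_cases)
    obtain b where b: "coeff P j = of_int b" using P(1)[of j] by (auto elim: Ints_cases)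
    have ab: "a \<noteq> 0" "b \<noteq> 0" using a b ij by (auto simp: S_def)
    obtain ca where ca: "has_val (of_int a) 1 ca" using of_int_has_val ab by blast
    obtain cb where cb: "has_val (of_int b) 1 cb" using of_int_has_val ab by blast
    note h = has_val_mult[OF ca has_val_inverse[OF cb]]
    have xj: "x ^ j = x ^ (j - i) * x ^ i" using ij by (simp flip: power_add)
    have "unit (y j / y i * (of_int a * inverse (of_int b) / of_nat p powi (ca - cb)))"
      using u h by (intro unit_mult) (auto simp: has_val_def)
    also have "y j / y i * (of_int a * inverse (of_int b) / of_nat p powi (ca - cb)) = x ^ (j - i) / of_nat p powi (ca - cb)"
      unfolding y_def a b xj using ab x by (simp add: field_simps)
    finally have "has_val x (j - i) (ca - cb)" using ij x by (simp add: has_val_def)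
    then show ?thesis by blast
  qed
  show ?thesis
  proof (cases "i < j")
    case True then show ?thesis using * i j by blast
  next
    case False
    have "unit (y i / y j)" using unit_inverse[OF j(3)] by simp
    then show ?thesis using *[of j i] i j False by auto
  qed
qed

end

lemma not_in_Ints_inverse_prime:
  assumes "prime p" shows "inverse (of_nat p :: 'a::field_char_0) \<notin> \<int>"
proof
  assume "inverse (of_nat p :: 'a) \<in> \<int>"
  then obtain k where "inverse (of_nat p :: 'a) = of_int k" by (auto elim: Ints_cases)
  then have "of_int (int p * k) = (1::'a)" using assms by (auto simp: field_simps)
  then have "int p * k = 1" by (metis of_int_eq_1_iff)
  then have "int p dvd 1" by (metis dvd_triv_left)
  then show False using assms by auto
qed

text \<open>Zorn's lemma is applied to the subrings that contain the integers but not 1/p. Closure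
  of \<open>K\<close> under addition ensures that a nonzero sum is again algebraic and so has a
  value.\<close>

lemma ex_padic_valuation:
  assumes p: "prime p" and K: "\<And>x y. x \<in> K \<Longrightarrow> y \<in> K \<Longrightarrow> x + y \<in> K" "\<And>x. x \<in> K \<Longrightarrow> algebraic x"
  obtains v :: "'a::field_char_0 \<Rightarrow> real" where
    "\<And>x y. x \<in> K \<Longrightarrow> y \<in> K \<Longrightarrow> x \<noteq> 0 \<Longrightarrow> y \<noteq> 0 \<Longrightarrow> v (x * y) = v x + v y"
    "\<And>x y. x \<in> K \<Longrightarrow> y \<in> K \<Longrightarrow> x \<noteq> 0 \<Longrightarrow> y \<noteq> 0 \<Longrightarrow> x + y \<noteq> 0 \<Longrightarrow> v (x + y) \<ge> min (v x) (v y)"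
    "v (of_nat p) = 1" "\<And>n. \<not> int p dvd n \<Longrightarrow> v (of_int n) = 0"
proof -
  have "\<exists>R :: 'a set. maximal_subring R (of_nat p)"
  proof (rule ex_maximal_subring)
    show "is_subring (\<int> :: 'a set)" by (auto simp: is_subring_def)
  qed (use p not_in_Ints_inverse_prime[OF p] in auto)
  then obtain R :: "'a set" where "maximal_subring R (of_nat p)" ..
  then interpret padic_subring R p using p by (simp add: padic_subring_def padic_subring_axioms_def)
  have h: "\<exists>d c. has_val x d c" if "x \<in> K" "x \<noteq> 0" for x using algebraic_has_val K that by blast
  show ?thesis
  proof (rule that[of val])
    show "val (of_nat p) = 1" by (rule val_p)
    show "\<not> int p dvd n \<Longrightarrow> val (of_int n) = 0" for n by (rule val_of_int)
    fix x y assume *: "x \<in> K" "y \<in> K" "x \<noteq> 0" "y \<noteq> 0"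
    from h * obtain d c d' c' where xy: "has_val x d c" "has_val y d' c'" by metis
    show "val (x * y) = val x + val y" using val_mult xy by blast
    assume "x + y \<noteq> 0"
    with h K(1)[OF *(1,2)] obtain e f where "has_val (x + y) e f" by metis
    then show "val (x + y) \<ge> min (val x) (val y)" using val_add xy by blast
  qed
qed

section \<open>Galois groups of splitting fields in the complex numbers\<close>

abbreviation cpoly :: "rat poly \<Rightarrow> complex poly" where "cpoly \<equiv> map_poly of_rat"
abbreviation evalq :: "rat poly \<Rightarrow> complex \<Rightarrow> complex" where "evalq P z \<equiv> poly (cpoly P) z"

lemma cpoly_hom:
  "cpoly (P + Q) = cpoly P + cpoly Q" "cpoly (P - Q) = cpoly P - cpoly Q"
  "cpoly (P * Q) = cpoly P * cpoly Q" "cpoly (pCons a P) = pCons (of_rat a) (cpoly P)"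
  "cpoly (smult a P) = smult (of_rat a) (cpoly P)" "cpoly (- P) = - cpoly P"
  "cpoly (monom a n) = monom (of_rat a) n"
  by (rule poly_eqI; simp add: coeff_map_poly of_rat_add of_rat_diff coeff_mult of_rat_sum of_rat_mult
      coeff_pCons of_rat_minus split: nat.splits)+

lemma cpoly_pderiv: "cpoly (pderiv P) = pderiv (cpoly P)"
  by (rule poly_eqI) (simp add: coeff_map_poly coeff_pderiv of_rat_mult of_rat_add)

lemma degree_cpoly [simp]: "degree (cpoly P) = degree P"
  by (rule degree_map_poly) simp

lemma cpoly_eq_0_iff [simp]: "cpoly P = 0 \<longleftrightarrow> P = 0"
  by (rule map_poly_eq_0_iff) auto

lemma evalq_dvd: "P dvd Q \<Longrightarrow> evalq P z = 0 \<Longrightarrow> evalq Q z = 0"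
  by (auto elim!: dvdE simp: cpoly_hom)

lemma algebraic_iff_evalq: "algebraic (z::complex) \<longleftrightarrow> (\<exists>P. P \<noteq> 0 \<and> evalq P z = 0)"
proof
  assume "algebraic z"
  then obtain p where p: "\<forall>i. coeff p i \<in> \<rat>" "p \<noteq> 0" "poly p z = 0" by (auto simp: algebraic_altdef)
  define P where "P = map_poly (inv (of_rat :: rat \<Rightarrow> complex)) p"
  have 0: "inv (of_rat :: rat \<Rightarrow> complex) 0 = 0"
    by (rule inv_f_eq) (auto simp: inj_on_def)
  have "cpoly P = p"
  proof (rule poly_eqI)
    fix i
    have "coeff p i \<in> range (of_rat :: rat \<Rightarrow> complex)" using p by (simp add: Rats_def)
    then have "of_rat (inv of_rat (coeff p i)) = coeff p i" by (rule f_inv_into_f)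
    then show "coeff (cpoly P) i = coeff p i" by (simp add: P_def coeff_map_poly 0)
  qed
  then show "\<exists>P. P \<noteq> 0 \<and> evalq P z = 0" using p by (intro exI[of _ P]) auto
next
  assume "\<exists>P. P \<noteq> 0 \<and> evalq P z = 0"
  then obtain P where "P \<noteq> 0" "evalq P z = 0" by blast
  then show "algebraic z" unfolding algebraic_altdef
    by (intro exI[of _ "cpoly P"]) (auto simp: coeff_map_poly)
qed

lemma poly_bezout:
  fixes P Q :: "'a::field poly"
  assumes "P \<noteq> 0"
  obtains g u w where "g dvd P" "g dvd Q" "u * P + w * Q = g"
proof -
  define I where "I = {u * P + w * Q | u w. u * P + w * Q \<noteq> 0}"
  have "P \<in> I" unfolding I_def using assms by (intro CollectI exI[of _ 1] exI[of _ 0]) simp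
  then obtain g where g: "g \<in> I" "\<forall>R\<in>I. degree g \<le> degree R"
    using ex_has_least_nat[of "\<lambda>R. R \<in> I" _ degree] by blast
  then obtain u w where uw: "g = u * P + w * Q" "g \<noteq> 0" by (auto simp: I_def)
  have dvd: "g dvd a * P + b * Q" for a b
  proof -
    define R where "R = a * P + b * Q"
    define d where "d = R div g"
    have "d * g = d * (u * P + w * Q)" using uw(1) by simp
    moreover have "R mod g = R - d * g" by (simp add: minus_div_mult_eq_mod d_def)
    ultimately have "R mod g = R - d * (u * P + w * Q)" by simp
    then have eq: "R mod g = (a - d * u) * P + (b - d * w) * Q"
      by (simp only: R_def) (simp add: algebra_simps)
    have "R mod g = 0"
    proof (rule ccontr)
      assume "R mod g \<noteq> 0"
      then have "R mod g \<in> I" unfolding I_def by (intro CollectI exI[of _ "a - d * u"] exI[of _ "b - d * w"]) (use eq in simp)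
      then have "degree g \<le> degree (R mod g)" using g(2) by blast
      then show False using degree_mod_less[OF uw(2), of R] \<open>R mod g \<noteq> 0\<close> by simp
    qed
    then show ?thesis by (simp add: R_def dvd_eq_mod_eq_0)
  qed
  show ?thesis
  proof (rule that)
    show "g dvd P" "g dvd Q" using dvd[of 1 0] dvd[of 0 1] by simp_all
    show "u * P + w * Q = g" by (rule uw(1)[symmetric])
  qed
qed

text \<open>Squarefreeness is separability in characteristic 0. With \<open>g\<close> a common
  divisor of \<open>h\<close> and its derivative obtained from Bezout and h = g * s, minimality of
  the degree forces either \<open>h\<close> to divide its own derivative, which is impossible, or
  \<open>g\<close> to be constant, so that there is no common root.\<close>

lemma ex_minpoly:
  assumes "algebraic \<theta>"
  shows "\<exists>h. h \<noteq> 0 \<and> (\<forall>P. evalq P \<theta> = 0 \<longleftrightarrow> h dvd P) \<and> degree h > 0 \<and> rsquarefree (cpoly h)"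
proof -
  define A where "A = {P. P \<noteq> 0 \<and> evalq P \<theta> = 0}"
  have "\<exists>P. P \<in> A" using assms by (auto simp: algebraic_iff_evalq A_def)
  then obtain h where h: "h \<in> A" "\<forall>P\<in>A. degree h \<le> degree P"
    using ex_has_least_nat[of "\<lambda>P. P \<in> A" _ degree] by blast
  have h0: "h \<noteq> 0" and hz: "evalq h \<theta> = 0" using h by (auto simp: A_def)
  have dvd: "evalq P \<theta> = 0 \<longleftrightarrow> h dvd P" for P
  proof
    assume "h dvd P" then show "evalq P \<theta> = 0" using evalq_dvd hz by blast
  next
    assume P: "evalq P \<theta> = 0"
    have "evalq (P mod h) \<theta> = 0"
      using P hz by (simp add: cpoly_hom minus_div_mult_eq_mod[symmetric])
    then have "P mod h = 0" using h degree_mod_less[OF h0, of P] by (fastforce simp: A_def)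
    then show "h dvd P" by (simp add: dvd_eq_mod_eq_0)
  qed
  have deg: "degree h > 0"
  proof (rule ccontr)
    assume "\<not> degree h > 0"
    then obtain c where "h = [:c:]" by (metis degree_eq_zeroE not_gr_zero)
    then show False using h0 hz by (simp add: cpoly_hom)
  qed
  have "rsquarefree (cpoly h)" unfolding rsquarefree_roots
  proof (intro allI notI)
    fix a assume a: "poly (cpoly h) a = 0 \<and> poly (pderiv (cpoly h)) a = 0"
    obtain g u w where g: "g dvd h" "g dvd pderiv h" and uw: "u * h + w * pderiv h = g"
      using poly_bezout[OF h0] .
    obtain s where s: "h = g * s" using g by (auto elim: dvdE)
    have g0: "g \<noteq> 0" "s \<noteq> 0" using s h0 by auto
    have "evalq g \<theta> = 0 \<or> evalq s \<theta> = 0" using hz s by (simp add: cpoly_hom)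
    then show False
    proof
      assume "evalq g \<theta> = 0"
      then have "h dvd pderiv h" using dvd[of g] using g by (meson dvd_trans)
      moreover have "pderiv h \<noteq> 0" using deg by (simp add: pderiv_eq_0_iff)
      ultimately have "degree h \<le> degree (pderiv h)" by (rule dvd_imp_degree_le)
      then show False using deg by (simp add: degree_pderiv)
    next
      assume "evalq s \<theta> = 0"
      then have "degree h \<le> degree s" using dvd[of s] g0 by (simp add: dvd_imp_degree_le)
      then have "degree g = 0" using s g0 by (simp add: degree_mult_eq)
      then obtain c where c: "g = [:c:]" by (metis degree_eq_zeroE)
      have "evalq g a = 0" unfolding uw[symmetric] using a by (simp add: cpoly_hom cpoly_pderiv)
      then show False using c g0 by (simp add: cpoly_hom)
    qed
  qed
  then show ?thesis using h0 dvd deg by blast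
qed

section \<open>Algebraic numbers through finite-dimensional rational vector spaces\<close>

interpretation Q: vector_space "\<lambda>(r::rat) (x::complex). of_rat r * x"
  by standard (auto simp: algebra_simps of_rat_add of_rat_mult)

text \<open>All powers of \<open>x\<close> lie in one finite-dimensional space and are therefore
  linearly dependent. This gives algebraicity of sums and polynomial values without
  resultants.\<close>

lemma algebraic_if_stable:
  assumes "finite B" "1 \<in> Q.span B" "\<And>y. y \<in> Q.span B \<Longrightarrow> x * y \<in> Q.span B"
  shows "algebraic x"
proof -
  have pow: "x ^ i \<in> Q.span B" for i by (induction i) (use assms in auto)
  \<comment> \<open>The dimension count concerns the set of powers, which is large enough only if
    the powers are distinct. A coincidence of two powers is itself a polynomial relation.\<close>
  show ?thesis
  proof (cases "inj (\<lambda>i. x ^ i)")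
    case False
    then obtain i j where ij: "i \<noteq> j" "x ^ i = x ^ j" by (auto simp: inj_def)
    have "coeff (monom (1::rat) i - monom 1 j) i \<noteq> 0" using ij by simp
    then have "monom (1::rat) i - monom 1 j \<noteq> 0" by (metis coeff_0)
    then show ?thesis unfolding algebraic_iff_evalq
      using ij by (intro exI[of _ "monom 1 i - monom 1 j"]) (auto simp: cpoly_hom poly_monom)
  next
    case True
    define S where "S = (\<lambda>i. x ^ i) ` {..card B}"
    have cS: "card S = Suc (card B)" using True by (simp add: S_def card_image inj_on_subset)
    have "\<not> Q.independent S"
      using Q.independent_span_bound[OF assms(1), of S] pow cS by (auto simp: S_def)
    then obtain u where u: "\<exists>v\<in>S. u v \<noteq> 0" "(\<Sum>v\<in>S. of_rat (u v) * v) = 0"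
      using Q.dependent_finite[of S] by (auto simp: S_def)
    define P where "P = (\<Sum>i\<le>card B. monom (u (x ^ i)) i)"
    have "evalq P x = (\<Sum>i\<le>card B. of_rat (u (x ^ i)) * x ^ i)"
    proof -
      have "evalq (\<Sum>i\<in>A. monom (u (x ^ i)) i) x = (\<Sum>i\<in>A. of_rat (u (x ^ i)) * x ^ i)" for A
        by (induction A rule: infinite_finite_induct) (auto simp: cpoly_hom poly_monom)
      then show ?thesis by (simp add: P_def)
    qed
    also have "\<dots> = (\<Sum>v\<in>S. of_rat (u v) * v)"
      unfolding S_def using True by (subst sum.reindex) (auto intro: inj_on_subset)
    finally have "evalq P x = 0" using u by simp
    moreover have "P \<noteq> 0"
    proof -
      obtain i where i: "i \<le> card B" "u (x ^ i) \<noteq> 0" using u by (auto simp: S_def)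
      have "coeff P i = u (x ^ i)" using i by (simp add: P_def coeff_sum)
      then show ?thesis using i by auto
    qed
    ultimately show ?thesis by (auto simp: algebraic_iff_evalq)
  qed
qed

text \<open>The space is spanned by the products a^i b^j with exponents below the degrees of
  relations for \<open>a\<close> and \<open>b\<close>; multiplication leads out of the spanning set
  only at the top power, which the relation reduces.\<close>

lemma ex_stable_span:
  fixes a b :: complex
  assumes a: "algebraic a" and b: "algebraic b"
  obtains B where "finite B" "1 \<in> Q.span B"
    "\<And>y. y \<in> Q.span B \<Longrightarrow> a * y \<in> Q.span B" "\<And>y. y \<in> Q.span B \<Longrightarrow> b * y \<in> Q.span B"
proof -
  have pw: "\<exists>n c. n > 0 \<and> x ^ n = (\<Sum>i<n. of_rat (c i) * x ^ i)" if "algebraic x" for x :: complex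
  proof -
    obtain P where P: "P \<noteq> 0" "evalq P x = 0" using \<open>algebraic x\<close> by (auto simp: algebraic_iff_evalq)
    define n where "n = degree P"
    have n0: "n > 0"
    proof (rule ccontr)
      assume "\<not> n > 0"
      then obtain c where "P = [:c:]" by (metis degree_eq_zeroE not_gr_zero n_def)
      then show False using P by (simp add: cpoly_hom)
    qed
    define l where "l = lead_coeff P"
    have l0: "l \<noteq> 0" using P by (simp add: l_def)
    have rl0: "of_rat l \<noteq> (0::complex)" using l0 by simp
    have "0 = (\<Sum>i\<le>n. of_rat (coeff P i) * x ^ i)" using P(2) by (simp add: poly_altdef n_def coeff_map_poly)
    also have "\<dots> = (\<Sum>i<n. of_rat (coeff P i) * x ^ i) + of_rat l * x ^ n"
      by (simp add: lessThan_Suc_atMost[symmetric] l_def n_def)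
    finally have "of_rat l * x ^ n = - (\<Sum>i<n. of_rat (coeff P i) * x ^ i)"
      by (metis add.commute add_eq_0_iff)
    also have "\<dots> = (\<Sum>i<n. - of_rat (coeff P i) * x ^ i)" by (simp add: sum_negf)
    finally have "x ^ n = (\<Sum>i<n. - of_rat (coeff P i) * x ^ i) / of_rat l"
      using rl0 by (metis nonzero_mult_div_cancel_left)
    also have "\<dots> = (\<Sum>i<n. of_rat (- coeff P i / l) * x ^ i)"
      unfolding sum_divide_distrib by (rule sum.cong) (auto simp: of_rat_divide of_rat_minus)
    finally show ?thesis using n0 by (intro exI[of _ n] exI conjI)
  qed
  obtain n c where n: "n > 0" "a ^ n = (\<Sum>i<n. of_rat (c i) * a ^ i)" using pw[OF a] by blast
  obtain m d where m: "m > 0" "b ^ m = (\<Sum>i<m. of_rat (d i) * b ^ i)" using pw[OF b] by blast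
  define B where "B = (\<lambda>(i,j). a ^ i * b ^ j) ` ({..<n} \<times> {..<m})"
  have mem: "a ^ i * b ^ j \<in> Q.span B" if "i < n" "j < m" for i j
    using that by (intro Q.span_base) (auto simp: B_def)
  have stable: "x * y \<in> Q.span B" if y: "y \<in> Q.span B" and g: "\<And>i j. i < n \<Longrightarrow> j < m \<Longrightarrow> x * (a ^ i * b ^ j) \<in> Q.span B" for x y
    using y
  proof (induction rule: Q.span_induct_alt)
    case base then show ?case by (simp add: Q.span_zero)
  next
    case (step r z w)
    then have "x * z \<in> Q.span B" using g by (auto simp: B_def)
    then have "of_rat r * (x * z) + x * w \<in> Q.span B" using step by (intro Q.span_add Q.span_scale)
    then show ?case by (simp add: algebra_simps)
  qed
  show ?thesis
  proof (rule that[of B])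
    show "finite B" by (simp add: B_def)
    show "1 \<in> Q.span B" using mem[of 0 0] n m by simp
    fix y assume y: "y \<in> Q.span B"
    show "a * y \<in> Q.span B" using y
    proof (rule stable)
      fix i j assume ij: "i < n" "j < m"
      show "a * (a ^ i * b ^ j) \<in> Q.span B"
      proof (cases "Suc i < n")
        case True then show ?thesis using mem[of "Suc i" j] ij by (simp add: mult.assoc)
      next
        case False
        then have "Suc i = n" using ij by simp
        then have "a * (a ^ i * b ^ j) = a ^ n * b ^ j" by (metis mult.assoc power_Suc)
        also have "\<dots> = (\<Sum>i<n. of_rat (c i) * (a ^ i * b ^ j))" by (simp add: n(2) sum_distrib_right mult.assoc)
        also have "\<dots> \<in> Q.span B" using mem ij by (intro Q.span_sum Q.span_scale) auto
        finally show ?thesis .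
      qed
    qed
    show "b * y \<in> Q.span B" using y
    proof (rule stable)
      fix i j assume ij: "i < n" "j < m"
      show "b * (a ^ i * b ^ j) \<in> Q.span B"
      proof (cases "Suc j < m")
        case True then show ?thesis using mem[of i "Suc j"] ij by (simp add: mult_ac)
      next
        case False
        then have "Suc j = m" using ij by simp
        then have "b * (a ^ i * b ^ j) = a ^ i * b ^ m" by (metis mult.assoc mult.commute power_Suc)
        also have "\<dots> = (\<Sum>j<m. of_rat (d j) * (a ^ i * b ^ j))" by (simp add: m(2) sum_distrib_left mult_ac)
        also have "\<dots> \<in> Q.span B" using mem ij by (intro Q.span_sum Q.span_scale) auto
        finally show ?thesis .
      qed
    qed
  qed
qed

lemma algebraic_linear_comb:
  fixes a b :: complex
  assumes "algebraic a" "algebraic b" shows "algebraic (a + of_rat c * b)"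
proof -
  obtain B where B: "finite B" "1 \<in> Q.span B"
    "\<And>y. y \<in> Q.span B \<Longrightarrow> a * y \<in> Q.span B" "\<And>y. y \<in> Q.span B \<Longrightarrow> b * y \<in> Q.span B"
    using ex_stable_span assms by blast
  show ?thesis using B(1,2)
  proof (rule algebraic_if_stable)
    fix y assume y: "y \<in> Q.span B"
    have "a * y + of_rat c * (b * y) \<in> Q.span B" using B y by (intro Q.span_add Q.span_scale) auto
    then show "(a + of_rat c * b) * y \<in> Q.span B" by (simp add: algebra_simps)
  qed
qed

lemma algebraic_evalq:
  fixes a :: complex
  assumes "algebraic a" shows "algebraic (evalq P a)"
proof -
  obtain B where B: "finite B" "1 \<in> Q.span B" "\<And>y. y \<in> Q.span B \<Longrightarrow> a * y \<in> Q.span B"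
    using ex_stable_span[OF assms assms] by metis
  show ?thesis using B(1,2)
  proof (rule algebraic_if_stable)
    show "evalq P a * y \<in> Q.span B" if "y \<in> Q.span B" for y
      using that
    proof (induction P arbitrary: y)
      case (pCons r P)
      have "of_rat r * y + a * (evalq P a * y) \<in> Q.span B" using pCons B by (intro Q.span_add Q.span_scale) auto
      then show ?case by (simp add: cpoly_hom algebra_simps)
    qed (simp add: Q.span_zero)
  qed
qed

section \<open>Simple extensions and primitive elements\<close>

definition Qgen :: "complex \<Rightarrow> complex set" where "Qgen \<theta> = range (\<lambda>P. evalq P \<theta>)"

lemma is_subfieldD:
  assumes "is_subfield K"
  shows "0 \<in> K" "1 \<in> K" "x \<in> K \<Longrightarrow> y \<in> K \<Longrightarrow> x + y \<in> K" "x \<in> K \<Longrightarrow> y \<in> K \<Longrightarrow> x * y \<in> K"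
    "x \<in> K \<Longrightarrow> - x \<in> K" "x \<in> K \<Longrightarrow> inverse x \<in> K" "x \<in> K \<Longrightarrow> y \<in> K \<Longrightarrow> x - y \<in> K"
    "x \<in> K \<Longrightarrow> y \<in> K \<Longrightarrow> x / y \<in> K" "x \<in> K \<Longrightarrow> x ^ n \<in> K"
proof -
  show a: "0 \<in> K" "1 \<in> K" "x \<in> K \<Longrightarrow> y \<in> K \<Longrightarrow> x + y \<in> K" "x \<in> K \<Longrightarrow> y \<in> K \<Longrightarrow> x * y \<in> K"
    "x \<in> K \<Longrightarrow> - x \<in> K" "x \<in> K \<Longrightarrow> inverse x \<in> K" for x y using assms by (auto simp: is_subfield_def)
  show "x \<in> K \<Longrightarrow> y \<in> K \<Longrightarrow> x - y \<in> K" using a(3)[of x "- y"] a(5)[of y] by simp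
  show "x \<in> K \<Longrightarrow> y \<in> K \<Longrightarrow> x / y \<in> K" using a(4)[of x "inverse y"] a(6)[of y] by (simp add: divide_inverse)
  show "x \<in> K \<Longrightarrow> x ^ n \<in> K" by (induction n) (use a in auto)
qed

lemma subfield_sum: "is_subfield K \<Longrightarrow> (\<And>i. i \<in> A \<Longrightarrow> f i \<in> K) \<Longrightarrow> sum f A \<in> K"
  by (induction A rule: infinite_finite_induct) (auto intro: is_subfieldD)

lemma subfield_prod: "is_subfield K \<Longrightarrow> (\<And>i. i \<in> A \<Longrightarrow> f i \<in> K) \<Longrightarrow> prod f A \<in> K"
  by (induction A rule: infinite_finite_induct) (auto intro: is_subfieldD)

lemma subfield_of_rat: assumes "is_subfield K" shows "of_rat r \<in> K"
proof -
  have n: "of_nat n \<in> K" for n by (induction n) (auto intro: is_subfieldD[OF assms])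
  have i: "of_int n \<in> K" for n by (cases n rule: int_cases2) (auto intro: is_subfieldD[OF assms] n)
  obtain a b where "r = Fract a b" "b > 0" by (cases r) auto
  then show ?thesis using is_subfieldD(8)[OF assms i[of a] i[of b]] by (simp add: of_rat_rat)
qed

lemma subfield_evalq: assumes "is_subfield K" "x \<in> K" shows "evalq P x \<in> K"
  by (induction P) (auto intro!: is_subfieldD[OF assms(1)] assms subfield_of_rat simp: cpoly_hom)

lemma Qgen_subset: "is_subfield K \<Longrightarrow> x \<in> K \<Longrightarrow> Qgen x \<subseteq> K"
  by (auto simp: Qgen_def subfield_evalq)

lemma self_in_Qgen: "x \<in> Qgen x"
  unfolding Qgen_def by (rule range_eqI[of _ _ "[:0,1:]"]) (simp add: cpoly_hom)

text \<open>Inverses come from Bezout. If P does not vanish at \<theta>, neither does its common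
  divisor with the minimal polynomial \<open>h\<close>, so by minimality this divisor is a
  constant.\<close>

lemma is_subfield_Qgen:
  assumes "algebraic \<theta>" shows "is_subfield (Qgen \<theta>)"
proof -
  obtain h where h: "h \<noteq> 0" "\<And>P. evalq P \<theta> = 0 \<longleftrightarrow> h dvd P" "degree h > 0" "rsquarefree (cpoly h)"
    using ex_minpoly[OF assms] by blast
  have c: "evalq P \<theta> \<in> Qgen \<theta>" for P by (auto simp: Qgen_def)
  have inv: "inverse (evalq P \<theta>) \<in> Qgen \<theta>" for P
  proof (cases "evalq P \<theta> = 0")
    case True then show ?thesis using c[of 0] by simp
  next
    case False
    obtain g u w where g: "g dvd h" "g dvd P" and uw: "w * P + u * h = g"
      using poly_bezout[OF h(1), of P] by (metis add.commute)
    obtain s where s: "h = g * s" using g by (auto elim: dvdE)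
    have g0: "g \<noteq> 0" "s \<noteq> 0" using s h(1) by auto
    have "evalq g \<theta> = 0 \<or> evalq s \<theta> = 0" using h(2)[of h] s by (simp add: cpoly_hom)
    moreover have "evalq g \<theta> \<noteq> 0" using False evalq_dvd[of g P] g by auto
    ultimately have "h dvd s" using h by blast
    then have "degree h \<le> degree s" using g0 by (simp add: dvd_imp_degree_le)
    then have "degree g = 0" using s g0 by (simp add: degree_mult_eq)
    then obtain k where k: "g = [:k:]" by (metis degree_eq_zeroE)
    then have k0: "k \<noteq> 0" using g0 by auto
    have "evalq (w * P + u * h) \<theta> = of_rat k" unfolding uw k by (simp add: cpoly_hom)
    then have "evalq w \<theta> * evalq P \<theta> = of_rat k" using h(2)[of h] by (simp add: cpoly_hom)
    moreover have "of_rat k \<noteq> (0::complex)" using k0 by simp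
    ultimately have "inverse (evalq P \<theta>) = of_rat (inverse k) * evalq w \<theta>"
      using False k0 by (simp only: of_rat_inverse) (simp add: divide_simps mult.commute)
    also have "\<dots> = evalq (smult (inverse k) w) \<theta>" by (simp add: cpoly_hom)
    finally show ?thesis using c by metis
  qed
  show ?thesis unfolding is_subfield_def
  proof (intro conjI ballI)
    show "0 \<in> Qgen \<theta>" using c[of 0] by simp
    show "1 \<in> Qgen \<theta>" using c[of "[:1:]"] by (simp add: cpoly_hom)
    fix x assume "x \<in> Qgen \<theta>" then obtain P where P: "x = evalq P \<theta>" by (auto simp: Qgen_def)
    show "- x \<in> Qgen \<theta>" using c[of "- P"] P by (simp add: cpoly_hom)
    show "inverse x \<in> Qgen \<theta>" using inv P by simp
    fix y assume "y \<in> Qgen \<theta>" then obtain R where R: "y = evalq R \<theta>" by (auto simp: Qgen_def)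
    show "x + y \<in> Qgen \<theta>" using c[of "P + R"] P R by (simp add: cpoly_hom)
    show "x * y \<in> Qgen \<theta>" using c[of "P * R"] P R by (simp add: cpoly_hom)
  qed
qed

text \<open>Long division stays inside the subfield generated by the coefficients. It serves to show
  that a polynomial of least degree over \<open>K\<close> divides all others vanishing at the same
  point.\<close>

lemma subfield_poly_division:
  assumes K: "is_subfield K" and D: "\<forall>i. coeff D i \<in> K" "D \<noteq> 0"
  shows "(\<forall>i. coeff P i \<in> K) \<Longrightarrow> \<exists>A R. (\<forall>i. coeff A i \<in> K) \<and> (\<forall>i. coeff R i \<in> K) \<and> P = A * D + R \<and> (R = 0 \<or> degree R < degree D)"
proof (induction "degree P" arbitrary: P rule: less_induct)
  case less
  show ?case
  proof (cases "P = 0 \<or> degree P < degree D")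
    case True
    then show ?thesis using less by (intro exI[of _ 0] exI[of _ P]) (auto intro: is_subfieldD[OF K])
  next
    case False
    define n d where "n = degree P" and "d = degree D"
    define c where "c = lead_coeff P / lead_coeff D"
    have cK: "c \<in> K" using less D by (auto simp: c_def intro: is_subfieldD[OF K])
    define P' where "P' = P - monom c (n - d) * D"
    have dn: "d \<le> n" using False by (simp add: n_def d_def)
    have P'K: "\<forall>i. coeff P' i \<in> K" using less D cK
      by (auto simp: P'_def coeff_monom_mult intro!: is_subfieldD[OF K])
    have "P' = 0 \<or> degree P' < n"
    proof -
      have "degree P' \<le> n" unfolding P'_def
        by (rule degree_diff_le) (use dn degree_mult_le[of "monom c (n - d)" D] degree_monom_le[of c "n - d"] in \<open>auto simp: n_def d_def\<close>)
      moreover have "coeff P' n = 0" using dn D by (simp add: P'_def coeff_monom_mult c_def n_def d_def)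
      ultimately show ?thesis by (metis leading_coeff_0_iff le_neq_implies_less)
    qed
    then have "\<exists>A R. (\<forall>i. coeff A i \<in> K) \<and> (\<forall>i. coeff R i \<in> K) \<and> P' = A * D + R \<and> (R = 0 \<or> degree R < degree D)"
    proof
      assume "P' = 0" then show ?thesis by (intro exI[of _ 0] exI[of _ 0]) (auto intro: is_subfieldD[OF K])
    next
      assume "degree P' < n" then show ?thesis using less.hyps[of P'] P'K by (simp add: n_def)
    qed
    then obtain A R where AR: "\<forall>i. coeff A i \<in> K" "\<forall>i. coeff R i \<in> K" "P' = A * D + R" "R = 0 \<or> degree R < degree D"
      by blast
    have "P = (A + monom c (n - d)) * D + R" using AR(3) by (simp add: P'_def algebra_simps)
    moreover have "\<forall>i. coeff (A + monom c (n - d)) i \<in> K" using AR cK by (auto intro!: is_subfieldD[OF K])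
    ultimately show ?thesis using AR by blast
  qed
qed

text \<open>The classical argument: for all but finitely many c, \<open>b\<close> is the only common
  root of \<open>g\<close> and of the polynomial f(\<theta> - c x), whose coefficients lie in
  Q(\<theta>). The minimal polynomial of \<open>b\<close> over that field divides both, so it is
  linear.\<close>

lemma primitive_element_two:
  assumes a: "algebraic a" and b: "algebraic b"
  obtains c :: rat where "a \<in> Qgen (a + of_rat c * b)" "b \<in> Qgen (a + of_rat c * b)"
proof -
  obtain f where f: "f \<noteq> 0" "evalq f a = 0" using a by (auto simp: algebraic_iff_evalq)
  obtain g where g: "g \<noteq> 0" "\<And>P. evalq P b = 0 \<longleftrightarrow> g dvd P" "degree g > 0" "rsquarefree (cpoly g)"
    using ex_minpoly[OF b] by blast
  have gb: "evalq g b = 0" using g by simp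
  \<comment> \<open>Pairs with y = b have denominator 0 and contribute the value 0, so they exclude
    only n = 0.\<close>
  define bad where "bad = (\<lambda>(x,y). (x - a) / (b - y)) ` ({x. evalq f x = 0} \<times> {y. evalq g y = 0})"
  have "finite bad" unfolding bad_def using f g by (intro finite_imageI finite_cartesian_product poly_roots_finite) auto
  then have "\<not> range (of_nat :: nat \<Rightarrow> complex) \<subseteq> bad"
    using infinite_UNIV_nat finite_subset finite_imageD[of of_nat "UNIV::nat set"] inj_of_nat by blast
  then obtain n where n: "(of_nat n :: complex) \<notin> bad" by auto
  define c :: rat where "c = of_nat n"
  define \<theta> where "\<theta> = a + of_rat c * b"
  define K where "K = Qgen \<theta>"
  have K: "is_subfield K" unfolding K_def \<theta>_def by (intro is_subfield_Qgen algebraic_linear_comb a b)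
  have \<theta>K: "\<theta> \<in> K" by (simp add: K_def self_in_Qgen)
  have c: "of_rat c = (of_nat n :: complex)" by (simp add: c_def)
  define F where "F = pcompose (cpoly f) [:\<theta>, - of_rat c:]"
  have FK: "\<forall>i. coeff F i \<in> K"
  proof -
    have "\<forall>i. coeff (pcompose (cpoly f) [:\<theta>, - of_rat c:]) i \<in> K" for f
    proof (induction f)
      case (pCons r f)
      have l: "coeff [:\<theta>, - of_rat c:] i \<in> K" for i
        by (auto simp: coeff_pCons subfield_of_rat[OF K] \<theta>K is_subfieldD(1,5)[OF K] split: nat.splits)
      have r: "coeff [:of_rat r:] i \<in> K" for i
        by (auto simp: coeff_pCons subfield_of_rat[OF K] is_subfieldD(1)[OF K] split: nat.splits)
      have "coeff ([:\<theta>, - of_rat c:] * pcompose (cpoly f) [:\<theta>, - of_rat c:]) i \<in> K" for i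
        unfolding coeff_mult using l pCons by (intro subfield_sum[OF K] is_subfieldD(4)[OF K]) auto
      then show ?case unfolding cpoly_hom pcompose_pCons coeff_add using r is_subfieldD(3)[OF K] by blast
    qed (simp add: is_subfieldD[OF K])
    then show ?thesis by (simp add: F_def)
  qed
  have Froot: "poly F x = evalq f (\<theta> - of_rat c * x)" for x
    by (simp add: F_def poly_pcompose algebra_simps)
  have Fb: "poly F b = 0" using f by (simp add: Froot \<theta>_def)
  have only_b: "y = b" if "poly F y = 0" "evalq g y = 0" for y
  proof (rule ccontr)
    assume "y \<noteq> b"
    then have "(\<theta> - of_rat c * y - a) / (b - y) = of_nat n"
      by (simp add: \<theta>_def c field_simps)
    then have "of_nat n \<in> bad" unfolding bad_def using that Froot
      by (intro image_eqI[of _ _ "(\<theta> - of_rat c * y, y)"]) auto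
    then show False using n by simp
  qed
  define M where "M = {\<mu>. \<mu> \<noteq> 0 \<and> (\<forall>i. coeff \<mu> i \<in> K) \<and> poly \<mu> b = 0}"
  have gK: "cpoly g \<in> M" using g gb by (auto simp: M_def coeff_map_poly subfield_of_rat[OF K])
  obtain \<mu> where mu: "\<mu> \<in> M" "\<forall>P\<in>M. degree \<mu> \<le> degree P"
    using ex_has_least_nat[of "\<lambda>P. P \<in> M" _ degree] gK by blast
  have mu': "\<mu> \<noteq> 0" "\<forall>i. coeff \<mu> i \<in> K" "poly \<mu> b = 0" using mu by (auto simp: M_def)
  have mudvd: "\<mu> dvd P" if P: "\<forall>i. coeff P i \<in> K" "poly P b = 0" for P
  proof -
    obtain A R where AR: "\<forall>i. coeff A i \<in> K" "\<forall>i. coeff R i \<in> K" "P = A * \<mu> + R" "R = 0 \<or> degree R < degree \<mu>"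
      using subfield_poly_division[OF K mu'(2,1) P(1)] by blast
    have "poly R b = 0" using AR P mu' by simp
    then have "R = 0" using mu AR by (fastforce simp: M_def)
    then show ?thesis using AR by simp
  qed
  obtain \<nu> where nu: "\<mu> = [:- b, 1:] * \<nu>" using mu'(3) poly_eq_0_iff_dvd by (metis dvdE)
  have nu0: "\<nu> \<noteq> 0" using nu mu' by auto
  \<comment> \<open>A root of the cofactor would be a common root of \<open>F\<close> and
    \<open>g\<close>, hence \<open>b\<close> again, and \<open>b\<close> would be a double root of
    the squarefree \<open>g\<close>.\<close>
  have "degree \<nu> = 0"
  proof (rule ccontr)
    assume "degree \<nu> \<noteq> 0"
    then have "\<not> constant (poly \<nu>)" by (simp add: constant_degree)
    then obtain y where y: "poly \<nu> y = 0" using fundamental_theorem_of_algebra by blast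
    then have "poly \<mu> y = 0" using nu by simp
    then have "poly F y = 0" "evalq g y = 0"
      using mudvd[OF FK Fb] mudvd[of "cpoly g"] gK by (auto simp: M_def elim!: dvdE)
    then have "y = b" using only_b by blast
    then have "[:- b, 1:] dvd \<nu>" using y poly_eq_0_iff_dvd by blast
    then have "[:- b, 1:] ^ 2 dvd \<mu>" unfolding nu power2_eq_square by (rule mult_dvd_mono[OF dvd_refl])
    then have "[:- b, 1:] ^ 2 dvd cpoly g" using mudvd[of "cpoly g"] gK unfolding M_def by (blast intro: dvd_trans)
    then have "2 \<le> order b (cpoly g)" using g by (simp add: order_divides)
    moreover have "order b (cpoly g) = 0 \<or> order b (cpoly g) = 1" using g(4) by (simp add: rsquarefree_def)
    ultimately show False by auto
  qed
  then obtain l where l: "\<nu> = [:l:]" by (metis degree_eq_zeroE)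
  then have l0: "l \<noteq> 0" using nu0 by simp
  have "\<mu> = [:- b * l, l:]" using nu l by simp
  then have "coeff \<mu> 0 = - b * l" "coeff \<mu> 1 = l" by simp_all
  then have "- b * l \<in> K" "l \<in> K" using mu'(2) by metis+
  then have "- (- b * l / l) \<in> K" by (intro is_subfieldD(5)[OF K] is_subfieldD(8)[OF K])
  then have bK: "b \<in> K" using l0 by simp
  have "\<theta> - of_rat c * b \<in> K" using \<theta>K bK by (intro is_subfieldD[OF K] subfield_of_rat[OF K])
  then have aK: "a \<in> K" by (simp add: \<theta>_def)
  show ?thesis using that[of c] aK bK by (simp add: K_def \<theta>_def)
qed

text \<open>Recording \<theta> as a linear combination of \<open>S\<close> pays off in
  \<open>conjugate_field_aut\<close>: the image of \<theta> is the same combination of permuted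
  roots, so it stays in the field.\<close>

lemma primitive_element:
  assumes "finite S" "\<And>s. s \<in> S \<Longrightarrow> algebraic s"
  shows "\<exists>\<theta> e. algebraic \<theta> \<and> \<theta> = (\<Sum>s\<in>S. of_rat (e s) * s) \<and> S \<subseteq> Qgen \<theta>"
  using assms
proof (induction S rule: finite_induct)
  case empty
  have "algebraic (0::complex)" by (auto simp: algebraic_iff_evalq cpoly_hom intro!: exI[of _ "[:0,1:]"])
  then show ?case by simp
next
  case (insert b S)
  then obtain \<theta>' e where t: "algebraic \<theta>'" "\<theta>' = (\<Sum>s\<in>S. of_rat (e s) * s)" "S \<subseteq> Qgen \<theta>'" by auto
  have b: "algebraic b" using insert by simp
  obtain c where c: "\<theta>' \<in> Qgen (\<theta>' + of_rat c * b)" "b \<in> Qgen (\<theta>' + of_rat c * b)"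
    using primitive_element_two[OF t(1) b] .
  define \<theta> where "\<theta> = \<theta>' + of_rat c * b"
  have alg: "algebraic \<theta>" unfolding \<theta>_def by (rule algebraic_linear_comb[OF t(1) b])
  have "Qgen \<theta>' \<subseteq> Qgen \<theta>" using Qgen_subset[OF is_subfield_Qgen[OF alg]] c by (simp add: \<theta>_def)
  then have "insert b S \<subseteq> Qgen \<theta>" using t c by (auto simp: \<theta>_def)
  moreover have "\<theta> = (\<Sum>s\<in>insert b S. of_rat ((e(b := c)) s) * s)"
  proof -
    have "(\<Sum>s\<in>S. of_rat ((e(b := c)) s) * s) = \<theta>'" unfolding t(2) using insert by (intro sum.cong) auto
    then show ?thesis using insert by (simp add: \<theta>_def)
  qed
  ultimately show ?case using alg by blast
qed

section \<open>The splitting field, its automorphisms and their fixed field\<close>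

locale galois =
  fixes g :: "rat poly"
  assumes g0: "g \<noteq> 0"
begin

definition R where "R = croots g"

definition L where "L = splitting_field g"

lemma finite_R [simp]: "finite R"
  unfolding R_def croots_def using g0 by (intro poly_roots_finite) simp

lemma in_R_iff: "z \<in> R \<longleftrightarrow> evalq g z = 0" by (simp add: R_def croots_def)

lemma is_subfield_L: "is_subfield L"
  unfolding L_def splitting_field_def is_subfield_def by auto

lemmas L_closed = is_subfieldD[OF is_subfield_L] subfield_of_rat[OF is_subfield_L]

lemma R_subset_L: "R \<subseteq> L" by (auto simp: L_def splitting_field_def R_def)

lemma L_least: "is_subfield K \<Longrightarrow> R \<subseteq> K \<Longrightarrow> L \<subseteq> K"
  unfolding L_def splitting_field_def R_def by blast

lemma algebraic_R: "z \<in> R \<Longrightarrow> algebraic z"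
  using g0 by (auto simp: algebraic_iff_evalq in_R_iff)

lemma ex_primitive:
  "\<exists>\<theta> e. algebraic \<theta> \<and> \<theta> = (\<Sum>s\<in>R. of_rat (e s) * s) \<and> L = Qgen \<theta>"
proof -
  obtain \<theta> e where t: "algebraic \<theta>" "\<theta> = (\<Sum>s\<in>R. of_rat (e s) * s)" "R \<subseteq> Qgen \<theta>"
    using primitive_element[OF finite_R algebraic_R] by blast
  have "\<theta> \<in> L" unfolding t(2) using R_subset_L
    by (intro subfield_sum[OF is_subfield_L] is_subfieldD[OF is_subfield_L] subfield_of_rat) (auto simp: is_subfield_L)
  then have "Qgen \<theta> \<subseteq> L" by (rule Qgen_subset[OF is_subfield_L])
  moreover have "L \<subseteq> Qgen \<theta>" using L_least[OF is_subfield_Qgen[OF t(1)] t(3)] .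
  ultimately show ?thesis using t by blast
qed

lemma algebraic_L: "x \<in> L \<Longrightarrow> algebraic x"
  using ex_primitive algebraic_evalq by (auto simp: Qgen_def)

lemma field_auts_hom:
  assumes "\<tau> \<in> field_auts L"
  shows "x \<in> L \<Longrightarrow> y \<in> L \<Longrightarrow> \<tau> (x + y) = \<tau> x + \<tau> y" "x \<in> L \<Longrightarrow> y \<in> L \<Longrightarrow> \<tau> (x * y) = \<tau> x * \<tau> y"
    "x \<in> L \<Longrightarrow> \<tau> x \<in> L" "\<tau> 0 = 0" "\<tau> 1 = 1" "x \<in> L \<Longrightarrow> \<tau> (- x) = - \<tau> x"
    "x \<in> L \<Longrightarrow> y \<in> L \<Longrightarrow> \<tau> (x - y) = \<tau> x - \<tau> y" "inj_on \<tau> L" "\<tau> ` L = L"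
    "x \<in> L \<Longrightarrow> \<tau> (x ^ n) = \<tau> x ^ n" "\<tau> (of_rat r) = of_rat r"
proof -
  have b: "bij_betw \<tau> L L" using assms by (simp add: field_auts_def)
  show i: "inj_on \<tau> L" and im: "\<tau> ` L = L" using b by (auto simp: bij_betw_def)
  show add: "x \<in> L \<Longrightarrow> y \<in> L \<Longrightarrow> \<tau> (x + y) = \<tau> x + \<tau> y"
    and mult: "x \<in> L \<Longrightarrow> y \<in> L \<Longrightarrow> \<tau> (x * y) = \<tau> x * \<tau> y" for x y
    using assms by (auto simp: field_auts_def)
  show mem: "x \<in> L \<Longrightarrow> \<tau> x \<in> L" for x using im by blast
  show z: "\<tau> 0 = 0" using add[of 0 0] L_closed by simp
  have "\<tau> 1 \<noteq> 0" using i z L_closed by (metis inj_on_contraD zero_neq_one)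
  then show one: "\<tau> 1 = 1" using mult[of 1 1] L_closed by simp
  show neg: "x \<in> L \<Longrightarrow> \<tau> (- x) = - \<tau> x" for x
    using add[of x "- x"] L_closed z by (simp add: eq_neg_iff_add_eq_0 add.commute)
  show "x \<in> L \<Longrightarrow> y \<in> L \<Longrightarrow> \<tau> (x - y) = \<tau> x - \<tau> y"
    using add[of x "- y"] neg[of y] L_closed by simp
  show "x \<in> L \<Longrightarrow> \<tau> (x ^ n) = \<tau> x ^ n" by (induction n) (auto simp: one mult L_closed)
  have n: "\<tau> (of_nat n) = of_nat n \<and> of_nat n \<in> L" for n
    by (induction n) (auto simp: z one add L_closed)
  have int: "\<tau> (of_int n) = of_int n \<and> of_int n \<in> L" for n
    by (cases n rule: int_cases2) (auto simp: n neg L_closed)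
  obtain a b where r: "r = Fract a b" "b > 0" by (cases r) auto
  have "\<tau> (of_rat r) * of_int b = \<tau> (of_rat r * of_int b)" using int L_closed by (simp add: mult)
  also have "of_rat r * (of_int b :: complex) = of_int a" using r by (simp add: of_rat_rat)
  finally have "\<tau> (of_rat r) * of_int b = of_int a" using int by simp
  then show "\<tau> (of_rat r) = of_rat r" using r by (simp add: of_rat_rat field_simps)
qed

lemma field_auts_sum:
  assumes "\<tau> \<in> field_auts L" "\<And>i. i \<in> A \<Longrightarrow> f i \<in> L"
  shows "\<tau> (sum f A) = (\<Sum>i\<in>A. \<tau> (f i))"
  using assms(2)
  by (induction A rule: infinite_finite_induct)
    (auto simp: field_auts_hom[OF assms(1)] subfield_sum[OF is_subfield_L])

lemma field_auts_prod:
  assumes "\<tau> \<in> field_auts L" "\<And>i. i \<in> A \<Longrightarrow> f i \<in> L"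
  shows "\<tau> (prod f A) = (\<Prod>i\<in>A. \<tau> (f i))"
  using assms(2)
  by (induction A rule: infinite_finite_induct)
    (auto simp: field_auts_hom[OF assms(1)] subfield_prod[OF is_subfield_L])

lemma field_auts_evalq:
  assumes t: "\<tau> \<in> field_auts L" and x: "x \<in> L"
  shows "\<tau> (evalq P x) = evalq P (\<tau> x)"
  by (induction P) (auto simp: cpoly_hom field_auts_hom[OF t] x L_closed subfield_evalq[OF is_subfield_L x])

lemma field_auts_bij_R:
  assumes t: "\<tau> \<in> field_auts L" shows "bij_betw \<tau> R R"
proof -
  have "\<tau> z \<in> R" if "z \<in> R" for z
    using field_auts_evalq[OF t, of z g] R_subset_L that field_auts_hom(4)[OF t] by (auto simp: in_R_iff)
  then have sub: "\<tau> ` R \<subseteq> R" by blast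
  have inj: "inj_on \<tau> R" using field_auts_hom(8)[OF t] R_subset_L by (rule inj_on_subset)
  then show ?thesis using sub endo_inj_surj[OF finite_R] by (auto simp: bij_betw_def)
qed

text \<open>Substituting \<theta>' for \<theta> is well defined since every rational polynomial
  vanishing at \<theta> is a multiple of \<open>h\<close>. The map is injective and permutes the
  finite set of roots, which puts \<theta>' into \<open>L\<close>. Its image is a subfield
  containing all roots, hence all of \<open>L\<close>.\<close>

lemma conjugate_field_aut:
  assumes alg: "algebraic \<theta>" and e: "\<theta> = (\<Sum>s\<in>R. of_rat (e s) * s)" and L: "L = Qgen \<theta>"
    and h: "\<forall>P. evalq P \<theta> = 0 \<longleftrightarrow> h dvd P" and conj: "evalq h \<theta>' = 0"
  shows "\<exists>\<tau>\<in>field_auts L. \<forall>P. \<tau> (evalq P \<theta>) = evalq P \<theta>'"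
proof -
  define \<tau> where "\<tau> x = evalq (SOME P. x = evalq P \<theta>) \<theta>'" for x
  have zero: "evalq P \<theta>' = 0" if "evalq P \<theta> = 0" for P using that h conj evalq_dvd by blast
  have tau: "\<tau> (evalq P \<theta>) = evalq P \<theta>'" for P
  proof -
    define P' where "P' = (SOME P'. evalq P \<theta> = evalq P' \<theta>)"
    have "evalq P \<theta> = evalq P' \<theta>" unfolding P'_def by (rule someI[of _ P]) simp
    then have "evalq (P - P') \<theta> = 0" by (simp add: cpoly_hom)
    then have "evalq (P - P') \<theta>' = 0" by (rule zero)
    then show ?thesis by (simp add: \<tau>_def P'_def cpoly_hom)
  qed
  have inL: "evalq P \<theta> \<in> L" for P by (auto simp: L Qgen_def)
  have add: "\<tau> (x + y) = \<tau> x + \<tau> y" and mult: "\<tau> (x * y) = \<tau> x * \<tau> y" if xy: "x \<in> L" "y \<in> L" for x y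
  proof -
    obtain P Q where PQ: "x = evalq P \<theta>" "y = evalq Q \<theta>" using xy by (auto simp: L Qgen_def)
    show "\<tau> (x + y) = \<tau> x + \<tau> y" using tau[of "P + Q"] by (simp add: PQ tau cpoly_hom)
    show "\<tau> (x * y) = \<tau> x * \<tau> y" using tau[of "P * Q"] by (simp add: PQ tau cpoly_hom)
  qed
  have rat: "\<tau> (of_rat r) = of_rat r" for r using tau[of "[:r:]"] by (simp add: cpoly_hom)
  have tau0: "\<tau> 0 = 0" "\<tau> 1 = 1" using rat[of 0] rat[of 1] by simp_all
  have nz: "\<tau> x \<noteq> 0" if "x \<in> L" "x \<noteq> 0" for x
  proof
    assume "\<tau> x = 0"
    have "\<tau> (x * inverse x) = \<tau> x * \<tau> (inverse x)" using that L_closed by (intro mult) auto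
    then show False using \<open>\<tau> x = 0\<close> that tau0 by simp
  qed
  have neg: "\<tau> (- x) = - \<tau> x" if "x \<in> L" for x
    using add[of x "- x"] that L_closed tau0 by (simp add: eq_neg_iff_add_eq_0 add.commute)
  have inj: "inj_on \<tau> L"
  proof (rule inj_onI)
    fix x y assume xy: "x \<in> L" "y \<in> L" "\<tau> x = \<tau> y"
    have "\<tau> (x + - y) = 0" using add[of x "- y"] neg[of y] xy L_closed by simp
    then show "x = y" using nz[of "x + - y"] xy L_closed by fastforce
  qed
  have R: "\<tau> s \<in> R" if "s \<in> R" for s
  proof -
    have "s \<in> Qgen \<theta>" using that R_subset_L L by blast
    then obtain A where A: "s = evalq A \<theta>" by (auto simp: Qgen_def)
    have "evalq (pcompose g A) x = evalq g (evalq A x)" for x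
    proof -
      have "cpoly (pcompose g A) = pcompose (cpoly g) (cpoly A)" for g
        by (induction g) (auto simp: pcompose_pCons cpoly_hom)
      then show ?thesis by (simp add: poly_pcompose)
    qed
    note ev = this
    have "evalq (pcompose g A) \<theta> = 0" unfolding ev using that by (simp add: in_R_iff A)
    then have "evalq (pcompose g A) \<theta>' = 0" by (rule zero)
    then show ?thesis by (simp add: ev in_R_iff A tau)
  qed
  have "inj_on \<tau> R" using inj R_subset_L by (rule inj_on_subset)
  then have surjR: "\<tau> ` R = R" using R by (intro endo_inj_surj) auto
  have t\<theta>: "\<tau> \<theta> = \<theta>'" using tau[of "[:0,1:]"] by (simp add: cpoly_hom)
  have sum: "\<tau> (\<Sum>s\<in>A. f s) = (\<Sum>s\<in>A. \<tau> (f s))" if "\<And>s. s \<in> A \<Longrightarrow> f s \<in> L" for f and A :: "complex set"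
    using that by (induction A rule: infinite_finite_induct) (auto simp: tau0 add subfield_sum[OF is_subfield_L])
  have "\<theta>' = (\<Sum>s\<in>R. \<tau> (of_rat (e s) * s))"
    unfolding t\<theta>[symmetric] by (subst e, rule sum) (use R_subset_L L_closed in auto)
  also have "\<dots> = (\<Sum>s\<in>R. of_rat (e s) * \<tau> s)"
    by (rule sum.cong) (use R_subset_L L_closed in \<open>auto simp: mult rat\<close>)
  also have "\<dots> \<in> L" using R R_subset_L L_closed by (intro subfield_sum[OF is_subfield_L] L_closed) auto
  finally have t'L: "\<theta>' \<in> L" .
  have sub: "\<tau> ` L \<subseteq> L" using subfield_evalq[OF is_subfield_L t'L] by (auto simp: L Qgen_def tau)
  have "is_subfield (\<tau> ` L)"
    unfolding is_subfield_def
  proof (intro conjI ballI)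
    show "0 \<in> \<tau> ` L" "1 \<in> \<tau> ` L" using tau0 L_closed by (auto intro!: image_eqI)
    fix x assume "x \<in> \<tau> ` L" then obtain a where a: "a \<in> L" "x = \<tau> a" by blast
    show "- x \<in> \<tau> ` L" using a neg L_closed by (intro image_eqI[of _ _ "- a"]) auto
    show "inverse x \<in> \<tau> ` L"
    proof (cases "a = 0")
      case True then show ?thesis using a tau0 by simp
    next
      case False
      have "\<tau> (a * inverse a) = \<tau> a * \<tau> (inverse a)" using a L_closed by (intro mult) auto
      then have "\<tau> a * \<tau> (inverse a) = 1" using False tau0 by simp
      then have "inverse x = \<tau> (inverse a)" unfolding a(2) by (rule inverse_unique)
      then show ?thesis using L_closed(6)[OF a(1)] by blast
    qed
    fix y assume "y \<in> \<tau> ` L" then obtain b where b: "b \<in> L" "y = \<tau> b" by blast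
    show "x + y \<in> \<tau> ` L" using a b add L_closed by (intro image_eqI[of _ _ "a + b"]) auto
    show "x * y \<in> \<tau> ` L" using a b mult L_closed by (intro image_eqI[of _ _ "a * b"]) auto
  qed
  moreover have "R \<subseteq> \<tau> ` L" using surjR R_subset_L by blast
  ultimately have "L \<subseteq> \<tau> ` L" by (rule L_least)
  then have "\<tau> \<in> field_auts L" using inj sub add mult by (auto simp: field_auts_def bij_betw_def)
  then show ?thesis using tau by blast
qed

lemma card_roots_rsquarefree:
  fixes p :: "complex poly"
  assumes "rsquarefree p" shows "card {z. poly p z = 0} = degree p"
proof -
  have p0: "p \<noteq> 0" using assms by (simp add: rsquarefree_def)
  then have fin: "finite {z. poly p z = 0}" by (rule poly_roots_finite)
  have "degree p = degree (smult (lead_coeff p) (\<Prod>z | poly p z = 0. [:-z, 1:]))"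
    by (subst complex_poly_decompose_rsquarefree[OF assms]) simp
  also have "\<dots> = (\<Sum>z | poly p z = 0. 1)" using p0 by (simp add: degree_prod_sum_eq)
  finally show ?thesis using fin by simp
qed

text \<open>Write x = P(\<theta>) with P of degree below that of \<open>h\<close>. Each of the deg h
  distinct roots z of \<open>h\<close> comes from an automorphism, so P(z) = x. Then P - x has more
  roots than its degree permits, and P is constant.\<close>

theorem fixed_rational:
  assumes x: "x \<in> L" and fixd: "\<And>\<tau>. \<tau> \<in> field_auts L \<Longrightarrow> \<tau> x = x"
  shows "x \<in> \<rat>"
proof -
  obtain \<theta> e where t: "algebraic \<theta>" "\<theta> = (\<Sum>s\<in>R. of_rat (e s) * s)" "L = Qgen \<theta>"
    using ex_primitive by blast
  obtain h where h: "h \<noteq> 0" "\<forall>P. evalq P \<theta> = 0 \<longleftrightarrow> h dvd P" "degree h > 0" "rsquarefree (cpoly h)"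
    using ex_minpoly[OF t(1)] by blast
  obtain P0 where P0: "x = evalq P0 \<theta>" using x t(3) by (auto simp: Qgen_def)
  define P where "P = P0 mod h"
  have "evalq h \<theta> = 0" using h(2) by simp
  then have P: "x = evalq P \<theta>" by (simp add: P_def P0 cpoly_hom minus_div_mult_eq_mod[symmetric])
  have dP: "degree P < degree h" using degree_mod_less[OF h(1), of P0] h(3) by (auto simp: P_def)
  define T where "T = cpoly P - [:x:]"
  have roots: "{z. evalq h z = 0} \<subseteq> {z. poly T z = 0}"
  proof
    fix z assume "z \<in> {z. evalq h z = 0}"
    then obtain \<tau> where tau: "\<tau> \<in> field_auts L" "\<forall>P. \<tau> (evalq P \<theta>) = evalq P z"
      using conjugate_field_aut[OF t h(2)] by blast
    then have "evalq P z = x" using fixd[OF tau(1)] P by simp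
    then show "z \<in> {z. poly T z = 0}" by (simp add: T_def)
  qed
  have "T = 0"
  proof (rule ccontr)
    assume T0: "T \<noteq> 0"
    have "degree h \<le> card {z. poly T z = 0}"
      using card_roots_rsquarefree[OF h(4)] card_mono[OF poly_roots_finite[OF T0] roots] by simp
    also have "\<dots> \<le> degree T" by (rule card_poly_roots_bound[OF T0])
    also have "\<dots> < degree h" unfolding T_def using dP h(3) by (intro degree_diff_less) auto
    finally show False by simp
  qed
  then have "coeff T 0 = 0" by simp
  then have "x = of_rat (coeff P 0)" by (simp add: T_def coeff_map_poly)
  then show ?thesis by simp
qed

lemma galois_group_eq: "galois_group g = (\<lambda>\<sigma> z. if z \<in> R then \<sigma> z else z) ` field_auts L"
  by (simp add: galois_group_def R_def L_def)

lemma field_auts_restrict: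
  assumes "\<tau> \<in> field_auts L" shows "\<exists>p\<in>galois_group g. \<forall>z\<in>R. p z = \<tau> z"
  using assms by (auto simp: galois_group_eq intro!: bexI[of _ "\<tau>"])

lemma galois_group_permutes:
  assumes "p \<in> galois_group g" shows "p permutes R"
proof -
  obtain \<tau> where t: "\<tau> \<in> field_auts L" "p = (\<lambda>z. if z \<in> R then \<tau> z else z)"
    using assms by (auto simp: galois_group_eq)
  have "bij_betw p R R" using field_auts_bij_R[OF t(1)] by (rule iffD1[OF bij_betw_cong, rotated]) (simp add: t)
  then show ?thesis by (rule bij_imp_permutes) (simp add: t)
qed

lemma galois_group_closed:
  "id \<in> galois_group g" "p \<in> galois_group g \<Longrightarrow> q \<in> galois_group g \<Longrightarrow> p \<circ> q \<in> galois_group g"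
proof -
  have "(\<lambda>x. x) \<in> field_auts L" by (auto simp: field_auts_def bij_betw_def)
  then show "id \<in> galois_group g" unfolding galois_group_eq by (rule rev_image_eqI) auto
  assume "p \<in> galois_group g" "q \<in> galois_group g"
  then obtain \<sigma> \<tau> where s: "\<sigma> \<in> field_auts L" "p = (\<lambda>z. if z \<in> R then \<sigma> z else z)"
    and t: "\<tau> \<in> field_auts L" "q = (\<lambda>z. if z \<in> R then \<tau> z else z)"
    by (auto simp: galois_group_eq)
  have "\<sigma> \<circ> \<tau> \<in> field_auts L" using s(1) t(1)
    by (auto simp: field_auts_def intro: bij_betw_trans dest: bij_betwE)
  moreover have "p \<circ> q = (\<lambda>z. if z \<in> R then (\<sigma> \<circ> \<tau>) z else z)"
    using field_auts_bij_R[OF t(1)] by (auto simp: s t fun_eq_iff dest: bij_betwE)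
  ultimately show "p \<circ> q \<in> galois_group g" unfolding galois_group_eq by blast
qed

end

section \<open>Jordan's theorem on primitive groups containing a prime cycle\<close>

lemma funpow_mult_fixed: "(F ^^ d) y = y \<Longrightarrow> (F ^^ (a * d)) y = y"
  by (induction a) (simp_all add: funpow_add)

text \<open>If a smaller positive power fixed \<open>y\<close>, a Bezout combination of its exponent
  with \<open>q\<close> would make \<open>F\<close> itself fix \<open>y\<close>.\<close>

lemma inj_on_prime_orbit:
  assumes q: "prime (q::nat)" and Fq: "(F ^^ q) y = y" and ne: "F y \<noteq> y"
  shows "inj_on (\<lambda>i. (F ^^ i) y) {..<q}"
proof -
  have "(F ^^ i) y \<noteq> (F ^^ j) y" if ij: "i < j" "j < q" for i j
  proof
    assume eq: "(F ^^ i) y = (F ^^ j) y"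
    define d where "d = q - j + i"
    have "(F ^^ d) y = (F ^^ (q - j)) ((F ^^ i) y)" by (simp add: d_def funpow_add)
    also have "\<dots> = (F ^^ (q - j + j)) y" by (simp only: eq funpow_add o_apply)
    finally have Fd: "(F ^^ d) y = y" using ij Fq by simp
    have d: "0 < d" "d < q" using ij by (auto simp: d_def)
    then have "\<not> q dvd d" by (auto dest: dvd_imp_le)
    then have "coprime q d" using q by (simp add: prime_imp_coprime)
    then have "gcd d q = 1" by (simp add: coprime_iff_gcd_eq_1 gcd.commute)
    then obtain u w where "d * u = q * w + 1" using bezout_nat[of d q] d by auto
    then have "(F ^^ (u * d)) y = F ((F ^^ (w * q)) y)" by (simp add: mult.commute)
    then show False using funpow_mult_fixed[OF Fd] funpow_mult_fixed[OF Fq] ne by simp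
  qed
  then show ?thesis by (intro inj_onI) (metis lessThan_iff linorder_neqE_nat)
qed

text \<open>All orbits have exactly \<open>q\<close> points. The counting is reused for Cauchy's
  theorem, for the support of \<sigma> and for the Frattini argument.\<close>

lemma prime_dvd_card_if_no_fixpoint:
  assumes q: "prime (q::nat)" and Y: "finite Y" "\<And>y. y \<in> Y \<Longrightarrow> F y \<in> Y"
    and Fq: "\<And>y. y \<in> Y \<Longrightarrow> (F ^^ q) y = y" and ne: "\<And>y. y \<in> Y \<Longrightarrow> F y \<noteq> y"
  shows "q dvd card Y"
proof -
  define orb where "orb y = (\<lambda>i. (F ^^ i) y) ` {..<q}" for y
  have q0: "q > 0" using q by (simp add: prime_gt_0_nat)
  have mem: "(F ^^ i) y \<in> Y" if "y \<in> Y" for i y by (induction i) (use that Y in auto)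
  have self: "y \<in> orb y" for y unfolding orb_def using q0 by (intro image_eqI[of _ _ 0]) auto
  have pow_in: "(F ^^ i) y \<in> orb y" if "y \<in> Y" for i y
  proof -
    have "(F ^^ i) y = (F ^^ (i mod q + (i div q) * q)) y" by (simp add: mult.commute)
    also have "\<dots> = (F ^^ (i mod q)) y" using funpow_mult_fixed[OF Fq[OF that]] by (simp only: funpow_add o_apply)
    finally show ?thesis using q0 by (simp add: orb_def)
  qed
  have orb_eq: "orb x = orb y" if y: "y \<in> Y" and x: "x \<in> orb y" for x y
  proof -
    obtain i where i: "x = (F ^^ i) y" "i < q" using x by (auto simp: orb_def)
    have x': "x \<in> Y" using i mem[OF y] by simp
    have "(F ^^ (q - i)) x = y" using i Fq[OF y] by (simp flip: funpow_add[THEN fun_cong, unfolded o_apply])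
    then have "(F ^^ j) y = (F ^^ (j + (q - i))) x" for j by (simp add: funpow_add)
    then have "orb y \<subseteq> orb x" using pow_in[OF x'] by (auto simp: orb_def[of y])
    moreover have "(F ^^ j) x = (F ^^ (j + i)) y" for j by (simp add: i funpow_add)
    then have "orb x \<subseteq> orb y" using pow_in[OF y] by (auto simp: orb_def[of x])
    ultimately show ?thesis by blast
  qed
  have "q * card (orb ` Y) = card (\<Union>(orb ` Y))"
  proof (rule card_partition)
    show "finite (orb ` Y)" using Y by simp
    show "finite (\<Union> (orb ` Y))" using Y by (auto simp: orb_def)
    show "card c = q" if "c \<in> orb ` Y" for c
      using that inj_on_prime_orbit[OF q Fq ne] by (auto simp: orb_def card_image)
    show "c1 \<inter> c2 = {}" if "c1 \<in> orb ` Y" "c2 \<in> orb ` Y" "c1 \<noteq> c2" for c1 c2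
      using that orb_eq by blast
  qed
  moreover have "\<Union>(orb ` Y) = Y" using self mem by (auto simp: orb_def)
  ultimately show ?thesis by (metis dvd_triv_left)
qed

abbreviation "tr \<equiv> Transposition.transpose"

section \<open>Finite permutation groups and Cauchy's theorem\<close>

locale perm_group =
  fixes R :: "'a set" and G :: "('a \<Rightarrow> 'a) set"
  assumes finite_R: "finite R" and permutes: "p \<in> G \<Longrightarrow> p permutes R"
    and id_in: "id \<in> G" and comp_in: "p \<in> G \<Longrightarrow> q \<in> G \<Longrightarrow> p \<circ> q \<in> G"
begin

lemma finite_G: "finite G"
  using finite_permutations[OF finite_R] permutes by (auto intro: finite_subset[of G "{p. p permutes R}"])

lemma bijG: "p \<in> G \<Longrightarrow> bij p"
  using permutes permutes_bij by blast

lemma injG: "p \<in> G \<Longrightarrow> inj p"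
  using bijG bij_is_inj by blast

text \<open>Left multiplication by \<open>p\<close> is injective on the finite set \<open>G\<close>,
  hence hits \<open>id\<close>.\<close>

lemma inv_in:
  assumes p: "p \<in> G" shows "inv p \<in> G"
proof -
  have "inj_on ((\<circ>) p) G"
  proof (rule inj_onI)
    fix a b assume "p \<circ> a = p \<circ> b"
    then have "p (a x) = p (b x)" for x by (metis o_apply)
    then show "a = b" using injG[OF p] by (auto dest: injD)
  qed
  moreover have "((\<circ>) p) ` G \<subseteq> G" using comp_in p by auto
  ultimately have "((\<circ>) p) ` G = G" by (intro endo_inj_surj finite_G)
  then obtain q where q: "q \<in> G" "id = p \<circ> q" using id_in by auto
  then have "inv p \<circ> (p \<circ> q) = inv p" by simp
  then have "q = inv p" using inv_o_cancel[OF injG[OF p]] by (simp add: o_assoc)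
  then show ?thesis using q by simp
qed

lemma inv_simps: "p \<in> G \<Longrightarrow> inv p (p x) = x" "p \<in> G \<Longrightarrow> p (inv p x) = x"
  using permutes permutes_inverses by (metis)+

lemma funpow_in: "p \<in> G \<Longrightarrow> p ^^ n \<in> G"
  by (induction n) (auto simp: id_in[unfolded id_def] id_in comp_in)

lemma in_R_iff: "p \<in> G \<Longrightarrow> p x \<in> R \<longleftrightarrow> x \<in> R"
  using permutes permutes_in_image by fastforce

text \<open>McKay's proof: rotation acts on the q-tuples with product \<open>id\<close>. Their
  number is divisible by \<open>q\<close>, so the constant tuple of \<open>id\<close> cannot be the
  only fixed point.\<close>

lemma cauchy:
  assumes q: "prime q" and dvd: "q dvd card G"
  shows "\<exists>\<sigma>\<in>G. \<sigma> \<noteq> id \<and> \<sigma> ^^ q = id"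
proof (rule ccontr)
  assume neg: "\<not> ?thesis"
  define pr where "pr = (\<lambda>xs :: ('a \<Rightarrow> 'a) list. foldr (\<circ>) xs id)"
  have pr_in: "pr xs \<in> G" if "set xs \<subseteq> G" for xs
    using that by (induction xs) (auto simp: pr_def id_in comp_in)
  have pr_app: "pr (xs @ ys) = pr xs \<circ> pr ys" for xs ys
    by (induction xs) (auto simp: pr_def o_assoc)
  have pr_rep: "pr (replicate n x) = x ^^ n" for n x by (induction n) (auto simp: pr_def)
  obtain n where n: "q = Suc n" using prime_gt_0_nat[OF q] by (cases q) auto
  define T where "T = {xs. set xs \<subseteq> G \<and> length xs = q \<and> pr xs = id}"
  \<comment> \<open>The first entry is determined by the other n = q - 1, which may be arbitrary;
    hence there are |G|^n tuples.\<close>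
  have T: "T = (\<lambda>xs. inv (pr xs) # xs) ` {xs. set xs \<subseteq> G \<and> length xs = n}"
  proof (intro set_eqI iffI)
    fix ys assume "ys \<in> T"
    then obtain x xs where xs: "ys = x # xs" "x \<in> G" "set xs \<subseteq> G" "length xs = n" "x \<circ> pr xs = id"
      by (cases ys) (auto simp: T_def n pr_def)
    have "(x \<circ> pr xs) \<circ> inv (pr xs) = inv (pr xs)" using xs by simp
    then have "x = inv (pr xs)" using surj_iff[of "pr xs"] bij_is_surj[OF bijG[OF pr_in[OF xs(3)]]]
      by (simp add: o_assoc[symmetric])
    then show "ys \<in> (\<lambda>xs. inv (pr xs) # xs) ` {xs. set xs \<subseteq> G \<and> length xs = n}" using xs by auto
  next
    fix ys assume "ys \<in> (\<lambda>xs. inv (pr xs) # xs) ` {xs. set xs \<subseteq> G \<and> length xs = n}"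
    then obtain xs where xs: "ys = inv (pr xs) # xs" "set xs \<subseteq> G" "length xs = n" by auto
    have "pr ys = inv (pr xs) \<circ> pr xs" by (simp add: xs pr_def)
    also have "\<dots> = id" using injG[OF pr_in[OF xs(2)]] by (rule inv_o_cancel)
    finally show "ys \<in> T" using xs inv_in[OF pr_in[OF xs(2)]] by (simp add: T_def n)
  qed
  have finT: "finite T" unfolding T using finite_lists_length_eq[OF finite_G, of n] by simp
  have "card T = card {xs. set xs \<subseteq> G \<and> length xs = n}" unfolding T by (rule card_image) (auto intro: inj_onI)
  also have "\<dots> = card G ^ n" by (rule card_lists_length_eq[OF finite_G])
  finally have cT: "card T = card G ^ n" .
  have n0: "n > 0" using n prime_gt_1_nat[OF q] by simp
  have dT: "q dvd card T" unfolding cT using dvd n0 by (meson dvd_power dvd_trans)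
  define e where "e = replicate q (id :: 'a \<Rightarrow> 'a)"
  have eT: "e \<in> T" using id_in by (auto simp: T_def e_def pr_rep)
  \<comment> \<open>A tuple fixed by rotation is constant, and its entry would be one of the
    elements whose existence is being denied.\<close>
  have "q dvd card (T - {e})"
  proof (rule prime_dvd_card_if_no_fixpoint[OF q, where F = rotate1])
    show "finite (T - {e})" using finT by simp
    fix xs assume xs: "xs \<in> T - {e}"
    then obtain y ys where y: "xs = y # ys" by (cases xs) (auto simp: T_def n)
    have yG: "y \<in> G" "pr ys \<in> G" using xs y pr_in by (auto simp: T_def)
    have "y \<circ> pr ys = id" using xs y by (simp add: T_def pr_def)
    then have "inv y \<circ> (y \<circ> pr ys) \<circ> y = inv y \<circ> y" by simp
    then have "pr ys \<circ> y = id" using inv_o_cancel[OF injG[OF yG(1)]] by (simp add: o_assoc)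
    then have "pr (rotate1 xs) = id" by (simp add: y pr_app) (simp add: pr_def)
    then have rT: "rotate1 xs \<in> T" using xs by (auto simp: T_def)
    show "(rotate1 ^^ q) xs = xs" using xs rotate_id[of q xs] by (simp add: T_def rotate_def)
    show "rotate1 xs \<noteq> xs"
    proof
      assume r: "rotate1 xs = xs"
      have all: "(rotate1 ^^ i) xs = xs" for i by (induction i) (auto simp: r)
      have "xs ! i = y" if "i < q" for i
      proof -
        have "xs ! i = rotate i xs ! 0" using that xs by (simp add: nth_rotate T_def)
        then show ?thesis using all[of i] by (simp add: rotate_def y)
      qed
      then have "xs = replicate q y" using xs by (intro nth_equalityI) (auto simp: T_def)
      then have "y ^^ q = id" "y \<noteq> id" using xs by (auto simp: T_def pr_rep e_def)
      then show False using neg yG by blast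
    qed
    moreover have "rotate1 xs \<noteq> e"
    proof
      assume "rotate1 xs = e"
      then have "set xs \<subseteq> {id}" by (metis e_def set_replicate_conv_if set_rotate1 subset_singleton_iff order_refl)
      then have "xs = replicate (length xs) id" by (intro replicate_eqI[symmetric, THEN sym]) auto
      then show False using xs by (auto simp: T_def e_def)
    qed
    ultimately show "rotate1 xs \<in> T - {e}" using rT by simp
  qed
  moreover have "card T = Suc (card (T - {e}))" by (rule card.remove[OF finT eT])
  ultimately have "q dvd 1" using dT by (metis dvd_add_right_iff plus_1_eq_Suc add.commute)
  then show False using q by auto
qed

section \<open>Subgroups supported in a subset, and their action on it\<close>

definition supp_in :: "'a set \<Rightarrow> ('a \<Rightarrow> 'a) set" where
  "supp_in X = {g \<in> G. \<forall>x. x \<notin> X \<longrightarrow> g x = x}"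

definition trans_on :: "'a set \<Rightarrow> bool" where
  "trans_on X \<longleftrightarrow> (\<forall>x\<in>X. \<forall>y\<in>X. \<exists>h\<in>supp_in X. h x = y)"

text \<open>Rudio's property, a consequence of primitivity on \<open>X\<close> that can be stated
  without blocks. It is the form in which primitivity enters the minimality argument of
  \<open>ex_shift\<close>.\<close>

definition separating :: "'a set \<Rightarrow> bool" where
  "separating X \<longleftrightarrow> (\<forall>A a b. A \<subseteq> X \<and> A \<noteq> {} \<and> A \<noteq> X \<and> a \<in> X \<and> b \<in> X \<and> a \<noteq> b \<longrightarrow>
     (\<exists>h\<in>supp_in X. a \<notin> h ` A \<and> b \<in> h ` A))"

lemma supp_in_G: "h \<in> supp_in X \<Longrightarrow> h \<in> G" by (simp add: supp_in_def)

lemma supp_in_closed: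
  "id \<in> supp_in X" "h \<in> supp_in X \<Longrightarrow> k \<in> supp_in X \<Longrightarrow> h \<circ> k \<in> supp_in X"
  "h \<in> supp_in X \<Longrightarrow> inv h \<in> supp_in X" "h \<in> supp_in X \<Longrightarrow> x \<in> X \<Longrightarrow> h x \<in> X"
  "X \<subseteq> Y \<Longrightarrow> h \<in> supp_in X \<Longrightarrow> h \<in> supp_in Y"
proof -
  show "id \<in> supp_in X" by (simp add: supp_in_def id_in)
  show "h \<in> supp_in X \<Longrightarrow> k \<in> supp_in X \<Longrightarrow> h \<circ> k \<in> supp_in X" by (simp add: supp_in_def comp_in)
  show "h \<in> supp_in X \<Longrightarrow> inv h \<in> supp_in X"
    by (simp add: supp_in_def inv_in) (metis inv_simps(1))
  show "h \<in> supp_in X \<Longrightarrow> x \<in> X \<Longrightarrow> h x \<in> X"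
  proof (rule ccontr)
    assume h: "h \<in> supp_in X" "x \<in> X" "h x \<notin> X"
    then have hG: "h \<in> G" and "h (h x) = h x" by (auto simp: supp_in_def)
    then have "h x = x" using injD[OF injG[OF hG]] by blast
    then show False using h by simp
  qed
  show "X \<subseteq> Y \<Longrightarrow> h \<in> supp_in X \<Longrightarrow> h \<in> supp_in Y" by (auto simp: supp_in_def)
qed

lemma supp_in_image:
  assumes "h \<in> supp_in X" shows "h ` X = X"
proof
  show "h ` X \<subseteq> X" using supp_in_closed(4)[OF assms] by blast
  show "X \<subseteq> h ` X"
  proof
    fix x assume "x \<in> X"
    then have "inv h x \<in> X" using supp_in_closed(3,4) assms by blast
    then show "x \<in> h ` X" using inv_simps(2)[OF supp_in_G[OF assms]] by (metis imageI)
  qed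
qed

lemma conj_supp_in:
  assumes "h \<in> supp_in X" "g \<in> G" shows "g \<circ> h \<circ> inv g \<in> supp_in (g ` X)"
proof -
  have "(g \<circ> h \<circ> inv g) x = x" if "x \<notin> g ` X" for x
  proof -
    have "inv g x \<notin> X" using that inv_simps(2)[OF assms(2)] by (metis imageI)
    then show ?thesis using assms inv_simps(2)[OF assms(2)] by (simp add: supp_in_def)
  qed
  then show ?thesis using assms by (simp add: supp_in_def comp_in inv_in)
qed

end

section \<open>Jordan's induction: enlarging a transitive set point by point\<close>

locale transitive_perm_group = perm_group +
  assumes transitive: "x \<in> R \<Longrightarrow> y \<in> R \<Longrightarrow> \<exists>g\<in>G. g x = y"
begin

text \<open>Take g with gX different from X and |X - gX| minimal. If two points a, b of X were
  missing from gX, an element h supported in X that separates them would give the conjugate g^-1 h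
  g, whose translate of X misses strictly fewer points. The size of X guarantees that X and gX
  overlap.\<close>

lemma ex_shift:
  assumes X: "X \<subseteq> R" "X \<noteq> R" "card R < 2 * card X" and sep: "separating X"
  shows "\<exists>g\<in>G. card (X - g ` X) = 1"
proof -
  have finX: "finite X" using X finite_R finite_subset by blast
  define D where "D = {g \<in> G. g ` X \<noteq> X}"
  have cimg: "card (g ` Y) = card Y" if "g \<in> G" for g Y using injG[OF that] by (simp add: card_image inj_on_subset)
  have "X \<noteq> {}" using X by auto
  then obtain x y where "x \<in> X" "y \<in> R - X" using X by blast
  then obtain g0 where "g0 \<in> G" "g0 x = y" using transitive X by blast
  then have "g0 \<in> D" using \<open>x \<in> X\<close> \<open>y \<in> R - X\<close> by (auto simp: D_def)
  then obtain g where g: "g \<in> D" "\<forall>f\<in>D. card (X - g ` X) \<le> card (X - f ` X)"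
    using ex_has_least_nat[of "\<lambda>f. f \<in> D" g0 "\<lambda>f. card (X - f ` X)"] by blast
  have gG: "g \<in> G" and gX: "g ` X \<noteq> X" using g by (auto simp: D_def)
  have "X - g ` X \<noteq> {}"
  proof
    assume "X - g ` X = {}"
    then have "X \<subseteq> g ` X" by blast
    then have "X = g ` X" using cimg[OF gG, of X] finX by (intro card_subset_eq) auto
    then show False using gX by simp
  qed
  then have c1: "card (X - g ` X) \<ge> 1" using finX by (simp add: Suc_le_eq card_gt_0_iff)
  show ?thesis
  proof (cases "card (X - g ` X) = 1")
    case True then show ?thesis using gG by blast
  next
    case False
    then have "\<not> card (X - g ` X) \<le> Suc 0" using c1 by simp
    then obtain a b where ab: "a \<in> X - g ` X" "b \<in> X - g ` X" "a \<noteq> b"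
      using card_le_Suc0_iff_eq[of "X - g ` X"] finX by auto
    define A where "A = X \<inter> g ` X"
    have "A \<noteq> {}"
    proof
      assume "A = {}"
      then have "card (X \<union> g ` X) = 2 * card X" using finX cimg[OF gG, of X] by (simp add: card_Un_disjoint A_def)
      moreover have "X \<union> g ` X \<subseteq> R" using X in_R_iff[OF gG] by auto
      ultimately show False using X card_mono[OF finite_R, of "X \<union> g ` X"] by simp
    qed
    moreover have "A \<subseteq> X" "A \<noteq> X" using ab by (auto simp: A_def)
    ultimately obtain h where h: "h \<in> supp_in X" "a \<notin> h ` A" "b \<in> h ` A"
      using sep ab unfolding separating_def by blast
    have hG: "h \<in> G" using supp_in_G h by blast
    \<comment> \<open>Applying g carries X - fX to gX - hgX. Since h is the identity outside X, this
      difference lies in A - hA. The point b, which is in hgX but not in gX, shows that fX differs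
      from X.\<close>
    define f where "f = inv g \<circ> h \<circ> g"
    have fG: "f \<in> G" using gG hG by (simp add: f_def comp_in inv_in)
    have gf: "g ` f ` X = h ` g ` X" by (simp add: f_def image_image inv_simps(2)[OF gG])
    have "h ` g ` X \<noteq> g ` X" using h(3) ab by (auto simp: A_def)
    then have "f ` X \<noteq> X" using gf by metis
    then have fD: "f \<in> D" using fG by (simp add: D_def)
    have "card (X - f ` X) = card (g ` (X - f ` X))" using cimg[OF gG] by simp
    also have "g ` (X - f ` X) = g ` X - h ` g ` X"
      using gf injG[OF gG] by (simp add: image_set_diff)
    also have "\<dots> \<subseteq> A - h ` A"
    proof
      fix y assume y: "y \<in> g ` X - h ` g ` X"
      have "y \<in> X"
      proof (rule ccontr)
        assume "y \<notin> X"
        then have "h y = y" using h by (simp add: supp_in_def)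
        then show False using y by (metis DiffD1 DiffD2 imageI)
      qed
      then show "y \<in> A - h ` A" using y by (auto simp: A_def)
    qed
    then have "card (g ` X - h ` g ` X) \<le> card (A - h ` A)" using finX by (intro card_mono) (auto simp: A_def)
    also have "\<dots> < card (X - g ` X)"
    proof -
      have fA: "finite A" using finX by (simp add: A_def)
      have "card (h ` A \<union> (A - h ` A)) = card A + card (A - h ` A)"
        using fA cimg[OF hG] by (subst card_Un_disjoint) auto
      \<comment> \<open>Strictness comes from \<open>a\<close>: it is not in \<open>A\<close>, being
        outside gX, and not in the image of \<open>A\<close> by the choice of h.\<close>
      moreover have "h ` A \<union> (A - h ` A) \<subseteq> X - {a}"
        using h ab supp_in_image[OF h(1)] by (auto simp: A_def)
      then have "card (h ` A \<union> (A - h ` A)) \<le> card X - 1"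
        using card_mono[of "X - {a}"] finX ab by (metis DiffD1 card_Diff_singleton finite_Diff)
      moreover have "card X = card A + card (X - g ` X)"
        unfolding A_def using finX by (metis card_Int_Diff)
      moreover have "card X > 0" using X by simp
      ultimately show ?thesis by linarith
    qed
    finally have "card (X - f ` X) < card (X - g ` X)" .
    then show ?thesis using g(2) fD by fastforce
  qed
qed

text \<open>X and its translate overlap and their union adds one point, so the subgroups supported
  in the two sets together act transitively on the union: every point can be moved into the
  overlap.\<close>

lemma trans_on_insert:
  assumes X: "X \<subseteq> R" "X \<noteq> R" "card R < 2 * card X" and sep: "separating X" and tr: "trans_on X"
  shows "\<exists>c\<in>R - X. trans_on (insert c X)"
proof -
  have finX: "finite X" using X finite_R finite_subset by blast
  obtain g where g: "g \<in> G" "card (X - g ` X) = 1" using ex_shift assms by blast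
  have cg: "card (g ` X) = card X" using injG[OF g(1)] by (simp add: card_image inj_on_subset)
  have "card (g ` X - X) = 1"
    using g(2) cg card_Int_Diff[OF finX, of "g ` X"] card_Int_Diff[of "g ` X" X] finX
    by (simp add: Int_commute)
  then obtain c where c: "g ` X - X = {c}" by (auto simp: card_1_singleton_iff)
  have "c \<in> g ` X" "c \<notin> X" using c by blast+
  then have cR: "c \<in> R - X" using X in_R_iff[OF g(1)] by auto
  have X': "insert c X = X \<union> g ` X" using c by blast
  have "X \<inter> g ` X \<noteq> {}"
  proof
    assume "X \<inter> g ` X = {}"
    then have "card (X \<union> g ` X) = 2 * card X" using finX cg by (simp add: card_Un_disjoint)
    moreover have "X \<union> g ` X \<subseteq> R" using X in_R_iff[OF g(1)] by auto
    ultimately show False using X card_mono[OF finite_R, of "X \<union> g ` X"] by simp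
  qed
  then obtain z where z: "z \<in> X" "z \<in> g ` X" by blast
  have to_z: "\<exists>h\<in>supp_in (insert c X). h x = z" if x: "x \<in> insert c X" for x
  proof (cases "x \<in> X")
    case True
    then obtain h where "h \<in> supp_in X" "h x = z" using tr z by (auto simp: trans_on_def)
    then show ?thesis using supp_in_closed(5)[of X "insert c X"] by blast
  next
    case False
    then have "x \<in> g ` X" using x c by blast
    then obtain x' z' where xz: "x = g x'" "x' \<in> X" "z = g z'" "z' \<in> X" using z by blast
    then obtain h where h: "h \<in> supp_in X" "h x' = z'" using tr by (auto simp: trans_on_def)
    have "g \<circ> h \<circ> inv g \<in> supp_in (insert c X)"
      using conj_supp_in[OF h(1) g(1)] X' by (intro supp_in_closed(5)[of "g ` X" "insert c X"]) auto
    moreover have "(g \<circ> h \<circ> inv g) x = z" using xz h inv_simps[OF g(1)] by simp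
    ultimately show ?thesis by blast
  qed
  have "trans_on (insert c X)"
    unfolding trans_on_def
  proof (intro ballI)
    fix x y assume "x \<in> insert c X" "y \<in> insert c X"
    then obtain h k where hk: "h \<in> supp_in (insert c X)" "h x = z" "k \<in> supp_in (insert c X)" "k y = z"
      using to_z by meson
    then have "(inv k \<circ> h) x = y" using inv_simps[OF supp_in_G[OF hk(3)]] by (metis o_apply)
    then show "\<exists>h\<in>supp_in (insert c X). h x = y" using hk supp_in_closed(2,3) by blast
  qed
  then show ?thesis using cR by blast
qed

text \<open>The subgroup fixing \<open>c\<close> is transitive on X, so the larger one is doubly
  transitive: a point outside \<open>A\<close> and a point inside it can be sent to a and b
  simultaneously.\<close>

lemma separating_insert:
  assumes c: "c \<notin> X" and tr: "trans_on X" and tr': "trans_on (insert c X)"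
  shows "separating (insert c X)"
  unfolding separating_def
proof (intro allI impI)
  fix A a b
  assume *: "A \<subseteq> insert c X \<and> A \<noteq> {} \<and> A \<noteq> insert c X \<and> a \<in> insert c X \<and> b \<in> insert c X \<and> a \<noteq> b"
  then obtain u w where uw: "u \<in> insert c X" "u \<notin> A" "w \<in> A" "w \<in> insert c X" by blast
  obtain h1 where h1: "h1 \<in> supp_in (insert c X)" "h1 u = c" using tr' uw by (auto simp: trans_on_def)
  obtain h2 where h2: "h2 \<in> supp_in (insert c X)" "h2 c = a" using tr' * unfolding trans_on_def by blast
  have "h1 w \<noteq> c" using h1 uw injG[OF supp_in_G[OF h1(1)]] by (metis injD)
  then have w': "h1 w \<in> X" using supp_in_closed(4)[OF h1(1) uw(4)] by blast
  have "inv h2 b \<noteq> c" using h2 * inv_simps(2)[OF supp_in_G[OF h2(1)]] by metis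
  then have b': "inv h2 b \<in> X" using supp_in_closed(4)[OF supp_in_closed(3)[OF h2(1)], of b] * by blast
  obtain h3 where h3: "h3 \<in> supp_in X" "h3 (h1 w) = inv h2 b" using tr w' b' by (auto simp: trans_on_def)
  have h3c: "h3 c = c" using h3 c by (simp add: supp_in_def)
  define h where "h = h2 \<circ> h3 \<circ> h1"
  have "h3 \<in> supp_in (insert c X)" using h3 by (intro supp_in_closed(5)[of X "insert c X"]) auto
  then have h: "h \<in> supp_in (insert c X)" unfolding h_def using h1 h2 by (intro supp_in_closed(2))
  have "h u = a" "h w = b" using h1 h2 h3 h3c inv_simps(2)[OF supp_in_G[OF h2(1)]] by (auto simp: h_def)
  then have "a \<notin> h ` A" "b \<in> h ` A" using uw injG[OF supp_in_G[OF h]] by (auto dest: injD)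
  then show "\<exists>h\<in>supp_in (insert c X). a \<notin> h ` A \<and> b \<in> h ` A" using h by blast
qed

text \<open>High transitivity relative to \<open>C\<close>: the images of all points outside
  \<open>C\<close> can be prescribed freely within \<open>X\<close>.\<close>

definition extends_on :: "'a set \<Rightarrow> 'a set \<Rightarrow> bool" where
  "extends_on C X \<longleftrightarrow> (\<forall>\<phi>. inj_on \<phi> (X - C) \<and> \<phi> ` (X - C) \<subseteq> X \<longrightarrow> (\<exists>g\<in>supp_in X. \<forall>x\<in>X - C. g x = \<phi> x))"

text \<open>Move \<open>c\<close> to its prescribed place first. Pulled back by that move, the
  remaining prescription avoids \<open>c\<close> and is a problem inside \<open>X\<close>.\<close>

lemma extends_on_insert:
  assumes c: "c \<notin> X" "C \<subseteq> X" and tr': "trans_on (insert c X)" and ext: "extends_on C X"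
  shows "extends_on C (insert c X)"
  unfolding extends_on_def
proof (intro allI impI)
  fix \<phi> assume *: "inj_on \<phi> (insert c X - C) \<and> \<phi> ` (insert c X - C) \<subseteq> insert c X"
  have eq: "insert c X - C = insert c (X - C)" using c by blast
  have "\<phi> c \<in> insert c X" using * eq by auto
  then obtain h where h: "h \<in> supp_in (insert c X)" "h c = \<phi> c" using tr' by (auto simp: trans_on_def)
  note hi = inv_simps[OF supp_in_G[OF h(1)]]
  define \<psi> where "\<psi> = inv h \<circ> \<phi>"
  have "inj_on \<psi> (X - C)"
    unfolding \<psi>_def using * injG[OF supp_in_G[OF supp_in_closed(3)[OF h(1)]]]
    by (intro comp_inj_on) (auto intro: inj_on_subset)
  moreover have "\<psi> x \<in> X" if x: "x \<in> X - C" for x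
  proof -
    have "\<psi> x \<in> insert c X" unfolding \<psi>_def o_apply
      using x * by (intro supp_in_closed(4)[OF supp_in_closed(3)[OF h(1)]]) auto
    moreover have "\<psi> x \<noteq> c"
    proof
      assume "\<psi> x = c"
      then have "\<phi> x = \<phi> c" using h hi by (metis \<psi>_def o_apply)
      then have "x = c" using * x unfolding eq by (metis inj_onD insertI1 insertI2)
      then show False using x c by blast
    qed
    ultimately show ?thesis by blast
  qed
  ultimately obtain g where g: "g \<in> supp_in X" "\<forall>x\<in>X - C. g x = \<psi> x" using ext unfolding extends_on_def by blast
  have "g c = c" using g c by (simp add: supp_in_def)
  then have "\<forall>x\<in>insert c X - C. (h \<circ> g) x = \<phi> x" unfolding eq using g h hi by (auto simp: \<psi>_def)
  moreover have "h \<circ> g \<in> supp_in (insert c X)"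
    using g h by (intro supp_in_closed(2)) (auto intro: supp_in_closed(5)[of X "insert c X"])
  ultimately show "\<exists>g\<in>supp_in (insert c X). \<forall>x\<in>insert c X - C. g x = \<phi> x" by blast
qed

text \<open>Each enlarged set is transitive and separating again, so points can be added until the
  set is \<open>R\<close>.\<close>

lemma extends_on_all:
  assumes C: "C \<subseteq> R" "card R < 2 * card C" and sep: "separating C" and tr: "trans_on C"
  shows "extends_on C R"
proof -
  have "\<exists>X. C \<subseteq> X \<and> X \<subseteq> R \<and> separating X \<and> trans_on X \<and> extends_on C X \<and> card X = card C + n"
    if "card C + n \<le> card R" for n
    using that
  proof (induction n)
    case 0
    have "extends_on C C" unfolding extends_on_def using supp_in_closed(1) by blast
    then show ?case using C sep tr by auto
  next
    case (Suc n)
    then obtain X where X: "C \<subseteq> X" "X \<subseteq> R" "separating X" "trans_on X" "extends_on C X" "card X = card C + n"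
      by auto
    have "X \<noteq> R" using X Suc.prems by auto
    then obtain c where c: "c \<in> R - X" "trans_on (insert c X)"
      using trans_on_insert[of X] X C by auto
    have "card (insert c X) = card C + Suc n" using c X finite_subset[OF X(2) finite_R] by simp
    then show ?case
      using X c separating_insert[of c X] extends_on_insert[of c X C] by (intro exI[of _ "insert c X"]) auto
  qed
  from this[of "card R - card C"] obtain X where X: "X \<subseteq> R" "extends_on C X" "card X = card R"
    using card_mono[OF finite_R C(1)] by auto
  then have "X = R" using finite_R by (intro card_subset_eq) auto
  then show ?thesis using X by simp
qed

section \<open>A cycle of prime length q with at least three fixed points\<close>

context
  fixes \<sigma> :: "'a \<Rightarrow> 'a" and q :: nat
  assumes q: "prime q" "card R < 2 * q" "q + 3 \<le> card R"
    and \<sigma>: "\<sigma> \<in> G" "\<sigma> \<noteq> id" "\<sigma> ^^ q = id"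
begin

definition "\<Gamma> = {x. \<sigma> x \<noteq> x}"

lemma q_gt_3: "q > 3" using q by linarith

lemma \<Gamma>_subset: "\<Gamma> \<subseteq> R"
  using permutes[OF \<sigma>(1)] by (auto simp: \<Gamma>_def permutes_def)

lemma \<sigma>_\<Gamma>: "x \<in> \<Gamma> \<Longrightarrow> (\<sigma> ^^ i) x \<in> \<Gamma>"
proof (induction i)
  case (Suc i)
  then show ?case using injG[OF \<sigma>(1)] by (auto simp: \<Gamma>_def dest: injD)
qed simp

lemma \<sigma>_pow_q: "(\<sigma> ^^ q) x = x" using \<sigma>(3) by simp

text \<open>The support consists of orbits of length q, and |R| < 2q leaves room for only one:
  \<sigma> is a single cycle.\<close>

lemma card_\<Gamma>: "card \<Gamma> = q"
proof -
  have fin: "finite \<Gamma>" using \<Gamma>_subset finite_R finite_subset by blast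
  have "q dvd card \<Gamma>"
    by (rule prime_dvd_card_if_no_fixpoint[OF q(1), where F = \<sigma>])
      (use fin \<sigma>_\<Gamma>[of _ 1] \<sigma>_pow_q in \<open>auto simp: \<Gamma>_def\<close>)
  then obtain k where k: "card \<Gamma> = q * k" by (auto elim: dvdE)
  have "card \<Gamma> < 2 * q" using card_mono[OF finite_R \<Gamma>_subset] q by simp
  then have "k < 2" using k by (simp add: mult.commute)
  moreover have "\<Gamma> \<noteq> {}" using \<sigma>(2) by (auto simp: \<Gamma>_def fun_eq_iff)
  then have "k \<noteq> 0" using k fin by (metis card_0_eq mult_0_right)
  ultimately have "k = 1" by simp
  then show ?thesis using k by simp
qed

lemma \<Gamma>_orbit: assumes "x \<in> \<Gamma>" shows "\<Gamma> = (\<lambda>i. (\<sigma> ^^ i) x) ` {..<q}"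
proof (rule sym, rule card_subset_eq)
  show "finite \<Gamma>" using \<Gamma>_subset finite_R finite_subset by blast
  show "(\<lambda>i. (\<sigma> ^^ i) x) ` {..<q} \<subseteq> \<Gamma>" using \<sigma>_\<Gamma>[OF assms] by blast
  have "inj_on (\<lambda>i. (\<sigma> ^^ i) x) {..<q}"
    using inj_on_prime_orbit[OF q(1) \<sigma>_pow_q] assms by (simp add: \<Gamma>_def)
  then show "card ((\<lambda>i. (\<sigma> ^^ i) x) ` {..<q}) = card \<Gamma>" by (simp add: card_image card_\<Gamma>)
qed

lemma \<sigma>_pow_supp: "\<sigma> ^^ i \<in> supp_in \<Gamma>"
proof -
  have "(\<sigma> ^^ i) x = x" if "x \<notin> \<Gamma>" for x using that by (induction i) (auto simp: \<Gamma>_def)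
  then show ?thesis using funpow_in[OF \<sigma>(1)] by (simp add: supp_in_def)
qed

lemma trans_on_\<Gamma>: "trans_on \<Gamma>"
  unfolding trans_on_def
proof (intro ballI)
  fix x y assume "x \<in> \<Gamma>" "y \<in> \<Gamma>"
  then obtain i where "y = (\<sigma> ^^ i) x" using \<Gamma>_orbit by blast
  then show "\<exists>h\<in>supp_in \<Gamma>. h x = y" using \<sigma>_pow_supp by blast
qed

text \<open>If no power of \<sigma> separated a from b, then A would be stable under the power of
  \<sigma> that carries b to a. That power has prime order without fixed points in A, so A would be
  the whole support.\<close>

lemma separating_\<Gamma>: "separating \<Gamma>"
  unfolding separating_def
proof (intro allI impI, rule ccontr)
  fix A a b assume *: "A \<subseteq> \<Gamma> \<and> A \<noteq> {} \<and> A \<noteq> \<Gamma> \<and> a \<in> \<Gamma> \<and> b \<in> \<Gamma> \<and> a \<noteq> b"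
    and neg: "\<not> (\<exists>h\<in>supp_in \<Gamma>. a \<notin> h ` A \<and> b \<in> h ` A)"
  obtain i where i: "a = (\<sigma> ^^ i) b" using * \<Gamma>_orbit[of b] by blast
  define \<tau> where "\<tau> = \<sigma> ^^ i"
  have \<tau>G: "\<tau> \<in> G" unfolding \<tau>_def by (rule funpow_in[OF \<sigma>(1)])
  have com: "\<tau> ((\<sigma> ^^ j) x) = (\<sigma> ^^ j) (\<tau> x)" for j x
    by (simp add: \<tau>_def flip: funpow_add[THEN fun_cong, unfolded o_apply]) (simp add: add.commute)
  have step: "\<tau> x \<in> A" if x: "x \<in> A" for x
  proof -
    obtain j where j: "b = (\<sigma> ^^ j) x" using x * \<Gamma>_orbit[of x] by blast
    then have "b \<in> (\<sigma> ^^ j) ` A" using x by blast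
    then have "a \<in> (\<sigma> ^^ j) ` A" using neg \<sigma>_pow_supp by blast
    moreover have "a = (\<sigma> ^^ j) (\<tau> x)" using i j com by (simp add: \<tau>_def)
    ultimately show ?thesis using injG[OF funpow_in[OF \<sigma>(1)], of j] by (auto dest: injD)
  qed
  have stepn: "(\<tau> ^^ n) x \<in> A" if "x \<in> A" for x n by (induction n) (use that step in auto)
  obtain x where x: "x \<in> A" using * by blast
  have \<tau>q: "(\<tau> ^^ q) y = y" for y
  proof -
    have "\<tau> ^^ q = (\<sigma> ^^ q) ^^ i" by (simp add: \<tau>_def funpow_mult mult.commute)
    then show ?thesis by (simp add: \<sigma>(3))
  qed
  have "\<tau> x \<noteq> x"
  proof
    assume "\<tau> x = x"
    obtain j where j: "b = (\<sigma> ^^ j) x" using x * \<Gamma>_orbit[of x] by blast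
    then have "\<tau> b = b" using com \<open>\<tau> x = x\<close> by simp
    then show False using i * by (simp add: \<tau>_def)
  qed
  then have "inj_on (\<lambda>n. (\<tau> ^^ n) x) {..<q}" by (intro inj_on_prime_orbit[OF q(1) \<tau>q])
  then have "q = card ((\<lambda>n. (\<tau> ^^ n) x) ` {..<q})" by (simp add: card_image)
  also have "\<dots> \<le> card A"
    using stepn[OF x] finite_subset[OF conjunct1[OF *] finite_subset[OF \<Gamma>_subset finite_R]] by (intro card_mono) auto
  finally have "card \<Gamma> \<le> card A" by (simp add: card_\<Gamma>)
  then have "A = \<Gamma>" using * finite_subset[OF \<Gamma>_subset finite_R] by (intro card_seteq) auto
  then show False using * by simp
qed

lemma ex_agree_outside:
  assumes "\<phi> permutes R" shows "\<exists>g\<in>G. \<forall>x\<in>R - \<Gamma>. g x = \<phi> x"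
proof -
  have "extends_on \<Gamma> R"
    using extends_on_all[OF \<Gamma>_subset _ separating_\<Gamma> trans_on_\<Gamma>] q by (simp add: card_\<Gamma>)
  moreover have "inj_on \<phi> (R - \<Gamma>)" using permutes_inj[OF assms] by (auto intro: inj_on_subset)
  moreover have "\<phi> ` (R - \<Gamma>) \<subseteq> R" using permutes_in_image[OF assms] by auto
  ultimately show ?thesis unfolding extends_on_def using supp_in_G by blast
qed

text \<open>An element of order q moves at least q points, but only q - 1 are available. Together
  with \<open>card_supp_\<Gamma>\<close> this says that \<sigma> generates a Sylow q-subgroup of
  \<open>supp_in \<Gamma>\<close>.\<close>

lemma not_dvd_card_stabilizer:
  assumes x: "x \<in> \<Gamma>" shows "\<not> q dvd card (supp_in (\<Gamma> - {x}))"
proof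
  assume d: "q dvd card (supp_in (\<Gamma> - {x}))"
  interpret S: perm_group R "supp_in (\<Gamma> - {x})"
    by standard (auto simp: finite_R supp_in_closed dest: supp_in_G intro: permutes)
  obtain \<tau> where t: "\<tau> \<in> supp_in (\<Gamma> - {x})" "\<tau> \<noteq> id" "\<tau> ^^ q = id" using S.cauchy[OF q(1) d] by blast
  obtain y where y: "\<tau> y \<noteq> y" using t(2) by (auto simp: fun_eq_iff)
  then have yx: "y \<in> \<Gamma> - {x}" using t(1) by (auto simp: supp_in_def)
  have "inj_on (\<lambda>i. (\<tau> ^^ i) y) {..<q}" by (rule inj_on_prime_orbit) (use q(1) y t(3) in auto)
  then have "q = card ((\<lambda>i. (\<tau> ^^ i) y) ` {..<q})" by (simp add: card_image)
  also have "\<dots> \<le> card (\<Gamma> - {x})"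
  proof (rule card_mono)
    show "finite (\<Gamma> - {x})" using \<Gamma>_subset finite_R finite_subset by blast
    have "(\<tau> ^^ i) y \<in> \<Gamma> - {x}" for i
      by (induction i) (use yx supp_in_closed(4)[OF t(1)] in auto)
    then show "(\<lambda>i. (\<tau> ^^ i) y) ` {..<q} \<subseteq> \<Gamma> - {x}" by blast
  qed
  also have "\<dots> = q - 1" using x by (simp add: card_\<Gamma>)
  finally show False using q_gt_3 by simp
qed

lemma card_supp_\<Gamma>:
  assumes x: "x \<in> \<Gamma>" shows "card (supp_in \<Gamma>) = q * card (supp_in (\<Gamma> - {x}))"
proof -
  have "supp_in \<Gamma> = (\<lambda>(i, h). (\<sigma> ^^ i) \<circ> h) ` ({..<q} \<times> supp_in (\<Gamma> - {x}))"
  proof (intro set_eqI iffI)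
    fix f assume f: "f \<in> supp_in \<Gamma>"
    then have "f x \<in> \<Gamma>" using supp_in_closed(4) x by blast
    then obtain i where i: "i < q" "f x = (\<sigma> ^^ i) x" using \<Gamma>_orbit[OF x] by blast
    define h where "h = inv (\<sigma> ^^ i) \<circ> f"
    note si = inv_simps[OF funpow_in[OF \<sigma>(1)], of i]
    have "h \<in> supp_in \<Gamma>" unfolding h_def using f supp_in_closed(2,3) \<sigma>_pow_supp by blast
    moreover have "h x = x" using i si by (simp add: h_def)
    ultimately have "h \<in> supp_in (\<Gamma> - {x})" by (auto simp: supp_in_def)
    moreover have "f = (\<sigma> ^^ i) \<circ> h" using si by (auto simp: h_def fun_eq_iff)
    ultimately show "f \<in> (\<lambda>(i, h). (\<sigma> ^^ i) \<circ> h) ` ({..<q} \<times> supp_in (\<Gamma> - {x}))" using i by auto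
  next
    fix f assume "f \<in> (\<lambda>(i, h). (\<sigma> ^^ i) \<circ> h) ` ({..<q} \<times> supp_in (\<Gamma> - {x}))"
    then obtain i h where "f = (\<sigma> ^^ i) \<circ> h" "h \<in> supp_in (\<Gamma> - {x})" by auto
    then show "f \<in> supp_in \<Gamma>"
      using supp_in_closed(2)[OF \<sigma>_pow_supp supp_in_closed(5)[of "\<Gamma> - {x}" \<Gamma>]] by auto
  qed
  moreover have "inj_on (\<lambda>(i, h). (\<sigma> ^^ i) \<circ> h) ({..<q} \<times> supp_in (\<Gamma> - {x}))"
  proof (rule inj_onI)
    fix u w assume uw: "u \<in> {..<q} \<times> supp_in (\<Gamma> - {x})" "w \<in> {..<q} \<times> supp_in (\<Gamma> - {x})"
      "(\<lambda>(i, h). (\<sigma> ^^ i) \<circ> h) u = (\<lambda>(i, h). (\<sigma> ^^ i) \<circ> h) w"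
    obtain i h j k where u: "u = (i, h)" and w: "w = (j, k)" by (cases u; cases w)
    have *: "i \<in> {..<q}" "j \<in> {..<q}" "h \<in> supp_in (\<Gamma> - {x})" "k \<in> supp_in (\<Gamma> - {x})"
      and eq: "(\<sigma> ^^ i) \<circ> h = (\<sigma> ^^ j) \<circ> k" using uw by (auto simp: u w)
    have "h x = x" "k x = x" using * by (auto simp: supp_in_def)
    then have "(\<sigma> ^^ i) x = (\<sigma> ^^ j) x" using fun_cong[OF eq, of x] by simp
    then have ij: "i = j" using inj_on_prime_orbit[OF q(1) \<sigma>_pow_q] x * by (auto simp: \<Gamma>_def dest: inj_onD)
    have "h = k"
    proof
      fix y show "h y = k y" using fun_cong[OF eq, of y] ij injG[OF funpow_in[OF \<sigma>(1), of j]] by (auto dest: injD)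
    qed
    then show "u = w" using ij by (simp add: u w)
  qed
  ultimately show ?thesis by (simp add: card_image card_cartesian_product)
qed

text \<open>The Frattini argument as a count. The coset \<open>C\<close> of
  \<open>supp_in \<Gamma>\<close> splits into left cosets of the cyclic group, and their number is
  prime to q. Left multiplication by \<sigma> permutes these cosets with q-th power trivial, so it
  fixes one, and a representative of that coset normalises the cyclic group. Changing g within
  \<open>C\<close> leaves it unaltered outside the cycle.\<close>

lemma ex_normalizing:
  assumes g: "g \<in> G" "g ` \<Gamma> = \<Gamma>"
  shows "\<exists>f\<in>G. \<exists>i. (\<forall>x\<in>R - \<Gamma>. f x = g x) \<and> f ` \<Gamma> = \<Gamma> \<and> \<sigma> \<circ> f = f \<circ> (\<sigma> ^^ i)"
proof -
  obtain x0 where x0: "x0 \<in> \<Gamma>" using card_\<Gamma> q_gt_3 by (metis card.empty ex_in_conv not_less_zero)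
  define C where "C = (\<lambda>h. g \<circ> h) ` supp_in \<Gamma>"
  define cos where "cos f = (\<lambda>i. f \<circ> (\<sigma> ^^ i)) ` {..<q}" for f :: "'a \<Rightarrow> 'a"
  have q0: "q > 0" using q_gt_3 by simp
  have \<sigma>C: "\<sigma> \<circ> f \<in> C" if f: "f \<in> C" for f
  proof -
    obtain h where h: "h \<in> supp_in \<Gamma>" "f = g \<circ> h" using f unfolding C_def by blast
    have "inv g ` \<Gamma> = \<Gamma>"
      using g(2) inv_simps(1)[OF g(1)] by (metis (no_types, lifting) image_cong image_ident image_image)
    then have "inv g \<circ> \<sigma> \<circ> inv (inv g) \<in> supp_in \<Gamma>"
      using conj_supp_in[OF \<sigma>_pow_supp[of 1] inv_in[OF g(1)]] by simp
    then have "inv g \<circ> \<sigma> \<circ> g \<in> supp_in \<Gamma>" using inv_inv_eq[OF bijG[OF g(1)]] by simp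
    then have "inv g \<circ> \<sigma> \<circ> g \<circ> h \<in> supp_in \<Gamma>" using h supp_in_closed(2) by blast
    moreover have "\<sigma> \<circ> f = g \<circ> (inv g \<circ> \<sigma> \<circ> g \<circ> h)" by (auto simp: h inv_simps[OF g(1)])
    ultimately show ?thesis by (auto simp: C_def)
  qed
  have Cpow: "f \<circ> (\<sigma> ^^ i) \<in> C" if "f \<in> C" for f i
    using that supp_in_closed(2)[OF _ \<sigma>_pow_supp] by (auto simp: C_def o_assoc[symmetric])
  have modq: "\<sigma> ^^ i = \<sigma> ^^ (i mod q)" for i
  proof
    fix x
    have "(\<sigma> ^^ i) x = (\<sigma> ^^ (i mod q + (i div q) * q)) x" by (simp add: mult.commute)
    also have "\<dots> = (\<sigma> ^^ (i mod q)) x"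
      using funpow_mult_fixed[OF \<sigma>_pow_q] by (simp only: funpow_add o_apply)
    finally show "(\<sigma> ^^ i) x = (\<sigma> ^^ (i mod q)) x" .
  qed
  have cos_mem: "f \<circ> (\<sigma> ^^ i) \<in> cos f" for f i
    unfolding cos_def using q0 modq[of i] by (intro image_eqI[of _ _ "i mod q"]) auto
  have cos_self: "f \<in> cos f" for f using cos_mem[of f 0] by (simp add: id_def o_def)
  have cos_eq: "cos f' = cos f" if f': "f' \<in> cos f" for f f'
  proof -
    obtain i where i: "f' = f \<circ> (\<sigma> ^^ i)" "i < q" using f' by (auto simp: cos_def)
    have "f = f' \<circ> (\<sigma> ^^ (q - i))"
    proof -
      have "f' \<circ> (\<sigma> ^^ (q - i)) = f \<circ> (\<sigma> ^^ i \<circ> \<sigma> ^^ (q - i))" by (simp add: i o_assoc)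
      also have "\<sigma> ^^ i \<circ> \<sigma> ^^ (q - i) = \<sigma> ^^ q" using i by (simp flip: funpow_add)
      finally show ?thesis using \<sigma>(3) by (simp add: fun_eq_iff)
    qed
    then have "f \<circ> (\<sigma> ^^ j) = f' \<circ> (\<sigma> ^^ (q - i + j))" for j by (simp add: funpow_add o_assoc)
    then have "cos f \<subseteq> cos f'" using cos_mem[of f'] by (auto simp: cos_def[of f])
    moreover have "f' \<circ> (\<sigma> ^^ j) = f \<circ> (\<sigma> ^^ (i + j))" for j by (simp add: i funpow_add o_assoc)
    then have "cos f' \<subseteq> cos f" using cos_mem[of f] by (auto simp: cos_def[of f'])
    ultimately show ?thesis by blast
  qed
  have CG: "C \<subseteq> G" using g supp_in_G comp_in by (auto simp: C_def)
  have finC: "finite C" using CG finite_G finite_subset by blast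
  have card_cos: "card (cos f) = q" if "f \<in> C" for f
  proof -
    have "inj_on (\<lambda>i. f \<circ> (\<sigma> ^^ i)) {..<q}"
    proof (rule inj_onI)
      fix i j assume ij: "i \<in> {..<q}" "j \<in> {..<q}" "f \<circ> (\<sigma> ^^ i) = f \<circ> (\<sigma> ^^ j)"
      have "f ((\<sigma> ^^ i) x0) = f ((\<sigma> ^^ j) x0)" using fun_cong[OF ij(3), of x0] by simp
      then have "(\<sigma> ^^ i) x0 = (\<sigma> ^^ j) x0" using injG CG that by (auto dest: injD)
      then show "i = j" using inj_on_prime_orbit[OF q(1) \<sigma>_pow_q] x0 ij by (auto simp: \<Gamma>_def dest: inj_onD)
    qed
    then show ?thesis by (simp add: cos_def card_image)
  qed
  have UC: "\<Union>(cos ` C) = C" using Cpow cos_self by (auto simp: cos_def)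
  have "q * card (cos ` C) = card (\<Union>(cos ` C))"
  proof (rule card_partition)
    show "finite (cos ` C)" "finite (\<Union>(cos ` C))" using finC UC by auto
    show "card c = q" if "c \<in> cos ` C" for c using that card_cos by auto
    show "c1 \<inter> c2 = {}" if "c1 \<in> cos ` C" "c2 \<in> cos ` C" "c1 \<noteq> c2" for c1 c2
      using that cos_eq by blast
  qed
  also have "\<dots> = card (supp_in \<Gamma>)"
  proof -
    have "inj_on (\<lambda>h. g \<circ> h) (supp_in \<Gamma>)"
    proof (rule inj_onI)
      fix a b assume eq: "g \<circ> a = g \<circ> b"
      show "a = b"
      proof
        fix x show "a x = b x" using fun_cong[OF eq, of x] injG[OF g(1)] by (auto dest: injD)
      qed
    qed
    then show ?thesis unfolding UC by (simp add: C_def card_image)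
  qed
  also have "\<dots> = q * card (supp_in (\<Gamma> - {x0}))" by (rule card_supp_\<Gamma>[OF x0])
  finally have nd: "\<not> q dvd card (cos ` C)" using not_dvd_card_stabilizer[OF x0] q0 by simp
  define F where "F = (\<lambda>Y :: ('a \<Rightarrow> 'a) set. (\<lambda>f. \<sigma> \<circ> f) ` Y)"
  have Fcos: "F (cos f) = cos (\<sigma> \<circ> f)" for f by (simp add: F_def cos_def image_image o_assoc)
  have Fpow: "(F ^^ n) Y = (\<lambda>f. (\<sigma> ^^ n) \<circ> f) ` Y" for n Y
  proof (induction n)
    case (Suc n)
    have "(F ^^ Suc n) Y = (\<lambda>f. \<sigma> \<circ> f) ` (F ^^ n) Y" by (simp only: funpow.simps o_apply) (simp only: F_def)
    also have "\<dots> = (\<lambda>f. \<sigma> \<circ> f) ` (\<lambda>f. (\<sigma> ^^ n) \<circ> f) ` Y" by (simp only: Suc)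
    also have "\<dots> = (\<lambda>f. (\<sigma> ^^ Suc n) \<circ> f) ` Y" unfolding image_image by (rule image_cong) auto
    finally show ?case .
  qed simp
  have "\<exists>Y\<in>cos ` C. F Y = Y"
  proof (rule ccontr)
    assume "\<not> ?thesis"
    then have "q dvd card (cos ` C)"
      using finC \<sigma>C by (intro prime_dvd_card_if_no_fixpoint[OF q(1), where F = F]) (auto simp: Fcos Fpow \<sigma>(3))
    then show False using nd by simp
  qed
  then obtain f where f: "f \<in> C" "cos (\<sigma> \<circ> f) = cos f" using Fcos by auto
  then have "\<sigma> \<circ> f \<in> cos f" using cos_self by metis
  then obtain i where i: "\<sigma> \<circ> f = f \<circ> (\<sigma> ^^ i)" by (auto simp: cos_def)
  obtain h where h: "h \<in> supp_in \<Gamma>" "f = g \<circ> h" using f unfolding C_def by blast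
  have "f ` \<Gamma> = \<Gamma>" using supp_in_image[OF h(1)] g by (simp add: h image_image[symmetric] image_comp[symmetric])
  moreover have "\<forall>x\<in>R - \<Gamma>. f x = g x" using h by (auto simp: supp_in_def)
  ultimately show ?thesis using f CG i by blast
qed

lemma three_cycle_cube: "distinct [a, b, c] \<Longrightarrow> (tr a b \<circ> tr b c) ^^ 3 = id"
  by (auto simp: fun_eq_iff eval_nat_numeral transpose_eq_iff Transposition.transpose_def)

text \<open>Take f and h acting as (a b) and (b c) off the cycle and normalising it. The
  automorphisms of a cyclic group commute, so the commutator of f and h centralises \<sigma> and is
  a power of \<sigma> on the cycle. Its q-th power is therefore trivial there, and off the cycle it
  is a power of the 3-cycle prime to 3, because q is not 3.\<close>

lemma ex_three_cycle:
  "\<exists>a b c. distinct [a, b, c] \<and> {a, b, c} \<subseteq> R - \<Gamma> \<and> tr a b \<circ> tr b c \<in> G"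
proof -
  have "card (R - \<Gamma>) \<ge> 3"
    using q card_\<Gamma> \<Gamma>_subset finite_subset[OF \<Gamma>_subset finite_R] by (simp add: card_Diff_subset)
  then obtain S where S: "S \<subseteq> R - \<Gamma>" "card S = 3" using obtain_subset_with_card_n by metis
  then obtain a b c where abc: "distinct [a, b, c]" "{a, b, c} \<subseteq> R - \<Gamma>"
    unfolding card_3_iff by auto
  have normalizing: "\<exists>f\<in>G. \<exists>i. (\<forall>x\<in>R - \<Gamma>. f x = tr d e x) \<and> f ` \<Gamma> = \<Gamma> \<and> \<sigma> \<circ> f = f \<circ> (\<sigma> ^^ i)"
    if de: "d \<in> R - \<Gamma>" "e \<in> R - \<Gamma>" for d e
  proof -
    have "tr d e permutes R" using de by (intro permutes_swap_id) auto
    then obtain g where g: "g \<in> G" "\<forall>x\<in>R - \<Gamma>. g x = tr d e x" using ex_agree_outside by blast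
    have "tr d e ` (R - \<Gamma>) = R - \<Gamma>" using de by simp
    then have gD: "g ` (R - \<Gamma>) = R - \<Gamma>" using g(2) by (metis image_cong)
    have gR: "g ` R = R" using permutes_image[OF permutes[OF g(1)]] .
    have "g ` \<Gamma> = g ` (R - (R - \<Gamma>))" using \<Gamma>_subset by (simp add: double_diff)
    also have "\<dots> = g ` R - g ` (R - \<Gamma>)" by (rule image_set_diff[OF injG[OF g(1)]])
    also have "\<dots> = \<Gamma>" unfolding gD gR using \<Gamma>_subset by blast
    finally have "g ` \<Gamma> = \<Gamma>" .
    from ex_normalizing[OF g(1) this] g(2) show ?thesis by metis
  qed
  obtain f i where f: "f \<in> G" "\<forall>x\<in>R - \<Gamma>. f x = tr a b x" "f ` \<Gamma> = \<Gamma>" "\<sigma> \<circ> f = f \<circ> (\<sigma> ^^ i)"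
    using normalizing[of a b] abc by auto
  obtain h j where h: "h \<in> G" "\<forall>x\<in>R - \<Gamma>. h x = tr b c x" "h ` \<Gamma> = \<Gamma>" "\<sigma> \<circ> h = h \<circ> (\<sigma> ^^ j)"
    using normalizing[of b c] abc by auto
  have pow: "(\<sigma> ^^ n) (k x) = k ((\<sigma> ^^ (m * n)) x)" if "\<sigma> \<circ> k = k \<circ> (\<sigma> ^^ m)" for n k m x
  proof (induction n arbitrary: x)
    case (Suc n)
    have "(\<sigma> ^^ Suc n) (k x) = (\<sigma> ^^ n) (\<sigma> (k x))" by (simp add: funpow_swap1)
    also have "\<sigma> (k x) = k ((\<sigma> ^^ m) x)" using fun_cong[OF that, of x] by simp
    also have "(\<sigma> ^^ n) (k ((\<sigma> ^^ m) x)) = k ((\<sigma> ^^ (m * n)) ((\<sigma> ^^ m) x))" by (rule Suc)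
    also have "(\<sigma> ^^ (m * n)) ((\<sigma> ^^ m) x) = (\<sigma> ^^ (m * Suc n)) x"
      by (simp add: add.commute flip: funpow_add[THEN fun_cong, unfolded o_apply])
    finally show ?case .
  qed simp
  define A where "A = f \<circ> h"
  define B where "B = h \<circ> f"
  have AB: "A \<in> G" "B \<in> G" using f h comp_in by (auto simp: A_def B_def)
  \<comment> \<open>Both orders of composition turn \<sigma> into the same power i * j; this is the
    commutativity used for the commutator \<open>e\<close>.\<close>
  have \<sigma>A: "\<sigma> (A x) = A ((\<sigma> ^^ (i * j)) x)" for x
    using fun_cong[OF f(4), of "h x"] pow[OF h(4), of i x] by (simp add: A_def mult.commute)
  have \<sigma>B: "\<sigma> (B x) = B ((\<sigma> ^^ (i * j)) x)" for x
    using fun_cong[OF h(4), of "f x"] pow[OF f(4), of j x] by (simp add: B_def)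
  note Bi = inv_simps[OF AB(2)]
  define e where "e = A \<circ> inv B"
  have eG: "e \<in> G" using AB inv_in comp_in by (simp add: e_def)
  have \<sigma>e: "\<sigma> (e x) = e (\<sigma> x)" for x
  proof -
    have "\<sigma> x = B ((\<sigma> ^^ (i * j)) (inv B x))" using \<sigma>B[of "inv B x"] by (simp add: Bi)
    then have "inv B (\<sigma> x) = (\<sigma> ^^ (i * j)) (inv B x)" by (metis Bi(1))
    then show ?thesis by (simp add: e_def \<sigma>A)
  qed
  have "B ` \<Gamma> = \<Gamma>" unfolding B_def using f h by (metis image_comp)
  then have "inv B ` \<Gamma> = \<Gamma>" by (metis (no_types, lifting) Bi(1) image_cong image_ident image_image)
  then have e\<Gamma>: "e ` \<Gamma> = \<Gamma>" unfolding e_def A_def using f h by (metis image_comp)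
  obtain x0 where x0: "x0 \<in> \<Gamma>" using card_\<Gamma> q_gt_3 by (metis card.empty ex_in_conv not_less_zero)
  then obtain n where n: "e x0 = (\<sigma> ^^ n) x0" using e\<Gamma> \<Gamma>_orbit[OF x0] by blast
  have com: "e ((\<sigma> ^^ m) x) = (\<sigma> ^^ m) (e x)" for m x by (induction m) (auto simp flip: \<sigma>e)
  have e_\<Gamma>: "e x = (\<sigma> ^^ n) x" if "x \<in> \<Gamma>" for x
  proof -
    from equalityD1[OF \<Gamma>_orbit[OF x0]] that have "x \<in> (\<lambda>i. (\<sigma> ^^ i) x0) ` {..<q}" by (rule subsetD)
    then obtain m where m: "x = (\<sigma> ^^ m) x0" by (rule imageE)
    have "e x = (\<sigma> ^^ m) (e x0)" unfolding m by (rule com)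
    also have "\<dots> = (\<sigma> ^^ (m + n)) x0" unfolding n by (simp only: funpow_add o_apply)
    also have "\<dots> = (\<sigma> ^^ n) x" 
    proof -
      have "m + n = n + m" by simp
      then have "(\<sigma> ^^ (m + n)) x0 = (\<sigma> ^^ (n + m)) x0" by (rule arg_cong)
      then show ?thesis unfolding m by (simp only: funpow_add o_apply)
    qed
    finally show ?thesis .
  qed
  have ek_\<Gamma>: "(e ^^ k) x = (\<sigma> ^^ (n * k)) x" if "x \<in> \<Gamma>" for k x
    by (induction k) (use that e_\<Gamma> \<sigma>_\<Gamma> in \<open>auto simp: funpow_add\<close>)
  define u where "u = tr a b \<circ> tr b c"
  have u3: "u ^^ 3 = id" unfolding u_def by (rule three_cycle_cube[OF abc(1)])
  have u_\<Gamma>: "u x = x" if "x \<notin> R - \<Gamma>" for x using abc that by (auto simp: u_def Transposition.transpose_def)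
  have uD: "u x \<in> R - \<Gamma>" if "x \<in> R - \<Gamma>" for x
    using abc that by (auto simp: u_def Transposition.transpose_def)
  have eD: "e x = u (u x)" if x: "x \<in> R - \<Gamma>" for x
  proof -
    have tD: "tr a b y \<in> R - \<Gamma>" "tr b c y \<in> R - \<Gamma>" if "y \<in> R - \<Gamma>" for y
      using abc that by (auto simp: Transposition.transpose_def)
    have "B (tr a b (tr b c x)) = x"
      using f h tD x by (simp add: B_def)
    then have "inv B x = tr a b (tr b c x)" using Bi by metis
    then show ?thesis using f h tD x by (simp add: e_def A_def u_def)
  qed
  have ekD: "(e ^^ k) x = (u ^^ (2 * k)) x \<and> (e ^^ k) x \<in> R - \<Gamma>" if "x \<in> R - \<Gamma>" for k x
  proof (induction k)
    case (Suc k)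
    have "(e ^^ Suc k) x = u (u ((u ^^ (2 * k)) x))" using eD[OF conjunct2[OF Suc]] Suc by simp
    moreover have "(e ^^ Suc k) x \<in> R - \<Gamma>"
      using uD[OF uD[OF conjunct2[OF Suc]]] eD[OF conjunct2[OF Suc]] by (simp only: funpow.simps o_apply)
    ultimately show ?case by simp
  qed (use that in simp)
  have "e ^^ q = u ^^ (2 * q)"
  proof
    fix x
    consider "x \<in> \<Gamma>" | "x \<in> R - \<Gamma>" | "x \<notin> R" by blast
    then show "(e ^^ q) x = (u ^^ (2 * q)) x"
    proof cases
      case 1
      have "(u ^^ m) x = x" for m by (induction m) (use 1 u_\<Gamma> in auto)
      moreover have "(\<sigma> ^^ (n * q)) x = x" using funpow_mult_fixed[OF \<sigma>_pow_q] .
      ultimately show ?thesis using ek_\<Gamma>[OF 1] by simp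
    next
      case 2 then show ?thesis using ekD by blast
    next
      case 3
      have "(u ^^ m) x = x" for m by (induction m) (use 3 u_\<Gamma> in auto)
      moreover have "(e ^^ m) x = x" for m
        by (induction m) (use 3 permutes_not_in[OF permutes[OF eG]] in auto)
      ultimately show ?thesis by simp
    qed
  qed
  then have uq: "u ^^ (2 * q) \<in> G" using funpow_in[OF eG] by metis
  have q3: "coprime q 3" using q(1) q_gt_3 by (intro primes_coprime) auto
  have um: "u ^^ m = u ^^ (m mod 3)" for m
  proof
    fix x
    have "(u ^^ m) x = (u ^^ (m mod 3 + (m div 3) * 3)) x" by (simp add: mult.commute)
    also have "\<dots> = (u ^^ (m mod 3)) x"
      using funpow_mult_fixed[of 3 u x "m div 3"] u3 by (simp only: funpow_add o_apply id_apply)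
    finally show "(u ^^ m) x = (u ^^ (m mod 3)) x" .
  qed
  \<comment> \<open>Off the cycle \<open>e\<close> acts as the square of \<open>u\<close>, so G
    contains u^(2q); the residue of q decides whether this power or its square equals
    \<open>u\<close>.\<close>
  have "q mod 3 = 1 \<or> q mod 3 = 2"
  proof -
    have "\<not> 3 dvd q" using q3 by (auto dest: coprime_common_divisor[of q 3 3])
    then show ?thesis by presburger
  qed
  then have "u \<in> G"
  proof
    assume "q mod 3 = 1"
    then have "(2 * (2 * q)) mod 3 = 1" by presburger
    then have "u = u ^^ (2 * (2 * q))" using um[of "2 * (2 * q)"] by simp
    also have "\<dots> = (u ^^ (2 * q)) \<circ> (u ^^ (2 * q))" by (metis funpow_add mult_2)
    finally show "u \<in> G" using comp_in[OF uq uq] by simp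
  next
    assume "q mod 3 = 2"
    then have "(2 * q) mod 3 = 1" by presburger
    then show "u \<in> G" using um[of "2 * q"] uq by simp
  qed
  then show ?thesis using abc by (auto simp: u_def)
qed

text \<open>The one known 3-cycle is conjugated by an element of G that sends its points to a, b, c;
  it exists because its three points lie off the support of \<sigma>, where images can be
  prescribed.\<close>

lemma all_three_cycles:
  assumes "distinct [a, b, c]" "a \<in> R" "b \<in> R" "c \<in> R"
  shows "tr a b \<circ> tr b c \<in> G"
proof -
  obtain d e f where def: "distinct [d, e, f]" "{d, e, f} \<subseteq> R - \<Gamma>" "tr d e \<circ> tr e f \<in> G"
    using ex_three_cycle by blast
  \<comment> \<open>The images of d, e, f are corrected one after the other; each new transposition
    leaves the points already placed alone.\<close>
  define p1 where "p1 = tr d a"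
  define p2 where "p2 = tr (p1 e) b \<circ> p1"
  define p3 where "p3 = tr (p2 f) c \<circ> p2"
  have p1: "p1 permutes R" using def assms by (auto simp: p1_def intro: permutes_swap_id)
  have p2: "p2 permutes R" unfolding p2_def
    using def assms permutes_in_image[OF p1] by (intro permutes_compose p1 permutes_swap_id) auto
  have p3: "p3 permutes R" unfolding p3_def
    using def assms permutes_in_image[OF p2] by (intro permutes_compose p2 permutes_swap_id) auto
  have "p1 d = a" by (simp add: p1_def)
  moreover have "p1 e \<noteq> a" using \<open>p1 d = a\<close> def injD[OF permutes_inj[OF p1], of e d] by auto
  ultimately have p2d: "p2 d = a" "p2 e = b" using assms by (auto simp: p2_def)
  have "p2 f \<noteq> a" "p2 f \<noteq> b"
    using p2d def injD[OF permutes_inj[OF p2], of f d] injD[OF permutes_inj[OF p2], of f e] by auto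
  then have p3d: "p3 d = a" "p3 e = b" "p3 f = c" using p2d assms by (auto simp: p3_def)
  obtain g where g: "g \<in> G" "\<forall>x\<in>R - \<Gamma>. g x = p3 x" using ex_agree_outside[OF p3] by blast
  have gd: "g d = a" "g e = b" "g f = c" using g def p3d by auto
  have cj: "g (tr x y z) = tr (g x) (g y) (g z)" for x y z
    using injG[OF g(1)] by (auto simp: Transposition.transpose_def dest: injD)
  have "(g \<circ> (tr d e \<circ> tr e f) \<circ> inv g) x = (tr a b \<circ> tr b c) x" for x
    using gd by (simp add: cj inv_simps[OF g(1)])
  then have "g \<circ> (tr d e \<circ> tr e f) \<circ> inv g = tr a b \<circ> tr b c" by blast
  then show ?thesis using comp_in inv_in g(1) def(3) by metis
qed

text \<open>Containment of the alternating group, phrased through products of two transpositions so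
  that no sign function is involved.\<close>

theorem jordan_prime_cycle:
  assumes "a \<in> R" "b \<in> R" "c \<in> R" "d \<in> R" "a \<noteq> b" "c \<noteq> d"
  shows "tr a b \<circ> tr c d \<in> G"
proof -
  have share: "tr a b \<circ> tr b c \<in> G" if "a \<in> R" "b \<in> R" "c \<in> R" "a \<noteq> b" "b \<noteq> c" for a b c
  proof (cases "a = c")
    case True then show ?thesis using id_in by (simp add: transpose_commute)
  next
    case False then show ?thesis using all_three_cycles that by simp
  qed
  show ?thesis
  proof (cases "b = c")
    case True then show ?thesis using share[of a b d] assms by simp
  next
    case False
    have "tr a b \<circ> tr c d = (tr a b \<circ> tr b c) \<circ> (tr b c \<circ> tr c d)" by (simp add: fun_eq_iff)
    then show ?thesis using share[of a b c] share[of b c d] assms False comp_in by metis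
  qed
qed

end

end

section \<open>Sign characters on a group containing the alternating group\<close>

context perm_group
begin

text \<open>Every permutation is in G with sign 1, or becomes so after composition with a fixed
  transposition t. If both g and t composed with g were in G, then t would be in G and G would be
  everything. Later \<open>\<epsilon>\<close> is the action on the product of root
  differences.\<close>

lemma sign_trivial_if_not_full:
  fixes \<epsilon> :: "('a \<Rightarrow> 'a) \<Rightarrow> int"
  assumes pairs: "\<And>a b c d. a \<in> R \<Longrightarrow> b \<in> R \<Longrightarrow> c \<in> R \<Longrightarrow> d \<in> R \<Longrightarrow> a \<noteq> b \<Longrightarrow> c \<noteq> d \<Longrightarrow> tr a b \<circ> tr c d \<in> G"
    and hom: "\<And>p q. p permutes R \<Longrightarrow> q permutes R \<Longrightarrow> \<epsilon> (p \<circ> q) = \<epsilon> p * \<epsilon> q"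
    and pm: "\<And>p. p permutes R \<Longrightarrow> \<epsilon> p = 1 \<or> \<epsilon> p = - 1"
    and not_full: "G \<noteq> {p. p permutes R}" and g: "g \<in> G"
  shows "\<epsilon> g = 1"
proof -
  have id1: "\<epsilon> id = 1" using hom[OF permutes_id permutes_id] pm[OF permutes_id] by auto
  have tp: "tr a b permutes R" if "a \<in> R" "b \<in> R" for a b using that by (rule permutes_swap_id)
  have share: "\<epsilon> (tr a b \<circ> tr b c) = 1" if "a \<in> R" "b \<in> R" "c \<in> R" "a \<noteq> b" "b \<noteq> c" for a b c
  proof (cases "a = c")
    case True then show ?thesis using id1 by (simp add: transpose_commute)
  next
    case False
    define u where "u = tr a b \<circ> tr b c"
    have up: "u permutes R" unfolding u_def using tp that by (intro permutes_compose) auto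
    \<comment> \<open>A sign whose cube is 1 is 1, so 3-cycles are even for every such
      \<open>\<epsilon>\<close>.\<close>
    have "u \<circ> (u \<circ> u) = id"
      using False that by (auto simp: u_def fun_eq_iff Transposition.transpose_def)
    then have "\<epsilon> u * (\<epsilon> u * \<epsilon> u) = 1" using hom up permutes_compose[OF up up] id1 by metis
    then show ?thesis using pm[OF up] by (auto simp: u_def)
  qed
  have pair1: "\<epsilon> (tr a b \<circ> tr c d) = 1"
    if "a \<in> R" "b \<in> R" "c \<in> R" "d \<in> R" "a \<noteq> b" "c \<noteq> d" for a b c d
  proof (cases "b = c")
    case True then show ?thesis using share[of a b d] that by simp
  next
    case False
    have "tr a b \<circ> tr c d = (tr a b \<circ> tr b c) \<circ> (tr b c \<circ> tr c d)" by (simp add: fun_eq_iff)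
    moreover have "tr a b \<circ> tr b c permutes R" "tr b c \<circ> tr c d permutes R"
      using tp that by (intro permutes_compose; simp)+
    ultimately have "\<epsilon> (tr a b \<circ> tr c d) = \<epsilon> (tr a b \<circ> tr b c) * \<epsilon> (tr b c \<circ> tr c d)"
      using hom by metis
    then show ?thesis using share[of a b c] share[of b c d] that False by simp
  qed
  show ?thesis
  proof (cases "\<exists>a\<in>R. \<exists>b\<in>R. a \<noteq> b")
    case False
    then have "p = id" if "p permutes R" for p
      using that permutes_in_image[OF that] permutes_not_in[OF that] by (metis eq_id_iff)
    then show ?thesis using permutes[OF g] id1 by metis
  next
    case True
    then obtain a b where ab: "a \<in> R" "b \<in> R" "a \<noteq> b" by blast
    define t where "t = tr a b"
    have tt: "t \<circ> (t \<circ> p) = p" for p by (simp add: t_def fun_eq_iff)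
    have key: "(p \<in> G \<and> \<epsilon> p = 1) \<or> (t \<circ> p \<in> G \<and> \<epsilon> (t \<circ> p) = 1)" if "p permutes R" for p
      using that finite_R
    proof (induction rule: permutes_induct)
      case id then show ?case using id_in id1 by blast
    next
      case (swap c d p)
      have tcd: "t \<circ> tr c d \<in> G" "\<epsilon> (t \<circ> tr c d) = 1" "tr c d \<circ> t \<in> G" "\<epsilon> (tr c d \<circ> t) = 1"
        using pairs[of a b c d] pairs[of c d a b] pair1[of a b c d] pair1[of c d a b] ab swap by (auto simp: t_def)
      have perms: "t \<circ> tr c d permutes R" "tr c d \<circ> t permutes R" "t permutes R"
        unfolding t_def using tp ab swap by (auto intro!: permutes_compose)
      from swap.IH show ?case
      proof
        assume p: "p \<in> G \<and> \<epsilon> p = 1"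
        have "t \<circ> (tr c d \<circ> p) = (t \<circ> tr c d) \<circ> p" by (simp add: o_assoc)
        moreover have "(t \<circ> tr c d) \<circ> p \<in> G" using p tcd comp_in by blast
        moreover have "\<epsilon> ((t \<circ> tr c d) \<circ> p) = 1" using p tcd hom[OF perms(1) swap.hyps(4)] by simp
        ultimately show ?thesis by metis
      next
        assume p: "t \<circ> p \<in> G \<and> \<epsilon> (t \<circ> p) = 1"
        have "tr c d \<circ> p = (tr c d \<circ> t) \<circ> (t \<circ> p)" by (simp add: o_assoc[symmetric] tt)
        moreover have "(tr c d \<circ> t) \<circ> (t \<circ> p) \<in> G" using p tcd comp_in by blast
        moreover have "\<epsilon> ((tr c d \<circ> t) \<circ> (t \<circ> p)) = 1"
          using p tcd hom[OF perms(2) permutes_compose[OF swap.hyps(4) perms(3)]] by simp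
        ultimately show ?thesis by metis
      qed
    qed
    have "t \<notin> G"
    proof
      assume tG: "t \<in> G"
      have "p \<in> G" if "p permutes R" for p using key[OF that] comp_in[OF tG] tt by metis
      then show False using not_full permutes by auto
    qed
    moreover have "t = (t \<circ> g) \<circ> inv g" using inv_simps[OF g] by (simp add: fun_eq_iff)
    then have "t \<circ> g \<in> G \<Longrightarrow> t \<in> G" using comp_in inv_in[OF g] by metis
    ultimately show ?thesis using key[OF permutes[OF g]] by blast
  qed
qed

end

section \<open>Newton polygons\<close>

text \<open>Indexed by a family and not by its set of values, since the monomials to which it is
  applied are indexed by group elements and may coincide.\<close>

definition esym :: "nat \<Rightarrow> ('i \<Rightarrow> 'a::comm_ring_1) \<Rightarrow> 'i set \<Rightarrow> 'a" where
  "esym n f I = (\<Sum>X | X \<subseteq> I \<and> card X = n. \<Prod>i\<in>X. f i)"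

lemma prod_diff_esym:
  fixes x :: "'a::comm_ring_1"
  assumes "finite I"
  shows "(\<Prod>i\<in>I. x - f i) = (\<Sum>n\<le>card I. (-1) ^ n * esym n f I * x ^ (card I - n))"
proof -
  have "(\<Prod>i\<in>I. x - f i) = (\<Sum>X\<in>Pow I. (-1) ^ card X * (\<Prod>i\<in>X. f i) * x ^ (card I - card X))"
    unfolding prod_diff_conv_sum[OF assms]
    by (rule sum.cong) (use assms in \<open>auto simp: card_Diff_subset finite_subset\<close>)
  also have "\<dots> = (\<Sum>n\<le>card I. \<Sum>X | X \<in> Pow I \<and> card X = n. (-1) ^ card X * (\<Prod>i\<in>X. f i) * x ^ (card I - card X))"
    by (rule sum.group[symmetric]) (use assms in \<open>auto intro: card_mono\<close>)
  also have "\<dots> = (\<Sum>n\<le>card I. (-1) ^ n * esym n f I * x ^ (card I - n))"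
    by (rule sum.cong) (auto simp: esym_def sum_distrib_left sum_distrib_right)
  finally show ?thesis .
qed

lemma coeff_prod_roots:
  fixes f :: "'i \<Rightarrow> 'a::comm_ring_1"
  assumes "finite I" "n \<le> card I"
  shows "coeff (\<Prod>i\<in>I. [:- f i, 1:]) (card I - n) = (-1) ^ n * esym n f I"
proof -
  have pc: "(\<Prod>i\<in>X. [:f i:]) = [:\<Prod>i\<in>X. f i:]" for X
    by (induction X rule: infinite_finite_induct) (auto simp: one_pCons)
  have sc: "(\<Sum>X\<in>B. [:h X:]) = [:\<Sum>X\<in>B. h X:]" for B and h :: "'i set \<Rightarrow> 'a"
    by (induction B rule: infinite_finite_induct) auto
  have e: "esym m (\<lambda>i. [:f i:]) I = [:esym m f I:]" for m
    by (simp add: esym_def pc sc)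
  have m1: "(-1) ^ m * [:c:] = [:(-1) ^ m * c:]" for m and c :: 'a
    by (induction m arbitrary: c) auto
  \<comment> \<open>The identity \<open>prod_diff_esym\<close> is used inside the polynomial ring,
    for the variable and constant polynomials.\<close>
  have "(\<Prod>i\<in>I. [:- f i, 1:]) = (\<Prod>i\<in>I. [:0, 1:] - [:f i:])" by simp
  also have "\<dots> = (\<Sum>m\<le>card I. monom ((-1) ^ m * esym m f I) (card I - m))"
    unfolding prod_diff_esym[OF assms(1)] e m1
    by (rule sum.cong) (auto simp: monom_altdef)
  finally have "coeff (\<Prod>i\<in>I. [:- f i, 1:]) (card I - n) =
    (\<Sum>m\<le>card I. if card I - m = card I - n then (-1) ^ m * esym m f I else 0)"
    by (simp add: coeff_sum)
  also have "\<dots> = (\<Sum>m\<le>card I. if m = n then (-1) ^ m * esym m f I else 0)"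
    using assms(2) by (intro sum.cong) auto
  finally show ?thesis using assms(2) by simp
qed

section \<open>Valuations on a subfield and the first edges of a Newton polygon\<close>

locale padic_field =
  fixes K :: "complex set" and v :: "complex \<Rightarrow> real" and p :: nat
  assumes K: "is_subfield K" and prime: "prime p"
    and v_mult: "\<And>x y. x \<in> K \<Longrightarrow> y \<in> K \<Longrightarrow> x \<noteq> 0 \<Longrightarrow> y \<noteq> 0 \<Longrightarrow> v (x * y) = v x + v y"
    and v_add: "\<And>x y. x \<in> K \<Longrightarrow> y \<in> K \<Longrightarrow> x \<noteq> 0 \<Longrightarrow> y \<noteq> 0 \<Longrightarrow> x + y \<noteq> 0 \<Longrightarrow> v (x + y) \<ge> min (v x) (v y)"
    and v_p: "v (of_nat p) = 1" and v_of_int: "\<And>n. \<not> int p dvd n \<Longrightarrow> v (of_int n) = 0"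
begin

lemmas closed = is_subfieldD[OF K] subfield_sum[OF K] subfield_prod[OF K] subfield_of_rat[OF K]

lemma closed_of_int: "of_int n \<in> K" using subfield_of_rat[OF K, of "of_int n"] by simp

lemma closed_of_nat: "of_nat n \<in> K" using subfield_of_rat[OF K, of "of_nat n"] by simp

lemma v_1: "v 1 = 0" using v_mult[of 1 1] closed by simp

lemma v_m1: "v (- 1) = 0" using v_mult[of "- 1" "- 1"] closed v_1 by simp

lemma v_uminus: "x \<in> K \<Longrightarrow> v (- x) = v x"
proof (cases "x = 0")
  case False
  assume "x \<in> K" then show ?thesis using v_mult[of "- 1" x] v_m1 closed False by simp
qed simp

lemma v_power: "x \<in> K \<Longrightarrow> x \<noteq> 0 \<Longrightarrow> v (x ^ n) = of_nat n * v x"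
  by (induction n) (auto simp: v_1 v_mult closed(9) algebra_simps)

lemma v_inverse: "x \<in> K \<Longrightarrow> x \<noteq> 0 \<Longrightarrow> v (inverse x) = - v x"
  using v_mult[of x "inverse x"] v_1 closed(6)[of x] by simp

lemma v_prod: "(\<And>i. i \<in> A \<Longrightarrow> f i \<in> K \<and> f i \<noteq> 0) \<Longrightarrow> v (prod f A) = (\<Sum>i\<in>A. v (f i))"
  by (induction A rule: infinite_finite_induct) (auto simp: v_1 v_mult subfield_prod[OF K])

lemma v_int: assumes "n \<noteq> 0" shows "v (of_int n) = multiplicity (int p) n"
proof -
  define c where "c = multiplicity (int p) n"
  from prime have np: "\<not> is_unit (int p)" by auto
  obtain m where m: "n = int p ^ c * m" "\<not> int p dvd m"
    using multiplicity_decompose'[OF assms np] unfolding c_def by metis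
  have m0: "m \<noteq> 0" using m assms by auto
  have "v (of_int n) = v (of_nat p ^ c * of_int m)" by (simp add: m(1))
  also have "\<dots> = v (of_nat p ^ c) + v (of_int m)"
    using prime m0 by (intro v_mult closed(9) closed_of_int closed_of_nat) auto
  also have "\<dots> = c" using prime by (simp add: v_power closed_of_nat v_p v_of_int[OF m(2)])
  finally show ?thesis by (simp add: c_def)
qed

lemma v_nat_not_dvd: "\<not> p dvd n \<Longrightarrow> v (of_nat n) = 0"
  using v_of_int[of "int n"] by simp

lemma v_nat_nonneg: "n > 0 \<Longrightarrow> v (of_nat n) \<ge> 0"
  using v_int[of "int n"] by simp

lemma v_p_mult: "n > 0 \<Longrightarrow> v (of_nat (p * n)) = 1 + v (of_nat n)"
  using v_mult[of "of_nat p" "of_nat n"] closed_of_nat prime v_p by (simp add: prime_gt_0_nat)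

lemma v_nat_dvd: assumes "p dvd n" "n > 0" shows "v (of_nat n) \<ge> 1"
proof -
  obtain m where m: "n = p * m" using assms(1) by (auto elim: dvdE)
  then show ?thesis using v_p_mult[of m] v_nat_nonneg[of m] assms(2) by simp
qed

lemma v_nat_exact: assumes "p dvd n" "\<not> p\<^sup>2 dvd n" shows "v (of_nat n) = 1"
proof -
  obtain m where m: "n = p * m" using assms(1) by (auto elim: dvdE)
  then have "\<not> p dvd m" using assms(2) by (auto simp: power2_eq_square)
  moreover from this have "m > 0" by (cases m) auto
  ultimately show ?thesis unfolding m using v_p_mult[of m] v_nat_not_dvd[of m] by simp
qed

text \<open>The integrality arguments all end here: single roots have fractional valuations, but a
  rational expression in them cannot.\<close>

lemma v_rat: assumes "x \<in> \<rat>" "x \<noteq> 0" shows "v x \<in> \<int>"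
proof -
  obtain r where r: "x = of_rat r" using assms(1) by (auto elim: Rats_cases)
  obtain a b where ab: "r = Fract a b" "b > 0" by (cases r) auto
  have x: "x = of_int a * inverse (of_int b)" using ab r by (simp add: of_rat_rat divide_inverse)
  then have a0: "a \<noteq> 0" using assms(2) by auto
  have "v x = v (of_int a) + v (inverse (of_int b))"
    unfolding x using a0 ab by (intro v_mult closed(6) closed_of_int) auto
  also have "\<dots> = v (of_int a) - v (of_int b)" using ab by (simp add: v_inverse closed_of_int)
  finally show ?thesis using a0 ab by (simp add: v_int)
qed

text \<open>\<open>v 0\<close> is unspecified, so 0 is treated as having infinite valuation.\<close>

definition ge :: "real \<Rightarrow> complex \<Rightarrow> bool" where "ge t x \<longleftrightarrow> x = 0 \<or> v x \<ge> t"

definition gt :: "real \<Rightarrow> complex \<Rightarrow> bool" where "gt t x \<longleftrightarrow> x = 0 \<or> v x > t"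

lemma gt_add: "x \<in> K \<Longrightarrow> y \<in> K \<Longrightarrow> gt t x \<Longrightarrow> gt t y \<Longrightarrow> gt t (x + y)"
  using v_add[of x y] by (cases "x = 0 \<or> y = 0 \<or> x + y = 0") (auto simp: gt_def)

lemma gt_sum: "(\<And>i. i \<in> A \<Longrightarrow> f i \<in> K \<and> gt t (f i)) \<Longrightarrow> gt t (sum f A)"
proof (induction A rule: infinite_finite_induct)
  case (insert i A) then show ?case using gt_add[of "f i" "sum f A" t] closed(10)[of A f] by simp
qed (auto simp: gt_def)

lemma gt_mult_ge: "x \<in> K \<Longrightarrow> y \<in> K \<Longrightarrow> gt s x \<Longrightarrow> ge t y \<Longrightarrow> gt (s + t) (x * y)"
  using v_mult[of x y] by (cases "x = 0 \<or> y = 0") (auto simp: gt_def ge_def)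

lemma dominant:
  assumes "x \<in> K" "y \<in> K" "x \<noteq> 0" "gt (v x) y"
  shows "x + y \<noteq> 0" "v (x + y) = v x"
proof -
  show ne: "x + y \<noteq> 0"
  proof
    assume "x + y = 0"
    then have "y = - x" by (simp add: eq_neg_iff_add_eq_0 add.commute)
    then show False using assms v_uminus[of x] by (auto simp: gt_def)
  qed
  show "v (x + y) = v x"
  proof (cases "y = 0")
    case False
    then have yx: "v y > v x" using assms by (simp add: gt_def)
    have "v (x + y) \<ge> v x" using v_add[of x y] ne assms False yx by simp
    moreover have "v ((x + y) + - y) \<ge> min (v (x + y)) (v (- y))"
      using assms ne False closed(3,5) by (intro v_add) auto
    then have "v x \<ge> min (v (x + y)) (v y)" using v_uminus assms by simp
    ultimately show ?thesis using yx by linarith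
  qed simp
qed

lemma dominant_sum:
  assumes A: "finite A" "i \<in> A" and f: "\<And>j. j \<in> A \<Longrightarrow> f j \<in> K" "f i \<noteq> 0"
    and d: "\<And>j. j \<in> A \<Longrightarrow> j \<noteq> i \<Longrightarrow> gt (v (f i)) (f j)"
  shows "sum f A \<noteq> 0" "v (sum f A) = v (f i)"
proof -
  have "sum f A = f i + sum f (A - {i})" using A by (rule sum.remove)
  moreover have "sum f (A - {i}) \<in> K" using f by (intro closed(10)) auto
  moreover have "gt (v (f i)) (sum f (A - {i}))" using f d by (intro gt_sum) auto
  ultimately show "sum f A \<noteq> 0" "v (sum f A) = v (f i)" using dominant f A by metis+
qed

text \<open>Exchanging members of \<open>S\<close> for other indices raises the valuation strictly,
  so the product over \<open>S\<close> is the unique smallest term.\<close>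

lemma esym_dominant:
  assumes I: "finite I" "S \<subseteq> I" and f: "\<And>i. i \<in> I \<Longrightarrow> f i \<in> K \<and> f i \<noteq> 0"
    and less: "\<And>i j. i \<in> S \<Longrightarrow> j \<in> I - S \<Longrightarrow> v (f i) < v (f j)"
  shows "esym (card S) f I \<noteq> 0" "v (esym (card S) f I) = (\<Sum>i\<in>S. v (f i))"
proof -
  define B where "B = {X. X \<subseteq> I \<and> card X = card S}"
  have finS: "finite S" using I finite_subset by blast
  have SB: "S \<in> B" and finB: "finite B" using I by (auto simp: B_def)
  have vX: "v (prod f X) = (\<Sum>i\<in>X. v (f i))" if "X \<in> B" for X
    using that f by (intro v_prod) (auto simp: B_def)
  have d: "gt (v (prod f S)) (prod f X)" if X: "X \<in> B" "X \<noteq> S" for X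
  proof -
    have finX: "finite X" using X I finite_subset by (auto simp: B_def)
    have "card X = card S" using X by (simp add: B_def)
    then have c: "card (S - X) = card (X - S)" using finX finS
      by (simp add: card_Diff_subset_Int Int_commute)
    then obtain h where h: "bij_betw h (S - X) (X - S)" 
      using finite_same_card_bij[of "S - X" "X - S"] c finX finS by auto
    have ne: "S - X \<noteq> {}"
    proof
      assume "S - X = {}"
      then have "S \<subseteq> X" by blast
      then have "S = X" using X finX by (intro card_subset_eq) (auto simp: B_def)
      then show False using X by simp
    qed
    have "(\<Sum>i\<in>S - X. v (f i)) < (\<Sum>i\<in>S - X. v (f (h i)))"
    proof (rule sum_strict_mono)
      fix i assume i: "i \<in> S - X"
      then have "h i \<in> X - S" using h by (auto dest: bij_betwE)
      then show "v (f i) < v (f (h i))" using i X by (intro less) (auto simp: B_def)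
    qed (use finS ne in auto)
    also have "\<dots> = (\<Sum>i\<in>X - S. v (f i))" using sum.reindex_bij_betw[OF h, of "\<lambda>i. v (f i)"] by simp
    finally have lt: "(\<Sum>i\<in>S - X. v (f i)) < (\<Sum>i\<in>X - S. v (f i))" .
    have "(\<Sum>i\<in>S. v (f i)) = (\<Sum>i\<in>S \<inter> X. v (f i)) + (\<Sum>i\<in>S - X. v (f i))"
      using finS by (rule sum.Int_Diff)
    moreover have "(\<Sum>i\<in>X. v (f i)) = (\<Sum>i\<in>X \<inter> S. v (f i)) + (\<Sum>i\<in>X - S. v (f i))"
      using finX by (rule sum.Int_Diff)
    ultimately show ?thesis using lt vX[OF SB] vX[OF X(1)] by (simp add: gt_def Int_commute)
  qed
  have S0: "prod f S \<noteq> 0" using f I finS by (auto simp: subset_iff)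
  have inK: "prod f X \<in> K" if "X \<in> B" for X using that f by (intro closed(11)) (auto simp: B_def)
  have e: "esym (card S) f I = sum (prod f) B" by (simp add: esym_def B_def)
  show "esym (card S) f I \<noteq> 0" "v (esym (card S) f I) = (\<Sum>i\<in>S. v (f i))"
    unfolding e using dominant_sum[OF finB SB, of "prod f"] inK S0 d vX[OF SB] by auto
qed

lemma esym_gt:
  assumes f: "\<And>i. i \<in> I \<Longrightarrow> f i \<in> K" and gt: "\<And>X. X \<subseteq> I \<Longrightarrow> card X = n \<Longrightarrow> gt t (prod f X)"
  shows "gt t (esym n f I)"
  unfolding esym_def using f gt by (intro gt_sum) (auto intro!: closed(11))

text \<open>Two edges are recovered without factoring over a completion. A root of forbidden
  valuation would make one term of its equation dominant. The number of roots on an edge is read off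
  an elementary symmetric function in which they form the dominant product. The bound
  \<open>card R < r + 2 * d\<close> rules out a second group of \<open>d\<close> roots of valuation
  1/d.\<close>

lemma newton_polygon:
  fixes R :: "complex set" and r d :: nat
  defines "c \<equiv> \<lambda>i. esym i id R"
  assumes R: "finite R" "R \<subseteq> K" "0 \<notin> R" and d: "d > 0" "r + d \<le> card R" "card R < r + 2 * d"
    and c0: "\<And>i. i \<le> r \<Longrightarrow> c i \<noteq> 0 \<and> v (c i) = 0"
    and c1: "\<And>i. r < i \<Longrightarrow> i \<le> card R \<Longrightarrow> ge 1 (c i)"
    and cd: "c (r + d) \<noteq> 0" "v (c (r + d)) = 1"
    and c2: "\<And>i. r + d < i \<Longrightarrow> i \<le> card R \<Longrightarrow> ge 2 (c i)"
  shows "card {x \<in> R. v x = 0} = r" "card {x \<in> R. v x = 1 / d} = d"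
    "\<And>x. x \<in> R \<Longrightarrow> v x = 0 \<or> v x \<ge> 1 / d"
proof -
  define k where "k = card R"
  have cK: "c i \<in> K" for i unfolding c_def esym_def using R by (intro closed(10) closed(11)) auto
  have root: "(\<Sum>i\<le>k. (-1) ^ i * c i * x ^ (k - i)) = 0" if "x \<in> R" for x
  proof -
    have "(\<Prod>y\<in>R. x - id y) = 0" using that R by (auto intro: prod_zero)
    then show ?thesis using prod_diff_esym[OF R(1), of x id] by (simp add: c_def k_def)
  qed
  have c_nonneg: "ge 0 (c i)" if "i \<le> k" for i
    using c0[of i] c1[of i] that by (cases "i \<le> r") (auto simp: ge_def k_def)
  have termK: "(-1) ^ i * c i * x ^ j \<in> K" if "x \<in> R" for x i j
    using that R cK by (auto intro!: closed(4) closed(5) closed(9) closed(2))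
  have sgn: "v ((-1) ^ i * c i * x ^ j) = v (c i) + j * v x" if "x \<in> R" "c i \<noteq> 0" for x i j
  proof -
    have x: "x \<in> K" "x \<noteq> 0" using that R by auto
    have "(-1) ^ i * c i * x ^ j = c i * x ^ j \<or> (-1) ^ i * c i * x ^ j = - (c i * x ^ j)"
      by (cases "even i") auto
    moreover have "c i * x ^ j \<in> K" using x cK by (intro closed(4) closed(9))
    moreover have "v (c i * x ^ j) = v (c i) + j * v x"
      using v_mult[of "c i" "x ^ j"] that x cK closed(9)[of x j] v_power[OF x] by simp
    ultimately show ?thesis by (elim disjE) (simp_all only: v_uminus)
  qed
  have term_gt: "gt t ((-1) ^ i * c i * x ^ j)" if "x \<in> R" "ge s (c i)" "t < s + j * v x" for x i j s t
    using sgn[OF that(1), of i j] that R by (cases "c i = 0") (auto simp: gt_def ge_def)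
  have no_dom: False if x: "x \<in> R" and i: "i \<le> k" "c i \<noteq> 0"
    and oth: "\<And>j. j \<le> k \<Longrightarrow> j \<noteq> i \<Longrightarrow> gt (v (c i) + (k - i) * v x) ((-1) ^ j * c j * x ^ (k - j))" for x i
    using dominant_sum(1)[of "{..k}" i "\<lambda>i. (-1) ^ i * c i * x ^ (k - i)"] root[OF x] termK[OF x]
      oth i x R by (auto simp: sgn[OF x i(2)])
  have nonneg: "v x \<ge> 0" if x: "x \<in> R" for x
  proof (rule ccontr)
    assume neg: "\<not> v x \<ge> 0"
    show False
    proof (rule no_dom[OF x, of 0])
      show "c 0 \<noteq> 0" using c0[of 0] by simp
      fix j assume j: "j \<le> k" "j \<noteq> 0"
      have "real k * v x < real (k - j) * v x" using neg j by (intro mult_strict_right_mono_neg) auto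
      then show "gt (v (c 0) + (k - 0) * v x) ((-1) ^ j * c j * x ^ (k - j))"
        using j c0[of 0] by (intro term_gt[OF x c_nonneg[OF j(1)]]) auto
    qed simp
  qed
  have rk: "r \<le> k" using d by (simp add: k_def)
  \<comment> \<open>For a valuation strictly between 0 and 1/d the term of index r, the vertex where
    the two edges meet, would dominate.\<close>
  have gap: "v x \<ge> 1 / d" if x: "x \<in> R" "v x \<noteq> 0" for x
  proof (rule ccontr)
    assume neg: "\<not> v x \<ge> 1 / d"
    have pos: "v x > 0" using nonneg[OF x(1)] x by simp
    have dv: "d * v x < 1" using neg d by (simp add: field_simps)
    show False
    proof (rule no_dom[OF x(1) rk])
      show "c r \<noteq> 0" using c0[of r] by simp
      fix j assume j: "j \<le> k" "j \<noteq> r"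
      have vr: "v (c r) = 0" using c0[of r] by simp
      consider "j < r" | "r < j" "j \<le> r + d" | "r + d < j" using j by linarith
      then show "gt (v (c r) + (k - r) * v x) ((-1) ^ j * c j * x ^ (k - j))"
      proof cases
        case 1
        then have "real (k - r) * v x < real (k - j) * v x" using pos rk by (intro mult_strict_right_mono) auto
        then show ?thesis using vr by (intro term_gt[OF x(1) c_nonneg[OF j(1)]]) auto
      next
        case 2
        have "real (k - r) * v x - real (k - j) * v x = real (j - r) * v x"
          using 2 j rk by (simp add: of_nat_diff algebra_simps)
        also have "\<dots> \<le> real d * v x" using 2 pos by (intro mult_right_mono) auto
        finally show ?thesis using vr dv 2 j
          by (intro term_gt[OF x(1) c1[of j]]) (auto simp: k_def)
      next
        case 3
        have "real (k - r) * v x \<le> real (2 * d) * v x" using d pos by (intro mult_right_mono) (auto simp: k_def)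
        moreover have "0 \<le> real (k - j) * v x" using pos by simp
        ultimately show ?thesis using vr dv 3 j
          by (intro term_gt[OF x(1) c2[of j]]) (auto simp: k_def)
      qed
    qed
  qed
  then show "\<And>x. x \<in> R \<Longrightarrow> v x = 0 \<or> v x \<ge> 1 / d" by blast
  define Z where "Z = {x \<in> R. v x = 0}"
  have ZR: "Z \<subseteq> R" "finite Z" using R by (auto simp: Z_def)
  have RK: "\<And>i. i \<in> R \<Longrightarrow> id i \<in> K \<and> id i \<noteq> 0" using R by auto
  have vZ: "v (c (card Z)) = 0 \<and> c (card Z) \<noteq> 0"
  proof -
    have "v (esym (card Z) id R) = (\<Sum>i\<in>Z. v (id i)) \<and> esym (card Z) id R \<noteq> 0"
      using esym_dominant[OF R(1) ZR(1), of id] RK nonneg by (force simp: Z_def)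
    then show ?thesis by (simp add: c_def Z_def)
  qed
  have Zk: "card Z \<le> k" using ZR R by (simp add: card_mono k_def)
  have prodv: "v (prod id X) = (\<Sum>x\<in>X. v x)" if "X \<subseteq> R" for X
    using v_prod[of X id] that RK by auto
  have Zr: "card Z \<ge> r"
  proof (rule ccontr)
    assume "\<not> card Z \<ge> r"
    then have "Suc (card Z) \<le> r" by simp
    have "gt 0 (c (Suc (card Z)))"
      unfolding c_def
    proof (rule esym_gt)
      fix X assume X: "X \<subseteq> R" "card X = Suc (card Z)"
      have finX: "finite X" using X R finite_subset by blast
      have "\<not> X \<subseteq> Z" using X card_mono[OF ZR(2), of X] by auto
      then obtain x where x: "x \<in> X" "x \<in> R" "v x \<noteq> 0" using X by (auto simp: Z_def)
      then have "0 < v x" using nonneg[of x] by simp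
      also have "\<dots> \<le> (\<Sum>x\<in>X. v x)" using x X finX nonneg by (intro member_le_sum) auto
      finally show "gt 0 (prod id X)" using prodv[OF X(1)] by (simp add: gt_def)
    qed (use R in auto)
    then show False using c0[OF \<open>Suc (card Z) \<le> r\<close>] by (simp add: gt_def)
  qed
  moreover have "card Z \<le> r"
  proof (rule ccontr)
    assume "\<not> card Z \<le> r"
    then have "ge 1 (c (card Z))" using c1[of "card Z"] Zk by (simp add: k_def)
    then show False using vZ by (simp add: ge_def)
  qed
  ultimately have cZ: "card Z = r" by simp
  then show "card {x \<in> R. v x = 0} = r" by (simp add: Z_def)
  define G where "G = {x \<in> R. v x = 1 / d}"
  have GR: "G \<subseteq> R" "finite G" using R by (auto simp: G_def)
  have ZG: "Z \<inter> G = {}" using d by (auto simp: Z_def G_def)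
  have cZG: "card (Z \<union> G) = r + card G" using ZR GR ZG cZ by (simp add: card_Un_disjoint)
  \<comment> \<open>\<open>Z\<close> and \<open>G\<close> collect the roots of smallest valuation,
    so this coefficient has valuation \<open>card G / d\<close>; the coefficient bounds then leave
    \<open>d\<close> as the only size of \<open>G\<close>.\<close>
  have "v (esym (card (Z \<union> G)) id R) = (\<Sum>i\<in>Z \<union> G. v (id i)) \<and> esym (card (Z \<union> G)) id R \<noteq> 0"
  proof -
    have "v i < v j" if "i \<in> Z \<union> G" "j \<in> R - (Z \<union> G)" for i j
    proof -
      have "v j \<ge> 1 / d" "v j \<noteq> 1 / d" using gap[of j] that by (auto simp: Z_def G_def)
      moreover have "v i \<le> 1 / d" using that d by (auto simp: Z_def G_def)
      ultimately show ?thesis by linarith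
    qed
    then show ?thesis using esym_dominant[OF R(1), of "Z \<union> G" id] ZR GR RK by auto
  qed
  moreover have "(\<Sum>i\<in>Z \<union> G. v (id i)) = card G / d"
  proof -
    have "(\<Sum>i\<in>Z \<union> G. v (id i)) = (\<Sum>i\<in>Z. v i) + (\<Sum>i\<in>G. v i)"
      using ZR GR ZG by (simp add: sum.union_disjoint)
    also have "(\<Sum>i\<in>Z. v i) = 0" by (simp add: Z_def)
    also have "(\<Sum>i\<in>G. v i) = (\<Sum>i\<in>G. 1 / d)" by (rule sum.cong) (auto simp: G_def)
    finally show ?thesis by simp
  qed
  ultimately have vG: "v (c (r + card G)) = card G / d" "c (r + card G) \<noteq> 0" using cZG by (auto simp: c_def)
  have Gk: "r + card G \<le> k" using card_mono[OF R(1), of "Z \<union> G"] ZR GR cZG by (simp add: k_def)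
  \<comment> \<open>Otherwise any product of r + d roots would contain at least d roots of valuation
    above 1/d, against \<open>cd\<close>.\<close>
  have "card G \<noteq> 0"
  proof
    assume G0: "card G = 0"
    have big: "v x > 1 / d" if "x \<in> R" "x \<notin> Z" for x
      using gap[of x] that G0 GR(2) by (force simp: G_def Z_def)
    have "gt 1 (c (r + d))"
      unfolding c_def
    proof (rule esym_gt)
      fix X assume X: "X \<subseteq> R" "card X = r + d"
      have finX: "finite X" using X R finite_subset by blast
      have "card (X - Z) \<ge> d" using diff_card_le_card_Diff[OF ZR(2), of X] X cZ by simp
      then have cXZ: "real (card (X - Z)) \<ge> d" by simp
      have ne: "X - Z \<noteq> {}" using \<open>card (X - Z) \<ge> d\<close> d by force
      have "1 \<le> real (card (X - Z)) * (1 / d)" using cXZ d by (simp add: field_simps)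
      also have "\<dots> = (\<Sum>x\<in>X - Z. 1 / d)" by simp
      also have "\<dots> < (\<Sum>x\<in>X - Z. v x)" using big X finX ne by (intro sum_strict_mono) auto
      also have "\<dots> \<le> (\<Sum>x\<in>X. v x)" using finX nonneg X by (intro sum_mono2) auto
      finally show "gt 1 (prod id X)" using prodv[OF X(1)] by (simp add: gt_def)
    qed (use R in auto)
    then show False using cd by (simp add: gt_def)
  qed
  moreover have "card G < 2 * d" using Gk d by (simp add: k_def)
  moreover have "card G \<ge> d"
  proof -
    have "ge 1 (c (r + card G))" using c1[of "r + card G"] Gk \<open>card G \<noteq> 0\<close> by (simp add: k_def)
    then show ?thesis using vG d by (simp add: ge_def field_simps)
  qed
  moreover have "card G \<le> d"
  proof (rule ccontr)
    assume "\<not> card G \<le> d"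
    then have "ge 2 (c (r + card G))" using c2[of "r + card G"] Gk by (simp add: k_def)
    then have "2 * d \<le> card G" using vG d by (simp add: ge_def field_simps flip: of_nat_mult)
    then show False using \<open>card G < 2 * d\<close> by simp
  qed
  ultimately have "card G = d" by simp
  then show "card {x \<in> R. v x = 1 / d} = d" by (simp add: G_def)
qed

end

section \<open>Valuations and Galois groups\<close>

context galois
begin

abbreviation "Gal \<equiv> galois_group g"

lemma perm_group_Gal: "perm_group R Gal"
  by standard (auto intro: galois_group_permutes galois_group_closed)

interpretation PG: perm_group R Gal by (rule perm_group_Gal)

text \<open>An automorphism acts on the monomials by left multiplication on the index group.
  Indexing by the group makes the number of monomials of least valuation the order of a subgroup in
  the next lemma.\<close>

lemma esym_orbit_rational:
  fixes e :: "complex \<Rightarrow> nat"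
  defines "\<beta> \<equiv> \<lambda>p :: complex \<Rightarrow> complex. \<Prod>x\<in>R. p x ^ e x"
  shows "esym n \<beta> Gal \<in> \<rat>"
proof (rule fixed_rational)
  have \<beta>L: "\<beta> p \<in> L" if "p \<in> Gal" for p
    unfolding \<beta>_def using PG.in_R_iff[OF that] R_subset_L
    by (intro subfield_prod[OF is_subfield_L] L_closed(9)) auto
  have sub: "\<Prod> (\<beta> ` X) \<in> L \<and> prod \<beta> X \<in> L" if "X \<subseteq> Gal" for X
    using that \<beta>L by (auto intro!: subfield_prod[OF is_subfield_L])
  show "esym n \<beta> Gal \<in> L" unfolding esym_def using sub by (intro subfield_sum[OF is_subfield_L]) auto
  fix \<tau> assume t: "\<tau> \<in> field_auts L"
  obtain h where h: "h \<in> Gal" "\<forall>z\<in>R. h z = \<tau> z" using field_auts_restrict[OF t] by blast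
  have hX: "(\<lambda>p. h \<circ> p) ` X \<subseteq> Gal" if "X \<subseteq> Gal" for X using that h PG.comp_in by blast
  have inj: "inj_on (\<lambda>p. h \<circ> p) X" for X :: "(complex \<Rightarrow> complex) set"
  proof (rule inj_onI)
    fix a b :: "complex \<Rightarrow> complex" assume eq: "h \<circ> a = h \<circ> b"
    show "a = b"
    proof
      fix x show "a x = b x" using fun_cong[OF eq, of x] PG.injG[OF h(1)] by (auto dest: injD)
    qed
  qed
  have \<tau>\<beta>: "\<tau> (\<beta> p) = \<beta> (h \<circ> p)" if p: "p \<in> Gal" for p
  proof -
    have "\<tau> (\<beta> p) = (\<Prod>x\<in>R. \<tau> (p x ^ e x))"
      unfolding \<beta>_def using PG.in_R_iff[OF p] R_subset_L
      by (intro field_auts_prod[OF t] L_closed(9)) auto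
    also have "\<dots> = \<beta> (h \<circ> p)" unfolding \<beta>_def
      by (rule prod.cong) (use h PG.in_R_iff[OF p] subsetD[OF R_subset_L] field_auts_hom(10)[OF t] in auto)
    finally show ?thesis .
  qed
  define B where "B = {X. X \<subseteq> Gal \<and> card X = n}"
  have "\<tau> (esym n \<beta> Gal) = (\<Sum>X\<in>B. \<tau> (prod \<beta> X))"
    unfolding esym_def B_def using sub by (intro field_auts_sum[OF t]) auto
  also have "\<dots> = (\<Sum>X\<in>B. prod \<beta> ((\<lambda>p. h \<circ> p) ` X))"
  proof (rule sum.cong)
    fix X assume X: "X \<in> B"
    have "\<tau> (prod \<beta> X) = (\<Prod>p\<in>X. \<tau> (\<beta> p))" using X \<beta>L by (intro field_auts_prod[OF t]) (auto simp: B_def)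
    also have "\<dots> = (\<Prod>p\<in>X. \<beta> (h \<circ> p))" by (rule prod.cong) (use X \<tau>\<beta> in \<open>auto simp: B_def\<close>)
    also have "\<dots> = prod \<beta> ((\<lambda>p. h \<circ> p) ` X)" using inj by (simp add: prod.reindex)
    finally show "\<tau> (prod \<beta> X) = prod \<beta> ((\<lambda>p. h \<circ> p) ` X)" .
  qed simp
  also have "\<dots> = (\<Sum>X\<in>B. prod \<beta> X)"
  proof -
    have iB: "inj_on (image (\<lambda>p. h \<circ> p)) B"
      by (rule inj_onI) (use inj[of UNIV] in \<open>simp add: inj_image_eq_iff\<close>)
    moreover have "image (\<lambda>p. h \<circ> p) ` B \<subseteq> B"
    proof
      fix Y assume "Y \<in> image (\<lambda>p. h \<circ> p) ` B"
      then obtain X where X: "X \<in> B" "Y = (\<lambda>p. h \<circ> p) ` X" by blast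
      then show "Y \<in> B" using hX[of X] card_image[OF inj[of X]] by (simp add: B_def)
    qed
    moreover have "finite B" using PG.finite_G by (simp add: B_def)
    ultimately have "image (\<lambda>p. h \<circ> p) ` B = B" by (intro endo_inj_surj)
    then have "(\<Sum>X\<in>B. prod \<beta> X) = (\<Sum>X\<in>image (\<lambda>p. h \<circ> p) ` B. prod \<beta> X)" by (simp only:)
    also have "\<dots> = (\<Sum>X\<in>B. prod \<beta> ((\<lambda>p. h \<circ> p) ` X))" by (subst sum.reindex[OF iB], rule sum.cong, rule refl, rule o_apply)
    finally show ?thesis by (rule sym)
  qed
  finally show "\<tau> (esym n \<beta> Gal) = esym n \<beta> Gal" by (simp add: esym_def B_def)
qed

text \<open>A substitute for ramification at slope 1/d. The monomial is designed so that its
  conjugates of least valuation, namely (d + 1)/d, are exactly those under the subgroup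
  \<open>N\<close> preserving \<open>B\<close> and \<open>C\<close>. The elementary symmetric
  function of degree |N| is rational with valuation |N| (d + 1)/d, so d divides |N|, and Cauchy's
  theorem applies to \<open>N\<close>.\<close>

lemma ex_element_of_prime_order:
  assumes pf: "padic_field L v p" and R0: "0 \<notin> R" and d: "prime d"
    and cd: "card {x \<in> R. v x = 1 / d} = d"
    and gap: "\<And>x. x \<in> R \<Longrightarrow> v x = 0 \<or> v x \<ge> 1 / d"
  shows "\<exists>\<sigma>\<in>Gal. \<sigma> \<noteq> id \<and> \<sigma> ^^ d = id"
proof -
  interpret padic_field L v p by (rule pf)
  have d0: "d > 0" using d by (simp add: prime_gt_0_nat)
  define Z where "Z = {x \<in> R. v x = 0}"
  define C where "C = {x \<in> R. v x = 1 / d}"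
  define B where "B = R - Z"
  have cC: "card C = d" using cd by (simp add: C_def)
  have CB: "C \<subseteq> B" using d0 by (auto simp: C_def B_def Z_def)
  have finB: "finite B" by (simp add: B_def)
  obtain y where y: "y \<in> C" using cC d0 by (metis card.empty ex_in_conv less_irrefl)
  \<comment> \<open>Weight 3 on \<open>Z\<close> exceeds all weights on \<open>B\<close>, so moving
    a root of \<open>Z\<close> into \<open>B\<close> is costly. Weight 0 beyond \<open>C\<close>
    ignores unknown valuations there. The single 2 makes the total over \<open>B\<close> equal to d
    + 1, which is prime to d; equal weights would give d and no information.\<close>
  define e :: "complex \<Rightarrow> nat" where "e x = (if x \<in> Z then 3 else if x = y then 2 else if x \<in> C then 1 else 0)" for x
  define \<beta> where "\<beta> = (\<lambda>p :: complex \<Rightarrow> complex. \<Prod>x\<in>R. p x ^ e x)"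
  have px: "p x \<in> L" "p x \<noteq> 0" if "p \<in> Gal" "x \<in> R" for p x
    using PG.in_R_iff[OF that(1), of x] that(2) R_subset_L R0 by auto
  have v\<beta>: "v (\<beta> p) = (\<Sum>x\<in>R. e x * v (p x))" and \<beta>L: "\<beta> p \<in> L \<and> \<beta> p \<noteq> 0" if "p \<in> Gal" for p
  proof -
    have "v (\<beta> p) = (\<Sum>x\<in>R. v (p x ^ e x))" unfolding \<beta>_def using px[OF that] closed(9) by (intro v_prod) auto
    also have "\<dots> = (\<Sum>x\<in>R. e x * v (p x))" using px[OF that] by (intro sum.cong) (auto simp: v_power)
    finally show "v (\<beta> p) = (\<Sum>x\<in>R. e x * v (p x))" .
    show "\<beta> p \<in> L \<and> \<beta> p \<noteq> 0" unfolding \<beta>_def using px[OF that] closed(9) by (auto intro!: closed(11))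
  qed
  have sumB: "(\<Sum>x\<in>B. e x) = d + 1"
  proof -
    have "(\<Sum>x\<in>B. e x) = (\<Sum>x\<in>C. e x)"
      by (rule sum.mono_neutral_right) (use CB finB y in \<open>auto simp: e_def B_def\<close>)
    also have "\<dots> = e y + (\<Sum>x\<in>C - {y}. e x)" using y CB finB by (intro sum.remove) (auto intro: finite_subset)
    also have "(\<Sum>x\<in>C - {y}. e x) = (\<Sum>x\<in>C - {y}. 1)"
      using CB by (intro sum.cong) (auto simp: e_def B_def)
    also have "e y = 2" using y CB by (auto simp: e_def B_def)
    finally show ?thesis using cC y d0 by simp
  qed
  define N where "N = {p \<in> Gal. p ` B = B \<and> p ` C = C}"
  have vB: "v x \<ge> 1 / d" if "x \<in> B" for x using gap[of x] that by (auto simp: B_def Z_def)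
  have vnn: "v x \<ge> 0" if "x \<in> R" for x using gap[OF that] d0 by (auto intro: order_trans[rotated])
  have notB: "v x = 0" if "x \<in> R" "x \<notin> B" for x using that by (simp add: B_def Z_def)
  have inj: "inj p" if "p \<in> Gal" for p using PG.injG that by blast
  have val_ge: "v (\<beta> p) \<ge> (\<Sum>x | x \<in> R \<and> p x \<in> B. e x) / d" if p: "p \<in> Gal" for p
  proof -
    have "(\<Sum>x | x \<in> R \<and> p x \<in> B. e x) / d = (\<Sum>x | x \<in> R \<and> p x \<in> B. e x * (1 / d))"
      by (simp add: sum_divide_distrib)
    also have "\<dots> \<le> (\<Sum>x | x \<in> R \<and> p x \<in> B. e x * v (p x))"
      using vB by (intro sum_mono mult_left_mono) auto
    also have "\<dots> \<le> (\<Sum>x\<in>R. e x * v (p x))"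
      using vnn PG.in_R_iff[OF p] by (intro sum_mono2) auto
    finally show ?thesis by (simp add: v\<beta>[OF p])
  qed
  have vN: "v (\<beta> p) = (d + 1) / d" if p: "p \<in> N" for p
  proof -
    have pG: "p \<in> Gal" using p by (simp add: N_def)
    have "(\<Sum>x\<in>R. e x * v (p x)) = (\<Sum>x\<in>B. e x * v (p x))"
    proof (rule sum.mono_neutral_right)
      show "\<forall>i\<in>R - B. real (e i) * v (p i) = 0"
      proof
        fix i assume i: "i \<in> R - B"
        have "p i \<notin> B" using i p inj[OF pG] by (auto simp: N_def) (metis inj_image_mem_iff)
        then show "real (e i) * v (p i) = 0" using notB PG.in_R_iff[OF pG] i by simp
      qed
    qed (auto simp: B_def)
    also have "\<dots> = (\<Sum>x\<in>B. e x * (1 / d))"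
    proof (rule sum.cong)
      fix x assume x: "x \<in> B"
      show "real (e x) * v (p x) = real (e x) * (1 / real d)"
      proof (cases "x \<in> C")
        case True
        then have "p x \<in> C" using p by (auto simp: N_def)
        then show ?thesis by (simp add: C_def)
      next
        case False then show ?thesis using x y by (auto simp: e_def B_def)
      qed
    qed simp
    also have "\<dots> = (\<Sum>x\<in>B. e x) / d" by (simp add: sum_divide_distrib)
    finally show ?thesis using sumB by (simp add: v\<beta>[OF pG])
  qed
  have vG: "v (\<beta> p) > (d + 1) / d" if p: "p \<in> Gal - N" for p
  proof -
    have pG: "p \<in> Gal" using p by simp
    define T where "T = {x \<in> R. p x \<in> B}"
    have finT: "finite T" by (simp add: T_def)
    have pT: "p ` T = B"
    proof
      show "B \<subseteq> p ` T"
      proof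
        fix z assume z: "z \<in> B"
        then have "z = p (inv p z)" "inv p z \<in> R"
          using PG.inv_simps[OF pG] PG.in_R_iff[OF PG.inv_in[OF pG]] by (auto simp: B_def)
        then show "z \<in> p ` T" using z by (auto simp: T_def intro!: image_eqI[of _ _ "inv p z"])
      qed
    qed (auto simp: T_def)
    then have cT: "card T = card B" using inj[OF pG] by (metis card_image inj_on_subset subset_UNIV)
    \<comment> \<open>If p does not preserve \<open>B\<close>, weights 3 replace weights of at most
      2. If it preserves \<open>B\<close> but not \<open>C\<close>, some root of \<open>C\<close>
      goes to one of valuation above 1/d.\<close>
    show ?thesis
    proof (cases "T = B")
      case False
      have c: "card (T - B) = card (B - T)"
        using cT finT finB by (simp add: card_Diff_subset_Int Int_commute)
      have "T - B \<noteq> {}"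
      proof
        assume "T - B = {}"
        then have "T = B" using cT finB by (intro card_subset_eq) auto
        then show False using False by simp
      qed
      then have pos: "card (T - B) > 0" using finT by (simp add: card_gt_0_iff)
      have "sum e T = sum e (T \<inter> B) + sum e (T - B)" by (rule sum.Int_Diff[OF finT])
      moreover have "sum e B = sum e (B \<inter> T) + sum e (B - T)" by (rule sum.Int_Diff[OF finB])
      moreover have "sum e (T - B) = (\<Sum>x\<in>T - B. 3)"
        by (rule sum.cong) (auto simp: e_def B_def T_def)
      moreover have "sum e (B - T) \<le> (\<Sum>x\<in>B - T. 2)"
        by (rule sum_mono) (auto simp: e_def B_def)
      ultimately have "sum e T \<ge> sum e B + 1" using c pos by (simp add: Int_commute)
      then have "real (sum e T) > d + 1" using sumB by (simp only: of_nat_less_iff)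
      then have "real (sum e T) / d > (d + 1) / d" using d0 by (simp add: divide_strict_right_mono)
      then show ?thesis using val_ge[OF pG] by (simp add: T_def)
    next
      case True
      then have pB: "p ` B = B" using pT by simp
      then have "p ` C \<noteq> C" using p by (simp add: N_def)
      moreover have "card (p ` C) = card C" using inj[OF pG] by (simp add: card_image inj_on_subset)
      ultimately have "\<not> p ` C \<subseteq> C" using finite_subset[OF CB finB] by (metis card_subset_eq)
      then obtain w where w: "w \<in> C" "p w \<notin> C" by blast
      have pw: "p w \<in> B" using w CB pB by blast
      then have "v (p w) \<noteq> 1 / d" using w by (auto simp: C_def B_def)
      then have vw: "v (p w) > 1 / d" using vB[OF pw] by simp
      have ew: "e w > 0" using w CB by (auto simp: e_def B_def)
      have "(d + 1) / d = (\<Sum>x\<in>B. e x) / d" using sumB by simp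
      also have "\<dots> = (\<Sum>x\<in>B. e x * (1 / d))" by (simp add: sum_divide_distrib)
      also have "\<dots> < (\<Sum>x\<in>B. e x * v (p x))"
      proof (rule sum_strict_mono_ex1[OF finB])
        show "\<forall>x\<in>B. real (e x) * (1 / real d) \<le> real (e x) * v (p x)"
          using vB pB by (intro ballI mult_left_mono) auto
        show "\<exists>a\<in>B. real (e a) * (1 / real d) < real (e a) * v (p a)"
          using w CB vw ew by (intro bexI[of _ w] mult_strict_left_mono) auto
      qed
      also have "\<dots> \<le> (\<Sum>x\<in>R. e x * v (p x))"
        using vnn PG.in_R_iff[OF pG] by (intro sum_mono2) (auto simp: B_def)
      finally show ?thesis by (simp add: v\<beta>[OF pG])
    qed
  qed
  have NG: "N \<subseteq> Gal" by (auto simp: N_def)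
  have es: "esym (card N) \<beta> Gal \<noteq> 0" "v (esym (card N) \<beta> Gal) = (\<Sum>p\<in>N. v (\<beta> p))"
    using esym_dominant[OF PG.finite_G NG, of \<beta>] \<beta>L vN vG by auto
  have "(\<Sum>p\<in>N. v (\<beta> p)) = card N * ((d + 1) / d)" using vN by simp
  then have "card N * ((d + 1) / d) \<in> \<int>"
    using v_rat[OF esym_orbit_rational[of "card N" e] es(1)[unfolded \<beta>_def]] es by (simp add: \<beta>_def)
  then obtain z :: int where "card N * ((d + 1) / d) = z" by (auto elim: Ints_cases)
  then have "real_of_int (int (card N) * int (d + 1)) = real_of_int (z * int d)"
    using d0 by (simp add: field_simps)
  then have "int (card N) * int (d + 1) = z * int d" by (simp only: of_int_eq_iff)
  then have "int d dvd int (card N * (d + 1))" by (metis dvd_triv_right of_nat_mult)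
  then have "d dvd card N * (d + 1)" by (simp only: int_dvd_int_iff)
  moreover have "\<not> d dvd d + 1" using d by (metis add.commute dvd_add_triv_right_iff not_prime_unit)
  ultimately have dN: "d dvd card N" using d by (simp add: prime_dvd_mult_iff)
  have "perm_group R N"
  proof
    show "id \<in> N" by (simp add: N_def PG.id_in)
    show "p \<circ> q \<in> N" if "p \<in> N" "q \<in> N" for p q
      using that PG.comp_in unfolding N_def by (auto simp only: mem_Collect_eq image_comp[symmetric])
  qed (auto simp: N_def PG.permutes)
  from perm_group.cauchy[OF this d dN] show ?thesis using NG by blast
qed

text \<open>The product over an orbit is rational and its valuation is |orbit|/|R|, so integrality
  leaves only the full orbit.\<close>

lemma transitive_if_uniform_valuation:
  assumes pf: "padic_field L v p" and R0: "0 \<notin> R"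
    and vk: "\<And>x. x \<in> R \<Longrightarrow> v x = 1 / card R"
  shows "transitive_perm_group R Gal"
proof
  fix x y assume xy: "x \<in> R" "y \<in> R"
  interpret padic_field L v p by (rule pf)
  define O' where "O' = (\<lambda>p. p x) ` Gal"
  have OR: "O' \<subseteq> R" using PG.in_R_iff xy by (auto simp: O'_def)
  have fin: "finite O'" by (simp add: O'_def PG.finite_G)
  have xO: "x \<in> O'" using PG.id_in by (auto simp: O'_def intro!: image_eqI[of _ _ id])
  have "\<Prod>O' \<in> \<rat>"
  proof (rule fixed_rational)
    show "\<Prod>O' \<in> L" using OR R_subset_L by (intro closed(11)) auto
    fix \<tau> assume t: "\<tau> \<in> field_auts L"
    obtain h where h: "h \<in> Gal" "\<forall>z\<in>R. h z = \<tau> z" using field_auts_restrict[OF t] by blast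
    have "h ` O' \<subseteq> O'"
    proof
      fix z assume "z \<in> h ` O'"
      then obtain p where p: "p \<in> Gal" "z = (h \<circ> p) x" by (auto simp: O'_def)
      then show "z \<in> O'" using PG.comp_in[OF h(1) p(1)] unfolding O'_def by blast
    qed
    moreover have inj: "inj_on h O'" using PG.injG[OF h(1)] by (auto intro: inj_on_subset)
    ultimately have hO: "h ` O' = O'" by (intro endo_inj_surj fin)
    have "\<tau> (\<Prod>O') = (\<Prod>z\<in>O'. \<tau> z)" using OR R_subset_L by (intro field_auts_prod[OF t]) auto
    also have "\<dots> = (\<Prod>z\<in>O'. h z)" by (rule prod.cong) (use h OR in auto)
    also have "\<dots> = \<Prod>(h ` O')" using inj by (simp add: prod.reindex)
    finally show "\<tau> (\<Prod>O') = \<Prod>O'" by (simp only: hO)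
  qed
  moreover have "\<Prod>O' \<noteq> 0" using fin OR R0 by auto
  ultimately have "v (\<Prod>O') \<in> \<int>" by (rule v_rat)
  moreover have "v (\<Prod>O') = (\<Sum>z\<in>O'. v z)" using OR R_subset_L R0 by (intro v_prod) auto
  moreover have "(\<Sum>z\<in>O'. v z) = card O' / card R"
  proof -
    have "(\<Sum>z\<in>O'. v z) = (\<Sum>z\<in>O'. 1 / card R)" using OR vk by (intro sum.cong) auto
    then show ?thesis by simp
  qed
  ultimately have Z: "card O' / card R \<in> \<int>" by simp
  have cR: "card R > 0" using xy by (auto simp: card_gt_0_iff)
  have cO: "card O' > 0" using xO fin by (auto simp: card_gt_0_iff)
  have "card O' \<le> card R" using OR by (simp add: card_mono)
  moreover have "card R \<le> card O'"
  proof -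
    obtain z :: int where z: "card O' / card R = z" using Z by (auto elim: Ints_cases)
    have "real_of_int z > 0" using cR cO unfolding z[symmetric] by simp
    then have "real_of_int z \<ge> 1" by simp
    then show ?thesis using cR unfolding z[symmetric] by (simp add: field_simps)
  qed
  ultimately have "O' = R" using OR by (intro card_subset_eq) auto
  then have "y \<in> O'" using xy by simp
  then show "\<exists>p\<in>Gal. p x = y" by (auto simp: O'_def)
qed

section \<open>Signs of permutations and the discriminant\<close>

definition ltpairs :: "(complex \<Rightarrow> nat) \<Rightarrow> (complex \<times> complex) set" where
  "ltpairs \<iota> = {(x, y). x \<in> R \<and> y \<in> R \<and> \<iota> x < \<iota> y}"

text \<open>The sign is read off the product of differences over pairs ordered by
  \<open>\<iota>\<close>. The identity is kept for arbitrary \<open>f\<close>: taking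
  \<open>f\<close> to be a permutation gives multiplicativity, taking it to be the identity gives
  the action on the square root of the discriminant.\<close>

lemma ex_sign:
  obtains \<iota> and \<epsilon> :: "(complex \<Rightarrow> complex) \<Rightarrow> int" where "inj_on \<iota> R"
    "\<And>f p. p permutes R \<Longrightarrow> (\<Prod>(x,y)\<in>ltpairs \<iota>. f (p x) - f (p y)) = of_int (\<epsilon> p) * (\<Prod>(x,y)\<in>ltpairs \<iota>. f x - f y :: complex)"
    "\<And>p. p permutes R \<Longrightarrow> \<epsilon> p = 1 \<or> \<epsilon> p = - 1"
    "\<And>p q. p permutes R \<Longrightarrow> q permutes R \<Longrightarrow> \<epsilon> (p \<circ> q) = \<epsilon> p * \<epsilon> q"
proof -
  obtain \<iota> :: "complex \<Rightarrow> nat" where i: "inj_on \<iota> R"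
    using finite_imp_inj_to_nat_seg[OF finite_R] by blast
  define T where "T = ltpairs \<iota>"
  have TR: "T \<subseteq> R \<times> R" by (auto simp: T_def ltpairs_def)
  then have finT: "finite T" by (rule finite_subset) simp
  define s where "s p = (\<lambda>(x, y). if \<iota> (p x) < \<iota> (p y) then (1::int) else - 1)" for p :: "complex \<Rightarrow> complex"
  define n where "n = (\<lambda>(x, y). if \<iota> x < \<iota> y then (x, y) else (y, x))"
  define \<epsilon> where "\<epsilon> p = prod (s p) T" for p
  have key: "(\<Prod>(x,y)\<in>T. f (p x) - f (p y)) = of_int (\<epsilon> p) * (\<Prod>(x,y)\<in>T. f x - f y :: complex)"
    if p: "p permutes R" for f p
  proof -
    \<comment> \<open>The image pair, put back into increasing order; this permutes the ordered
      pairs.\<close>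
    define m where "m = (\<lambda>(x, y). n (p x, p y))"
    have pR: "p x \<in> R \<longleftrightarrow> x \<in> R" for x using permutes_in_image[OF p] .
    have pinj: "p x = p y \<longleftrightarrow> x = y" for x y using permutes_inj[OF p] by (auto dest: injD)
    have m_in: "m z \<in> T" if "z \<in> T" for z
    proof -
      obtain x y where xy: "z = (x, y)" by (cases z)
      have R: "x \<in> R" "y \<in> R" "x \<noteq> y" using that by (auto simp: xy T_def ltpairs_def)
      then have "\<iota> (p x) \<noteq> \<iota> (p y)" using inj_onD[OF i, of "p x" "p y"] pR pinj by auto
      then show ?thesis using R pR by (auto simp: xy m_def n_def T_def ltpairs_def)
    qed
    have m_inj: "inj_on m T"
    proof (rule inj_onI)
      fix z w assume zw: "z \<in> T" "w \<in> T" "m z = m w"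
      obtain x y a b where xy: "z = (x, y)" and ab: "w = (a, b)" by (cases z; cases w)
      have "{p x, p y} = {p a, p b}" using zw by (auto simp: xy ab m_def n_def split: if_splits)
      then have "{x, y} = {a, b}" using pinj by (auto simp: doubleton_eq_iff)
      then show "z = w" using zw by (auto simp: xy ab doubleton_eq_iff T_def ltpairs_def)
    qed
    have m_bij: "m ` T = T" using m_in m_inj by (intro endo_inj_surj finT) auto
    have "(\<Prod>(x,y)\<in>T. f (p x) - f (p y)) = (\<Prod>z\<in>T. of_int (s p z) * (\<lambda>(x,y). f x - f y) (m z))"
      by (rule prod.cong) (auto simp: s_def m_def n_def)
    also have "\<dots> = of_int (\<epsilon> p) * (\<Prod>z\<in>T. (\<lambda>(x,y). f x - f y) (m z))"
      by (simp add: prod.distrib \<epsilon>_def)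
    also have "(\<Prod>z\<in>T. (\<lambda>(x,y). f x - f y) (m z)) = (\<Prod>(x,y)\<in>m ` T. f x - f y)"
      by (simp only: prod.reindex[OF m_inj] o_def)
    finally show ?thesis by (simp only: m_bij)
  qed
  have pm: "\<epsilon> p = 1 \<or> \<epsilon> p = - 1" for p
  proof -
    have "prod (s p) A = 1 \<or> prod (s p) A = - 1" for A
      by (induction A rule: infinite_finite_induct) (auto simp: s_def split: if_splits)
    then show ?thesis by (simp add: \<epsilon>_def)
  qed
  have hom: "\<epsilon> (p \<circ> q) = \<epsilon> p * \<epsilon> q" if p: "p permutes R" and q: "q permutes R" for p q
  proof -
    define D where "D = (\<Prod>(x,y)\<in>T. x - y :: complex)"
    have D0: "D \<noteq> 0" using finT by (auto simp: D_def T_def ltpairs_def)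
    have "of_int (\<epsilon> (p \<circ> q)) * D = (\<Prod>(x,y)\<in>T. p (q x) - p (q y))"
      using key[OF permutes_compose[OF q p], of id] by (simp add: D_def)
    also have "\<dots> = of_int (\<epsilon> q) * (\<Prod>(x,y)\<in>T. p x - p y)" using key[OF q, of p] by simp
    also have "(\<Prod>(x,y)\<in>T. p x - p y) = of_int (\<epsilon> p) * D" using key[OF p, of id] by (simp add: D_def)
    finally have "of_int (\<epsilon> (p \<circ> q)) * D = of_int (\<epsilon> p * \<epsilon> q) * D" by (simp only: of_int_mult mult_ac)
    then have "of_int (\<epsilon> (p \<circ> q)) = (of_int (\<epsilon> p * \<epsilon> q) :: complex)" by (rule iffD1[OF mult_right_cancel[OF D0]])
    then show ?thesis by (simp only: of_int_eq_iff)
  qed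
  show ?thesis using that[of \<iota> \<epsilon>] i key pm hom by (simp add: T_def)
qed

text \<open>A proper subgroup containing the alternating group fixes the product D of differences,
  so D is rational and has integer valuation. The sum in \<open>disc\<close> is the valuation of the
  discriminant, twice that of D and hence even.\<close>

lemma full_if_odd_discriminant:
  assumes pf: "padic_field L v p"
    and pairs: "\<And>a b c d. a \<in> R \<Longrightarrow> b \<in> R \<Longrightarrow> c \<in> R \<Longrightarrow> d \<in> R \<Longrightarrow> a \<noteq> b \<Longrightarrow> c \<noteq> d \<Longrightarrow> tr a b \<circ> tr c d \<in> Gal"
    and disc: "(\<Sum>x\<in>R. v (\<Prod>y\<in>R - {x}. x - y)) = real N" "odd N"
  shows "Gal = {p. p permutes R}"
proof (rule ccontr)
  assume nf: "Gal \<noteq> {p. p permutes R}"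
  interpret padic_field L v p by (rule pf)
  obtain \<iota> and \<epsilon> :: "(complex \<Rightarrow> complex) \<Rightarrow> int" where i: "inj_on \<iota> R"
    and key: "\<And>f p. p permutes R \<Longrightarrow> (\<Prod>(x,y)\<in>ltpairs \<iota>. f (p x) - f (p y)) = of_int (\<epsilon> p) * (\<Prod>(x,y)\<in>ltpairs \<iota>. f x - f y :: complex)"
    and pm: "\<And>p. p permutes R \<Longrightarrow> \<epsilon> p = 1 \<or> \<epsilon> p = - 1"
    and hom: "\<And>p q. p permutes R \<Longrightarrow> q permutes R \<Longrightarrow> \<epsilon> (p \<circ> q) = \<epsilon> p * \<epsilon> q"
    using ex_sign by blast
  define T where "T = ltpairs \<iota>"
  define T' where "T' = prod.swap ` T"
  have finT: "finite T" by (rule finite_subset[of _ "R \<times> R"]) (auto simp: T_def ltpairs_def)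
  have one: "\<epsilon> p = 1" if "p \<in> Gal" for p
    using PG.sign_trivial_if_not_full[OF pairs hom pm nf that] .
  define D where "D = (\<Prod>(x,y)\<in>T. x - y :: complex)"
  have xyL: "x - y \<in> L \<and> x - y \<noteq> 0" if "x \<in> R" "y \<in> R" "x \<noteq> y" for x y
    using that R_subset_L closed(7) by auto
  have TL: "(case z of (x, y) \<Rightarrow> x - y) \<in> L \<and> (case z of (x, y) \<Rightarrow> x - y) \<noteq> 0" if "z \<in> T" for z
    using that xyL by (cases z) (auto simp: T_def ltpairs_def)
  have "D \<in> \<rat>"
  proof (rule fixed_rational)
    show "D \<in> L" unfolding D_def using TL by (intro closed(11)) blast
    fix \<tau> assume t: "\<tau> \<in> field_auts L"
    obtain h where h: "h \<in> Gal" "\<forall>z\<in>R. h z = \<tau> z" using field_auts_restrict[OF t] by blast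
    have "\<tau> D = (\<Prod>z\<in>T. \<tau> (case z of (x, y) \<Rightarrow> x - y))"
      unfolding D_def using TL by (intro field_auts_prod[OF t]) blast
    also have "\<dots> = (\<Prod>(x,y)\<in>T. h x - h y)"
      by (rule prod.cong) (use h in \<open>auto simp: T_def ltpairs_def field_auts_hom(7)[OF t] subsetD[OF R_subset_L]\<close>)
    also have "\<dots> = D" using key[OF PG.permutes[OF h(1)], of id] one[OF h(1)] by (simp add: D_def T_def)
    finally show "\<tau> D = D" .
  qed
  moreover have "D \<noteq> 0" using TL finT by (simp add: D_def)
  ultimately have vD: "v D \<in> \<int>" by (rule v_rat)
  have vDs: "v D = (\<Sum>(x,y)\<in>T. v (x - y))"
    unfolding D_def using v_prod[of T "\<lambda>(x, y). x - y"] TL by (simp add: case_prod_beta)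
  have vDs': "v D = (\<Sum>(x,y)\<in>T'. v (x - y))"
  proof -
    have "(\<Sum>(x,y)\<in>T'. v (x - y)) = (\<Sum>(x,y)\<in>T. v (y - x))"
      unfolding T'_def by (subst sum.reindex) (auto simp: inj_on_def case_prod_beta intro!: sum.cong)
    also have "\<dots> = (\<Sum>(x,y)\<in>T. v (x - y))"
    proof (rule sum.cong)
      fix z assume z: "z \<in> T"
      obtain x y where xy: "z = (x, y)" by (cases z)
      have "v (- (x - y)) = v (x - y)" using TL[OF z] by (intro v_uminus) (simp add: xy)
      then show "(case z of (x, y) \<Rightarrow> v (y - x)) = (case z of (x, y) \<Rightarrow> v (x - y))" by (simp add: xy)
    qed simp
    finally show ?thesis using vDs by simp
  qed
  have "real N = (\<Sum>x\<in>R. \<Sum>y\<in>R - {x}. v (x - y))"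
    unfolding disc(1)[symmetric] by (rule sum.cong) (use xyL in \<open>auto intro!: v_prod\<close>)
  also have "\<dots> = (\<Sum>(x,y)\<in>(SIGMA x:R. R - {x}). v (x - y))" by (rule sum.Sigma) auto
  also have "(SIGMA x:R. R - {x}) = T \<union> T'"
  proof -
    have "\<iota> x < \<iota> y \<or> \<iota> y < \<iota> x" if "x \<in> R" "y \<in> R" "x \<noteq> y" for x y
      using that inj_onD[OF i, of x y] by (meson linorder_neqE_nat)
    note lin = this
    show ?thesis
    proof (intro set_eqI)
      fix z show "z \<in> (SIGMA x:R. R - {x}) \<longleftrightarrow> z \<in> T \<union> T'"
        using lin[of "fst z" "snd z"] by (cases z) (auto simp: T_def T'_def ltpairs_def image_iff)
    qed
  qed
  also have "(\<Sum>(x,y)\<in>T \<union> T'. v (x - y)) = v D + v D"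
    using vDs vDs' finT by (subst sum.union_disjoint) (auto simp: T_def T'_def ltpairs_def)
  finally have "real N = 2 * v D" by simp
  then obtain z :: int where "real N = 2 * of_int z" using vD by (auto elim: Ints_cases)
  then have "int N = 2 * z" by linarith
  then have "even (int N)" by simp
  then show False using disc(2) by simp
qed

end

section \<open>Trimmed exponentials\<close>

definition ffact :: "nat \<Rightarrow> nat \<Rightarrow> nat" where "ffact m i = (\<Prod>t<i. m - t)"

lemma ffact_fact: "i \<le> m \<Longrightarrow> ffact m i * fact (m - i) = fact m"
proof (induction i)
  case (Suc i)
  then have "m - i = Suc (m - Suc i)" by simp
  then have "fact (m - i) = (m - i) * fact (m - Suc i)" by (metis fact_Suc of_nat_id)
  then show ?case using Suc by (simp add: ffact_def mult_ac)
qed (simp add: ffact_def)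

lemma ffact_pos: "i \<le> m \<Longrightarrow> ffact m i > 0"
  by (auto simp: ffact_def intro!: prod_pos)

section \<open>The monic integral multiple of a trimmed exponential and its roots\<close>

locale trimmed =
  fixes m k :: nat
  assumes km: "k \<le> m" and k2: "2 \<le> k"
begin

definition g :: "rat poly" where "g = trimmed_exp (m - k) m"

definition F :: "complex poly" where "F = (\<Sum>i\<le>k. monom (of_nat (ffact m i)) (k - i))"

lemma trimmed_sum: "g = (\<Sum>i\<le>k. monom (1 / of_nat (fact (m - i))) (k - i))"
  unfolding g_def trimmed_exp_def
  by (rule sum.reindex_bij_witness[of _ "\<lambda>i. m - i" "\<lambda>j. m - j"]) (use km in \<open>auto simp: add.commute\<close>)

lemma coeff_g: "i \<le> k \<Longrightarrow> coeff g (k - i) = 1 / of_nat (fact (m - i))"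
proof -
  assume i: "i \<le> k"
  have "coeff g (k - i) = (\<Sum>j\<le>k. if k - j = k - i then 1 / of_nat (fact (m - j)) else 0)"
    by (simp add: trimmed_sum coeff_sum del: of_nat_fact)
  also have "\<dots> = (\<Sum>j\<le>k. if j = i then 1 / of_nat (fact (m - j)) else 0)"
    using i by (intro sum.cong) auto
  finally show ?thesis using i by simp
qed

lemma degree_g: "degree g = k"
proof (rule antisym)
  show "degree g \<le> k" unfolding trimmed_sum
    by (rule degree_sum_le) (auto intro: order_trans[OF degree_monom_le])
  show "k \<le> degree g" using coeff_g[of 0] by (intro le_degree) simp
qed

lemma g0: "g \<noteq> 0" using degree_g k2 by auto

lemma F_eq: "F = smult (of_nat (fact m)) (map_poly of_rat g)"
proof -
  have "map_poly of_rat (\<Sum>i\<in>A. f i) = (\<Sum>i\<in>A. map_poly of_rat (f i) :: complex poly)" for f and A :: "nat set"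
    by (induction A rule: infinite_finite_induct) (simp_all add: cpoly_hom)
  moreover have "smult c (\<Sum>i\<in>A. f i) = (\<Sum>i\<in>A. smult c (f i))" for c :: complex and f and A :: "nat set"
    by (induction A rule: infinite_finite_induct) (simp_all add: smult_add_right)
  ultimately have "smult (of_nat (fact m)) (map_poly of_rat g) =
    (\<Sum>i\<le>k. monom (of_nat (fact m) * of_rat (1 / of_nat (fact (m - i)))) (k - i) :: complex poly)"
    unfolding trimmed_sum by (simp add: cpoly_hom smult_monom)
  also have "\<dots> = F" unfolding F_def
  proof (rule sum.cong)
    fix i assume "i \<in> {..k}"
    then have "fact m = ffact m i * fact (m - i)" using km by (simp add: ffact_fact)
    then have "of_nat (fact m) = (of_nat (ffact m i) * of_nat (fact (m - i)) :: complex)"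
      by (metis of_nat_mult)
    then show "monom (of_nat (fact m) * of_rat (1 / of_nat (fact (m - i)))) (k - i) =
        (monom (of_nat (ffact m i)) (k - i) :: complex poly)"
      by (simp add: of_rat_divide del: of_nat_fact)
  qed simp
  finally show ?thesis ..
qed

sublocale galois g by standard (rule g0)

lemma root_iff: "x \<in> R \<longleftrightarrow> poly F x = 0" by (simp add: in_R_iff F_eq)

lemma poly_F: "poly F x = (\<Sum>i\<le>k. of_nat (ffact m i) * x ^ (k - i))"
  by (simp add: F_def poly_sum poly_monom)

lemma poly_F': "poly (pderiv F) x = (\<Sum>i<k. of_nat ((k - i) * ffact m i) * x ^ (k - 1 - i))"
proof -
  have "poly (pderiv F) x = (\<Sum>i\<le>k. of_nat ((k - i) * ffact m i) * x ^ (k - 1 - i))"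
  proof -
    have "pderiv (\<Sum>i\<in>A. f i) = (\<Sum>i\<in>A. pderiv (f i))" for f :: "nat \<Rightarrow> complex poly" and A
      by (induction A rule: infinite_finite_induct) (simp_all add: pderiv_add)
    then show ?thesis by (simp add: F_def pderiv_monom poly_sum poly_monom mult_ac)
  qed
  also have "{..k} = insert k {..<k}" by auto
  finally show ?thesis by simp
qed

lemma root_nonzero: "0 \<notin> R"
proof
  assume "0 \<in> R"
  then have "(\<Sum>i\<le>k. of_nat (ffact m i) * (0::complex) ^ (k - i)) = 0" by (simp add: root_iff poly_F)
  also have "(\<Sum>i\<le>k. of_nat (ffact m i) * (0::complex) ^ (k - i)) = (\<Sum>i\<le>k. if i = k then of_nat (ffact m i) else 0)"
    by (rule sum.cong) (auto simp: power_0_left)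
  finally show False using ffact_pos[OF km] by simp
qed

lemma degree_F: "degree F = k" by (simp add: F_eq degree_g)

lemma lead_F: "lead_coeff F = 1"
proof -
  have "coeff F k = (\<Sum>j\<le>k. if k - j = k then of_nat (ffact m j) else 0)"
    by (simp add: F_def coeff_sum)
  also have "\<dots> = (\<Sum>j\<le>k. if j = 0 then of_nat (ffact m j) else 0)"
    by (intro sum.cong) (use k2 in auto)
  finally show ?thesis by (simp add: degree_F ffact_def)
qed

lemma ex_padic_field:
  assumes "prime p" shows "\<exists>v. padic_field L v p"
proof -
  obtain v :: "complex \<Rightarrow> real" where
    "\<And>x y. x \<in> L \<Longrightarrow> y \<in> L \<Longrightarrow> x \<noteq> 0 \<Longrightarrow> y \<noteq> 0 \<Longrightarrow> v (x * y) = v x + v y"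
    "\<And>x y. x \<in> L \<Longrightarrow> y \<in> L \<Longrightarrow> x \<noteq> 0 \<Longrightarrow> y \<noteq> 0 \<Longrightarrow> x + y \<noteq> 0 \<Longrightarrow> v (x + y) \<ge> min (v x) (v y)"
    "v (of_nat p) = 1" "\<And>n. \<not> int p dvd n \<Longrightarrow> v (of_int n) = 0"
    using ex_padic_valuation[OF assms, of L] L_closed(3) algebraic_L by blast
  then have "padic_field L v p" using is_subfield_L assms by (unfold_locales) auto
  then show ?thesis by blast
qed

lemma separable_if_simple:
  assumes "\<And>x. x \<in> R \<Longrightarrow> poly (pderiv F) x \<noteq> 0"
  shows "F = (\<Prod>x\<in>R. [:- x, 1:])" "card R = k"
proof -
  have sf: "rsquarefree F" unfolding rsquarefree_roots using assms root_iff by blast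
  have RF: "{z. poly F z = 0} = R" using root_iff by blast
  show "F = (\<Prod>x\<in>R. [:- x, 1:])"
    using complex_poly_decompose_rsquarefree[OF sf] by (simp add: lead_F RF)
  show "card R = k" using card_roots_rsquarefree[OF sf] by (simp add: RF degree_F)
qed

lemma esym_eq:
  assumes F: "F = (\<Prod>x\<in>R. [:- x, 1:])" and "card R = k" "i \<le> k"
  shows "esym i id R = (-1) ^ i * of_nat (ffact m i)"
proof -
  have "coeff F (k - i) = (\<Sum>j\<le>k. if k - j = k - i then of_nat (ffact m j) else 0)"
    by (simp add: F_def coeff_sum)
  also have "\<dots> = (\<Sum>j\<le>k. if j = i then of_nat (ffact m j) else 0)"
    using assms by (intro sum.cong) auto
  finally have "coeff F (k - i) = of_nat (ffact m i)" using assms by simp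
  moreover have "coeff F (k - i) = (-1) ^ i * esym i id R"
    unfolding F using coeff_prod_roots[of R i id] assms by simp
  ultimately have "(-1) ^ i * ((-1) ^ i * esym i id R) = (-1) ^ i * of_nat (ffact m i)" by simp
  moreover have "(-1) ^ i * (-1) ^ i = (1 :: complex)" by (simp flip: power_mult_distrib)
  ultimately show ?thesis by (simp flip: mult.assoc)
qed

text \<open>It makes the valuation of the discriminant computable from the derivative.\<close>

lemma prod_diff_roots:
  assumes F: "F = (\<Prod>x\<in>R. [:- x, 1:])" and x: "x \<in> R"
  shows "(\<Prod>y\<in>R - {x}. x - y) = poly (pderiv F) x"
proof -
  define Q where "Q = (\<Prod>y\<in>R - {x}. [:- y, 1:])"
  have "F = [:- x, 1:] * Q" unfolding F Q_def using x by (intro prod.remove) auto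
  then have "poly (pderiv F) x = poly ([:- x, 1:] * pderiv Q + Q * pderiv [:- x, 1:]) x"
    by (simp only: pderiv_mult)
  also have "\<dots> = poly Q x" by (simp add: pderiv_pCons algebra_simps)
  also have "\<dots> = (\<Prod>y\<in>R - {x}. x - y)" by (simp add: Q_def poly_prod algebra_simps)
  finally show ?thesis ..
qed

text \<open>The valuations of the coefficients needed in \<open>newton_polygon\<close>, for the polygon with vertices
  \<open>(0, 0)\<close>, \<open>(r, 0)\<close>, \<open>(r + d, 1)\<close>, \<open>(k, \<dots>)\<close>.\<close>

definition newton_data :: "nat \<Rightarrow> nat \<Rightarrow> nat \<Rightarrow> bool" where
  "newton_data p r d \<longleftrightarrow> prime p \<and> d > 0 \<and> r + d \<le> k \<and> k < r + 2 * d \<and>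
     (\<forall>i\<le>r. \<not> p dvd ffact m i) \<and> (\<forall>i. r < i \<and> i \<le> k \<longrightarrow> p dvd ffact m i) \<and>
     \<not> p\<^sup>2 dvd ffact m (r + d) \<and> (\<forall>i. r + d < i \<and> i \<le> k \<longrightarrow> p\<^sup>2 dvd ffact m i)"

lemma newton_roots:
  assumes nd: "newton_data p r d" and pf: "padic_field L v p"
    and F: "F = (\<Prod>x\<in>R. [:- x, 1:])" and cR: "card R = k"
  shows "card {x \<in> R. v x = 0} = r" "card {x \<in> R. v x = 1 / d} = d"
    "\<And>x. x \<in> R \<Longrightarrow> v x = 0 \<or> v x \<ge> 1 / d"
proof -
  interpret padic_field L v p by (rule pf)
  have es: "esym i id R = (-1) ^ i * of_nat (ffact m i)" if "i \<le> k" for i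
    by (rule esym_eq[OF F cR that])
  have nz: "esym i id R \<noteq> 0" if "i \<le> k" for i using that ffact_pos[of i m] km by (simp add: es)
  have v: "v (esym i id R) = v (of_nat (ffact m i))" if "i \<le> k" for i
  proof (cases "even i")
    case False then show ?thesis using es[OF that] v_uminus[OF closed_of_nat] by simp
  qed (simp add: es[OF that])
  have pp: "v (of_nat n) \<ge> 2" if n: "p\<^sup>2 dvd n" "n > 0" for n
  proof -
    obtain l where "n = p\<^sup>2 * l" using n(1) by (rule dvdE)
    then have l: "n = p * (p * l)" by (simp add: power2_eq_square)
    have "p * l > 0" "l > 0" using l n(2) by auto
    then show ?thesis unfolding l using v_p_mult[of "p * l"] v_p_mult[of l] v_nat_nonneg[of l] by simp
  qed
  note nd' = nd[unfolded newton_data_def]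
  have RL: "R \<subseteq> L" by (rule R_subset_L)
  note NP = newton_polygon[of R d r, OF finite_R RL root_nonzero]
  have h: "d > 0" "r + d \<le> card R" "card R < r + 2 * d" using nd' cR by auto
  have h0: "esym i id R \<noteq> 0 \<and> v (esym i id R) = 0" if "i \<le> r" for i
    using nd' that nz[of i] v[of i] v_nat_not_dvd[of "ffact m i"] by simp
  have h1: "ge 1 (esym i id R)" if "r < i" "i \<le> card R" for i
    using nd' that cR v[of i] v_nat_dvd[of "ffact m i"] ffact_pos[of i m] km by (simp add: ge_def)
  have hd: "esym (r + d) id R \<noteq> 0" "v (esym (r + d) id R) = 1"
    using nd' nz[of "r + d"] v[of "r + d"] v_nat_exact[of "ffact m (r + d)"] by auto
  have h2: "ge 2 (esym i id R)" if "r + d < i" "i \<le> card R" for i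
    using nd' that cR v[of i] pp[of "ffact m i"] ffact_pos[of i m] km by (simp add: ge_def)
  show "card {x \<in> R. v x = 0} = r" "card {x \<in> R. v x = 1 / d} = d"
    "\<And>x. x \<in> R \<Longrightarrow> v x = 0 \<or> v x \<ge> 1 / d"
    using NP[OF h h0 h1 hd h2] by blast+
qed

text \<open>Separability comes first: at a prime \<open>p > k\<close> exactly dividing \<open>m\<close> the polynomial is Eisenstein and tame.\<close>

lemma eisenstein_roots:
  assumes pf: "padic_field L v p" and pk: "p > k" and pm: "p dvd m" "\<not> p\<^sup>2 dvd m"
  shows "\<And>x. x \<in> R \<Longrightarrow> v x = 1 / k"
    "\<And>x. x \<in> R \<Longrightarrow> poly (pderiv F) x \<noteq> 0 \<and> v (poly (pderiv F) x) = (k - 1) / k"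
proof -
  interpret padic_field L v p by (rule pf)
  have m0: "m > 0" using km k2 by simp
  have ff: "p dvd ffact m i" if "0 < i" for i
    unfolding ffact_def using that pm by (intro dvd_trans[OF _ dvd_prodI[of _ 0]]) auto
  have v0: "v (of_nat (m - t)) = 0" if "0 < t" "t < k" for t
  proof (rule v_nat_not_dvd)
    show "\<not> p dvd m - t"
    proof
      assume "p dvd m - t"
      then have "p dvd t" using pm(1) that km by (metis dvd_diffD1 le_trans less_imp_le_nat)
      then show False using that pk by (auto dest: dvd_imp_le)
    qed
  qed
  have ffk: "v (of_nat (ffact m k)) = 1"
  proof -
    have "v (of_nat (ffact m k)) = (\<Sum>t<k. v (of_nat (m - t)))"
      unfolding ffact_def of_nat_prod using km closed_of_nat
      by (intro v_prod) (auto simp del: of_nat_diff)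
    also have "\<dots> = (\<Sum>t<k. if t = 0 then 1 else 0)"
      using v0 v_nat_exact[OF pm] by (intro sum.cong) auto
    finally show ?thesis using k2 by simp
  qed
  fix x assume x: "x \<in> R"
  have xL: "x \<in> L" "x \<noteq> 0" using x R_subset_L root_nonzero by auto
  have tL: "of_nat n * x ^ j \<in> L" for n j using xL by (intro closed(4) closed(9) closed_of_nat)
  have vt: "v (of_nat n * x ^ j) = v (of_nat n) + j * v x" if "n > 0" for n j
    using that xL closed_of_nat closed(9)[of x j] by (simp add: v_mult v_power)
  have ffp: "ffact m i > 0" if "i \<le> k" for i using that km ffact_pos by simp
  have root: "(\<Sum>i\<le>k. of_nat (ffact m i) * x ^ (k - i)) = 0" using x by (simp add: root_iff poly_F)
  have no_dom: False if i: "i \<le> k"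
    and oth: "\<And>j. j \<le> k \<Longrightarrow> j \<noteq> i \<Longrightarrow> v (of_nat (ffact m i)) + (k - i) * v x < v (of_nat (ffact m j)) + (k - j) * v x" for i
    using dominant_sum(1)[of "{..k}" i "\<lambda>i. of_nat (ffact m i) * x ^ (k - i)"] root tL i ffp[OF i] xL oth
    by (simp add: gt_def vt ffp)
  have vf1: "v (of_nat (ffact m i)) \<ge> 1" if "0 < i" "i \<le> k" for i
    using that ff[of i] ffp[of i] by (intro v_nat_dvd)
  have f0: "ffact m 0 = 1" by (simp add: ffact_def)
  have ge0: "v x \<ge> 0"
  proof (rule ccontr)
    assume neg: "\<not> v x \<ge> 0"
    show False
    proof (rule no_dom[of 0])
      fix j assume j: "j \<le> k" "j \<noteq> 0"
      have "real k * v x < real (k - j) * v x" using neg j by (intro mult_strict_right_mono_neg) auto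
      then show "v (of_nat (ffact m 0)) + (k - 0) * v x < v (of_nat (ffact m j)) + (k - j) * v x"
        using vf1[of j] j by (simp add: f0 v_1)
    qed simp
  qed
  have ge1: "real k * v x \<ge> 1"
  proof (rule ccontr)
    assume neg: "\<not> real k * v x \<ge> 1"
    show False
    proof (rule no_dom[of 0])
      fix j assume j: "j \<le> k" "j \<noteq> 0"
      have "0 \<le> real (k - j) * v x" using ge0 by simp
      then show "v (of_nat (ffact m 0)) + (k - 0) * v x < v (of_nat (ffact m j)) + (k - j) * v x"
        using vf1[of j] j neg by (simp add: f0 v_1)
    qed simp
  qed
  then have pos: "v x > 0" using ge0 by (cases "v x = 0") auto
  have le1: "real k * v x \<le> 1"
  proof (rule ccontr)
    assume neg: "\<not> real k * v x \<le> 1"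
    show False
    proof (rule no_dom[of k])
      fix j assume j: "j \<le> k" "j \<noteq> k"
      show "v (of_nat (ffact m k)) + (k - k) * v x < v (of_nat (ffact m j)) + (k - j) * v x"
      proof (cases "j = 0")
        case True then show ?thesis using neg ffk by (simp add: f0 v_1)
      next
        case False
        have "0 < real (k - j) * v x" using pos j by (intro mult_pos_pos) auto
        then show ?thesis using vf1[of j] j False ffk by simp
      qed
    qed simp
  qed
  show vx: "v x = 1 / k" using ge1 le1 k2 by (simp add: field_simps)
  have vn: "v (of_nat (n * l)) = v (of_nat n) + v (of_nat l)" if "n > 0" "l > 0" for n l
    using that closed_of_nat unfolding of_nat_mult by (intro v_mult) auto
  have kpos: "v (of_nat (k - 0)) = 0" using pk k2 by (intro v_nat_not_dvd) (auto dest: dvd_imp_le)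
  define T where "T i = of_nat ((k - i) * ffact m i) * x ^ (k - 1 - i)" for i
  \<comment> \<open>The leading term k x^(k-1) has valuation (k - 1)/k < 1 because p does not divide
    k; all other coefficients of the derivative are divisible by p.\<close>
  have gtT: "gt (v (T 0)) (T j)" if j: "j \<in> {..<k}" "j \<noteq> 0" for j
  proof -
    have "v (of_nat ((k - j) * ffact m j)) = v (of_nat (k - j)) + v (of_nat (ffact m j))"
      using j ffp[of j] by (intro vn) auto
    moreover have "v (of_nat (k - j)) \<ge> 0" using j by (intro v_nat_nonneg) auto
    moreover have "v (of_nat (ffact m j)) \<ge> 1" using j vf1 by simp
    moreover have "real (k - 1) * v x < 1" unfolding vx using k2 by (simp add: field_simps)
    moreover have "0 \<le> real (k - 1 - j) * v x" using pos by simp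
    ultimately show ?thesis
      using j ffp[of j] kpos k2 by (simp add: T_def gt_def vt f0 del: of_nat_mult of_nat_diff)
  qed
  have T0: "T 0 = of_nat k * x ^ (k - 1)" by (simp add: T_def f0)
  have "sum T {..<k} \<noteq> 0 \<and> v (sum T {..<k}) = v (T 0)"
  proof -
    have "T j \<in> L" for j unfolding T_def by (rule tL)
    moreover have "T 0 \<noteq> 0" using k2 xL by (simp add: T0)
    ultimately show ?thesis using dominant_sum[of "{..<k}" 0 T] gtT k2 by simp
  qed
  then show "poly (pderiv F) x \<noteq> 0 \<and> v (poly (pderiv F) x) = (k - 1) / k"
    unfolding poly_F' T_def[symmetric] T0 using vt[of k "k - 1"] kpos k2 vx by simp
qed

section \<open>Polygon data at large and at small primes\<close>

lemma not_square_dvd_ffact: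
  assumes p: "prime p" and j: "j < n" "\<not> p\<^sup>2 dvd m - j"
    and oth: "\<And>t. t < n \<Longrightarrow> t \<noteq> j \<Longrightarrow> \<not> p dvd m - t"
  shows "\<not> p\<^sup>2 dvd ffact m n"
proof
  assume *: "p\<^sup>2 dvd ffact m n"
  have "ffact m n = (m - j) * (\<Prod>t\<in>{..<n} - {j}. m - t)"
    unfolding ffact_def using j by (intro prod.remove) auto
  moreover have "\<not> p dvd (\<Prod>t\<in>{..<n} - {j}. m - t)"
    using oth p by (subst prime_dvd_prod_iff) auto
  then have "coprime p (\<Prod>t\<in>{..<n} - {j}. m - t)" using p by (simp add: prime_imp_coprime)
  then have "coprime (p\<^sup>2) (\<Prod>t\<in>{..<n} - {j}. m - t)" by simp
  ultimately have "p\<^sup>2 dvd m - j" using * by (simp add: coprime_dvd_mult_left_iff)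
  then show False using j by simp
qed

lemma dvd_ffact: "p dvd m - j \<Longrightarrow> j < n \<Longrightarrow> p dvd ffact m n"
  unfolding ffact_def by (rule dvd_trans[OF _ dvd_prodI[of _ j]]) auto

lemma not_dvd_ffact: "prime p \<Longrightarrow> (\<And>t. t < n \<Longrightarrow> \<not> p dvd m - t) \<Longrightarrow> \<not> p dvd ffact m n"
  unfolding ffact_def by (subst prime_dvd_prod_iff) auto

text \<open>A prime above k divides at most one of k consecutive integers, so the polygon has the
  vertices (0, 0), (j, 0), (k, 1).\<close>

lemma newton_data_large:
  assumes p: "prime p" "p > k" and j: "j < k" "p dvd m - j" "\<not> p\<^sup>2 dvd m - j"
  shows "newton_data p j (k - j)"
proof -
  have nd: "\<not> p dvd m - t" if t: "t < k" "t \<noteq> j" for t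
  proof
    assume d: "p dvd m - t"
    show False
    proof (cases "t < j")
      case True
      then have "(m - t) - (m - j) = j - t" using j km by simp
      then have "p dvd j - t" using d j(2) by (metis dvd_diff_nat)
      then show False using True j p by (auto dest: dvd_imp_le)
    next
      case False
      then have "(m - j) - (m - t) = t - j" using t km by simp
      then have "p dvd t - j" using d j(2) by (metis dvd_diff_nat)
      then show False using False t p by (auto dest: dvd_imp_le)
    qed
  qed
  have "\<not> p dvd ffact m i" if "i \<le> j" for i
    using that j nd by (intro not_dvd_ffact p(1)) simp
  moreover have "p dvd ffact m i" if "j < i" for i using dvd_ffact[OF j(2) that] .
  moreover have "\<not> p\<^sup>2 dvd ffact m (j + (k - j))"
    using j nd by (intro not_square_dvd_ffact[OF p(1), of j]) auto
  ultimately show ?thesis unfolding newton_data_def using p j by auto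
qed

text \<open>With r = m mod q, the factors m - t divisible by q are those at t = r and, if it is
  below k, t = r + q. The first brings the valuation to 1 and the second to at least 2. The
  condition on the residue modulo q^2 says that q^2 does not divide m - r.\<close>

lemma newton_data_small:
  assumes q: "prime q" "k < 2 * q" and r: "m mod q + q \<le> k" "m mod q\<^sup>2 \<ge> q"
  shows "newton_data q (m mod q) q"
proof -
  define r where "r = m mod q"
  have q0: "q > 0" using q by (simp add: prime_gt_0_nat)
  have rq: "r < q" using q0 by (simp add: r_def)
  have rk: "r + q \<le> k" using r by (simp add: r_def)
  have dr: "q dvd m - r" by (simp add: r_def dvd_minus_mod)
  have dvd_iff: "q dvd m - t \<longleftrightarrow> t = r \<or> t = r + q" if t: "t < k" for t
  proof -
    have "q dvd m - t \<longleftrightarrow> m mod q = t mod q" using t km mod_eq_dvd_iff_nat[of t m q] by simp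
    also have "\<dots> \<longleftrightarrow> t = r \<or> t = r + q"
    proof (cases "t < q")
      case True then show ?thesis using rq by (auto simp: r_def)
    next
      case False
      have "t - q < q" using t q by simp
      then have "t mod q = t - q" using False by (simp add: le_mod_geq)
      then show ?thesis using False rq by (auto simp: r_def)
    qed
    finally show ?thesis .
  qed
  have nsq: "\<not> q\<^sup>2 dvd m - r"
  proof
    assume "q\<^sup>2 dvd m - r"
    moreover have "r \<le> m" by (simp add: r_def)
    ultimately have "m mod q\<^sup>2 = r mod q\<^sup>2" using mod_eq_dvd_iff_nat[of r m "q\<^sup>2"] by simp
    also have "\<dots> \<le> r" by simp
    finally show False using r rq by simp
  qed
  have sq: "q\<^sup>2 dvd ffact m i" if i: "r + q < i" "i \<le> k" for i
  proof -
    have d2: "q dvd m - (r + q)" using dvd_iff[of "r + q"] i by simp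
    have "q * q dvd (\<Prod>t\<in>{r, r + q}. m - t)" using q0 dr d2 by (simp add: mult_dvd_mono)
    also have "\<dots> dvd ffact m i" unfolding ffact_def using i by (intro prod_dvd_prod_subset) auto
    finally show ?thesis by (simp add: power2_eq_square)
  qed
  have "\<not> q dvd ffact m i" if "i \<le> r" for i
    using that dvd_iff rk by (intro not_dvd_ffact q(1)) auto
  moreover have "q dvd ffact m i" if "r < i" for i using dvd_ffact[OF dr that] .
  moreover have "\<not> q\<^sup>2 dvd ffact m (r + q)"
    using dvd_iff rk q0 nsq by (intro not_square_dvd_ffact[OF q(1), of r]) auto
  moreover have "k < r + 2 * q" using q by simp
  ultimately show ?thesis unfolding newton_data_def r_def[symmetric] using q rk q0 sq by auto
qed

text \<open>One root has valuation 0 and the other k - 1 have valuation 1/(k - 1). The derivative is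
  a unit at the first; at each of the others its term of index 1 dominates, with valuation (k -
  2)/(k - 1).\<close>

lemma discriminant_at_pred:
  assumes pf: "padic_field L v p" and pk: "p > k" and pm: "p dvd m - 1" "\<not> p\<^sup>2 dvd m - 1"
    and k3: "k \<ge> 3" and F: "F = (\<Prod>x\<in>R. [:- x, 1:])" and cR: "card R = k"
  shows "(\<Sum>x\<in>R. v (poly (pderiv F) x)) = real (k - 2)"
proof -
  interpret padic_field L v p by (rule pf)
  have nd: "newton_data p 1 (k - 1)" using prime pk pm k3 by (intro newton_data_large) auto
  note nr = newton_roots[OF nd pf F cR]
  define w :: real where "w = 1 / (k - 1)"
  have w: "w > 0" "(k - 1) * w = 1" "(k - 2) * w < 1" using k3 by (auto simp: w_def field_simps)
  define Z where "Z = {x \<in> R. v x = 0}"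
  define W where "W = {x \<in> R. v x = w}"
  have cZ: "card Z = 1" and cW: "card W = k - 1" using nr by (auto simp: Z_def W_def w_def)
  have ZW: "Z \<inter> W = {}" using w by (auto simp: Z_def W_def)
  have fin: "finite Z" "finite W" by (auto simp: Z_def W_def)
  have "Z \<union> W = R"
  proof (rule card_subset_eq)
    show "card (Z \<union> W) = card R" using cZ cW ZW fin cR k3 by (simp add: card_Un_disjoint)
  qed (auto simp: Z_def W_def)
  have mpos: "m > 0" using km k2 by simp
  have f0: "ffact m 0 = 1" and f1: "ffact m 1 = m" by (auto simp: ffact_def)
  have ffp: "ffact m i > 0" if "i \<le> k" for i using that km ffact_pos by simp
  have vf: "v (of_nat (ffact m i)) \<ge> 1" if "1 < i" "i \<le> k" for i
    using that nd ffp[of i] by (intro v_nat_dvd) (auto simp: newton_data_def)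
  have vm: "v (of_nat m) = 0"
    using nd f1 by (intro v_nat_not_dvd) (auto simp: newton_data_def)
  have vk1: "v (of_nat (k - 1)) = 0" using pk k3 by (intro v_nat_not_dvd) (auto dest: dvd_imp_le)
  have xL: "x \<in> L" "x \<noteq> 0" if "x \<in> R" for x using that R_subset_L root_nonzero by auto
  have tL: "of_nat n * x ^ j \<in> L" if "x \<in> R" for n j x
    using xL[OF that] by (intro closed(4) closed(9) closed_of_nat)
  have vt: "v (of_nat n * x ^ j) = v (of_nat n) + j * v x" if "n > 0" "x \<in> R" for n j x
    using xL[OF that(2)] that closed_of_nat closed(9)[of x j] by (simp add: v_mult v_power)
  have vn: "v (of_nat (n * l)) = v (of_nat n) + v (of_nat l)" if "n > 0" "l > 0" for n l
    using that closed_of_nat unfolding of_nat_mult by (intro v_mult) auto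
  have vZ: "v (poly (pderiv F) x) = 0" if xZ: "x \<in> Z" for x
  proof -
    have x: "x \<in> R" and vx: "v x = 0" using xZ by (auto simp: Z_def)
    define A where "A = (\<Sum>i\<in>{2..k}. of_nat (ffact m i) * x ^ (k - i))"
    define B where "B = (\<Sum>i\<in>{2..<k}. of_nat ((k - i) * ffact m i) * x ^ (k - 1 - i))"
    have gA: "gt 0 A" unfolding A_def
    proof (rule gt_sum, rule conjI)
      fix i assume i: "i \<in> {2..k}"
      show "of_nat (ffact m i) * x ^ (k - i) \<in> L" by (rule tL[OF x])
      show "gt 0 (of_nat (ffact m i) * x ^ (k - i))"
        using vt[OF _ x, of "ffact m i" "k - i"] vf[of i] ffp[of i] vx i by (simp add: gt_def)
    qed
    have gB: "gt 0 B" unfolding B_def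
    proof (rule gt_sum, rule conjI)
      fix i assume i: "i \<in> {2..<k}"
      show "of_nat ((k - i) * ffact m i) * x ^ (k - 1 - i) \<in> L" by (rule tL[OF x])
      have "v (of_nat ((k - i) * ffact m i)) \<ge> 1"
        using vn[of "k - i" "ffact m i"] vf[of i] ffp[of i] i v_nat_nonneg[of "k - i"] by simp
      then show "gt 0 (of_nat ((k - i) * ffact m i) * x ^ (k - 1 - i))"
        using vt[OF _ x, of "(k - i) * ffact m i" "k - 1 - i"] vx ffp[of i] i by (simp add: gt_def del: of_nat_mult)
    qed
    have AL: "A \<in> L" unfolding A_def using tL[OF x] by (intro closed(10)) auto
    have BL: "B \<in> L" unfolding B_def by (intro closed(10) tL[OF x])
    have root: "of_nat 1 * x ^ k + of_nat m * x ^ (k - 1) + A = 0"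
    proof -
      have "0 = (\<Sum>i\<le>k. of_nat (ffact m i) * x ^ (k - i))" using x by (simp add: root_iff poly_F)
      also have "{..k} = insert 0 (insert 1 {2..k})" using k3 by auto
      finally show ?thesis using f1 by (simp add: A_def f0 add.assoc)
    qed
    have der: "poly (pderiv F) x = of_nat k * x ^ (k - 1) + of_nat ((k - 1) * m) * x ^ (k - 2) + B"
    proof -
      have "{..<k} = insert 0 (insert 1 {2..<k})" using k3 by auto
      then show ?thesis using f1 unfolding poly_F'
        by (simp add: B_def f0 numeral_2_eq_2 del: of_nat_mult of_nat_diff)
    qed
    have e1: "x * x ^ (k - 1) = x ^ k" using k3 by (simp flip: power_Suc)
    have e2: "x * x ^ (k - 2) = x ^ (k - 1)" using k3 by (simp add: Suc_diff_le flip: power_Suc) (metis Suc_diff_Suc Suc_le_lessD numeral_2_eq_2 numeral_3_eq_3 Suc_leD)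
    have mm: "of_nat ((k - 1) * m) = (of_nat k * of_nat m - of_nat m :: complex)"
      using k3 by (simp add: of_nat_diff algebra_simps)
    \<comment> \<open>At the unit root the first two terms of the derivative might cancel.
      Subtracting k F(x) = 0 leaves the single unit -m x^(k-1) and terms of positive
      valuation.\<close>
    have "x * poly (pderiv F) x = of_nat k * (x * x ^ (k - 1)) + of_nat ((k - 1) * m) * (x * x ^ (k - 2)) + x * B"
      unfolding der by (simp add: algebra_simps del: of_nat_mult of_nat_diff)
    also have "\<dots> = of_nat k * (of_nat 1 * x ^ k + of_nat m * x ^ (k - 1) + A) - of_nat m * x ^ (k - 1) + (x * B - of_nat k * A)"
      unfolding e1 e2 mm by (simp add: algebra_simps)
    also have "\<dots> = - (of_nat m * x ^ (k - 1)) + (x * B - of_nat k * A)" unfolding root by simp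
    finally have xF: "x * poly (pderiv F) x = - (of_nat m * x ^ (k - 1)) + (x * B - of_nat k * A)" .
    have vlead: "v (- (of_nat m * x ^ (k - 1))) = 0" using v_uminus[OF tL[OF x]] vt[OF mpos x] vx vm by simp
    have "gt 0 (x * B + of_nat k * (- A))"
    proof (rule gt_add)
      show "gt 0 (x * B)" using gt_mult_ge[OF BL xL(1)[OF x] gB, of 0] vx by (simp add: ge_def mult.commute)
      have "gt 0 (- A)" using gA v_uminus[OF AL] by (simp add: gt_def)
      moreover have "ge 0 (of_nat k)" using k3 v_nat_nonneg[of k] by (simp add: ge_def)
      ultimately show "gt 0 (of_nat k * (- A))"
        using gt_mult_ge[OF closed(5)[OF AL] closed_of_nat, of 0 0 k] by (simp add: mult.commute)
      show "x * B \<in> L" using xL(1)[OF x] BL by (rule closed(4))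
      show "of_nat k * (- A) \<in> L" using closed_of_nat closed(5)[OF AL] by (rule closed(4))
    qed
    then have gt: "gt (v (- (of_nat m * x ^ (k - 1)))) (x * B - of_nat k * A)" by (simp only: vlead) simp
    have lead0: "- (of_nat m * x ^ (k - 1)) \<noteq> 0" using mpos xL[OF x] by simp
    have restL: "x * B - of_nat k * A \<in> L" using xL[OF x] AL BL closed_of_nat by (intro closed(7) closed(4))
    from dominant[OF closed(5)[OF tL[OF x]] restL lead0 gt]
    have d: "x * poly (pderiv F) x \<noteq> 0" "v (x * poly (pderiv F) x) = 0" using vlead by (auto simp: xF)
    have FL: "poly (pderiv F) x \<in> L" unfolding poly_F' using tL[OF x] by (intro closed(10))
    show ?thesis using d v_mult[OF xL(1)[OF x] FL] xL[OF x] vx by auto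
  qed
  have vW: "v (poly (pderiv F) x) = (k - 2) * w" if xW: "x \<in> W" for x
  proof -
    have x: "x \<in> R" and vx: "v x = w" using xW by (auto simp: W_def)
    have v1: "v (of_nat ((k - 1) * ffact m 1) * x ^ (k - 1 - 1)) = (k - 2) * w"
      using vt[OF _ x, of "(k - 1) * m" "k - 1 - 1"] vn[of "k - 1" m] vk1 vm vx mpos k3
      by (simp add: f1[unfolded One_nat_def] numeral_2_eq_2 del: of_nat_mult of_nat_diff)
    have "v (\<Sum>i<k. of_nat ((k - i) * ffact m i) * x ^ (k - 1 - i)) = v (of_nat ((k - 1) * ffact m 1) * x ^ (k - 1 - 1))"
    proof (rule dominant_sum(2)[where i = 1])
      fix j assume j: "j \<in> {..<k}" "j \<noteq> 1"
      have jk: "k - j > 0" "ffact m j > 0" using j ffp[of j] by auto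
      have vj: "v (of_nat ((k - j) * ffact m j)) \<ge> v (of_nat (ffact m j))"
        using vn[OF jk] v_nat_nonneg[OF jk(1)] by simp
      have "(k - 2) * w < v (of_nat ((k - j) * ffact m j)) + (k - 1 - j) * w"
      proof (cases "j = 0")
        case True
        then have "v (of_nat ((k - j) * ffact m j)) \<ge> 0" using vj v_1 by (simp add: f0 del: of_nat_mult)
        moreover have "real (k - 1 - j) * w = 1" using True w(2) by (simp del: of_nat_diff)
        ultimately show ?thesis using w(3) by linarith
      next
        case False
        then have "v (of_nat (ffact m j)) \<ge> 1" using j by (intro vf) auto
        moreover have "0 \<le> real (k - 1 - j) * w" using w by simp
        ultimately show ?thesis using vj w by linarith
      qed
      then show "gt (v (of_nat ((k - 1) * ffact m 1) * x ^ (k - 1 - 1))) (of_nat ((k - j) * ffact m j) * x ^ (k - 1 - j))"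
        unfolding v1 using vt[OF _ x, of "(k - j) * ffact m j" "k - 1 - j"] jk vx by (simp add: gt_def del: of_nat_mult of_nat_diff)
    qed (use tL[OF x] k3 xL[OF x] f1 mpos in \<open>auto simp del: of_nat_mult of_nat_diff\<close>)
    then show ?thesis unfolding poly_F' v1 .
  qed
  have "(\<Sum>x\<in>R. v (poly (pderiv F) x)) = (\<Sum>x\<in>Z. v (poly (pderiv F) x)) + (\<Sum>x\<in>W. v (poly (pderiv F) x))"
    unfolding \<open>Z \<union> W = R\<close>[symmetric] using fin ZW by (rule sum.union_disjoint)
  also have "\<dots> = (k - 1) * ((k - 2) * w)" using vZ vW cW by simp
  also have "\<dots> = (k - 2) * ((k - 1) * w)" by (simp only: mult_ac)
  also have "\<dots> = k - 2" unfolding w(2) by simp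
  finally show ?thesis .
qed

text \<open>The discriminant has valuation k - 1 at \<open>p0\<close> and, for odd k, valuation k -
  2 at \<open>p1\<close>, so an odd valuation is available for either parity.\<close>

theorem full_symmetric:
  assumes p0: "prime p0" "p0 > k" "p0 dvd m" "\<not> p0\<^sup>2 dvd m"
    and p1: "prime p1" "p1 > k" "p1 dvd m - 1" "\<not> p1\<^sup>2 dvd m - 1"
    and q: "prime q" "k < 2 * q" "q + 3 \<le> k" and nd: "newton_data p r q"
  shows "galois_is_full_symmetric (trimmed_exp (m - k) m)"
proof -
  obtain v0 where v0: "padic_field L v0 p0" using ex_padic_field[OF p0(1)] by blast
  obtain v1 where v1: "padic_field L v1 p1" using ex_padic_field[OF p1(1)] by blast
  have "prime p" using nd by (simp add: newton_data_def)
  then obtain v where v: "padic_field L v p" using ex_padic_field by blast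
  note ei = eisenstein_roots[OF v0 p0(2-4)]
  have F: "F = (\<Prod>x\<in>R. [:- x, 1:])" and cR: "card R = k" using separable_if_simple ei(2) by auto
  interpret T: transitive_perm_group R "galois_group g"
    using transitive_if_uniform_valuation[OF v0 root_nonzero] ei(1) cR by simp
  note nr = newton_roots[OF nd v F cR]
  obtain \<sigma> where s: "\<sigma> \<in> galois_group g" "\<sigma> \<noteq> id" "\<sigma> ^^ q = id"
    using ex_element_of_prime_order[OF v root_nonzero q(1) nr(2,3)] by blast
  have pairs: "tr a b \<circ> tr c d \<in> galois_group g" if "a \<in> R" "b \<in> R" "c \<in> R" "d \<in> R" "a \<noteq> b" "c \<noteq> d" for a b c d
    using T.jordan_prime_cycle[OF q(1) _ _ s that] q cR by simp
  have "galois_group g = {p. p permutes R}"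
  proof (cases "even k")
    case True
    have "(\<Sum>x\<in>R. v0 (\<Prod>y\<in>R - {x}. x - y)) = (\<Sum>x\<in>R. (k - 1) / k)"
      using ei(2) by (intro sum.cong) (auto simp: prod_diff_roots[OF F])
    also have "\<dots> = real (k - 1)" using cR k2 by simp
    finally show ?thesis using full_if_odd_discriminant[OF v0 pairs, of "k - 1"] True k2 by auto
  next
    case False
    have "(\<Sum>x\<in>R. v1 (\<Prod>y\<in>R - {x}. x - y)) = (\<Sum>x\<in>R. v1 (poly (pderiv F) x))"
      by (intro sum.cong) (auto simp: prod_diff_roots[OF F])
    also have "\<dots> = real (k - 2)" using False k2
      by (intro discriminant_at_pred[OF v1 p1(2-4) _ F cR]) presburger
    finally show ?thesis using full_if_odd_discriminant[OF v1 pairs, of "k - 2"] False k2 by auto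
  qed
  then have "galois_is_full_symmetric g"
    using cR degree_g by (simp add: galois_is_full_symmetric_def R_def[symmetric])
  then show ?thesis by (simp add: g_def)
qed

end

section \<open>Lower bounds for the number of primes\<close>

lemma multiplicity_eq_card:
  assumes p: "prime (p::nat)" and m: "0 < m" "m < p ^ N"
  shows "multiplicity p m = card {i \<in> {1..N}. p ^ i dvd m}"
proof -
  have np: "\<not> is_unit p" using p by auto
  have iff: "p ^ i dvd m \<longleftrightarrow> i \<le> multiplicity p m" for i
    using power_dvd_iff_le_multiplicity[of m p i] m np by auto
  have "multiplicity p m < N"
  proof (rule ccontr)
    assume "\<not> ?thesis"
    then have "p ^ N dvd m" using iff by simp
    then show False using m dvd_imp_le[of "p ^ N" m] by simp
  qed
  then have "{i \<in> {1..N}. p ^ i dvd m} = {1..multiplicity p m}"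
    unfolding iff by auto
  then show ?thesis by simp
qed

text \<open>Legendre's formula, cut off at any N beyond which the quotients vanish.\<close>

lemma multiplicity_fact:
  assumes p: "prime (p::nat)"
  shows "n < p ^ N \<Longrightarrow> multiplicity p (fact n :: nat) = (\<Sum>i=1..N. n div p ^ i)"
proof (induction n)
  case (Suc n)
  have "multiplicity p (fact (Suc n) :: nat) = multiplicity p (Suc n) + multiplicity p (fact n :: nat)"
    using p by (simp add: prime_elem_multiplicity_mult_distrib del: mult_Suc)
  also have "multiplicity p (Suc n) = (\<Sum>i=1..N. if p ^ i dvd Suc n then 1 else 0)"
    using multiplicity_eq_card[OF p, of "Suc n" N] Suc.prems by (simp add: sum.If_cases Int_def)
  also have "multiplicity p (fact n :: nat) = (\<Sum>i=1..N. n div p ^ i)" using Suc by simp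
  also have "(\<Sum>i=1..N. if p ^ i dvd Suc n then 1 else 0) + (\<Sum>i=1..N. n div p ^ i) = (\<Sum>i=1..N. Suc n div p ^ i)"
    unfolding sum.distrib[symmetric] by (rule sum.cong) (auto simp: div_Suc dvd_eq_mod_eq_0)
  finally show ?case .
qed simp

lemma double_div:
  fixes n d :: nat assumes "d > 0"
  shows "(2 * n) div d = 2 * (n div d) \<or> (2 * n) div d = 2 * (n div d) + 1"
proof -
  define a where "a = n div d"
  define r where "r = n mod d"
  have n: "n = d * a + r" "r < d" using assms by (auto simp: a_def r_def)
  have "2 * n = d * (2 * a) + 2 * r" by (simp add: n algebra_simps)
  then have "(2 * n) div d = 2 * a + (2 * r) div d" using assms by simp
  moreover have "(2 * r) div d < 2" using n by (simp add: less_mult_imp_div_less)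
  ultimately show ?thesis unfolding a_def by linarith
qed

lemma multiplicity_central_binomial:
  assumes p: "prime (p::nat)" and N: "2 * n < p ^ N"
  shows "multiplicity p ((2 * n) choose n) = (\<Sum>i=1..N. (2 * n) div p ^ i - 2 * (n div p ^ i))"
proof -
  have "fact (2 * n) = fact n * fact n * ((2 * n) choose n :: nat)"
    using binomial_fact_lemma[of n "2 * n"] by simp
  moreover have "(2 * n choose n) > 0" by simp
  ultimately have "multiplicity p (fact (2 * n) :: nat) =
      2 * multiplicity p (fact n :: nat) + multiplicity p ((2 * n) choose n)"
    using p by (simp add: prime_elem_multiplicity_mult_distrib)
  moreover have "multiplicity p (fact (2 * n) :: nat) = (\<Sum>i=1..N. (2 * n) div p ^ i)"
    by (rule multiplicity_fact[OF p N])
  moreover have "multiplicity p (fact n :: nat) = (\<Sum>i=1..N. n div p ^ i)"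
    using N by (intro multiplicity_fact[OF p]) simp
  moreover have "(\<Sum>i=1..N. (2 * n) div p ^ i) = (\<Sum>i=1..N. 2 * (n div p ^ i)) + (\<Sum>i=1..N. (2 * n) div p ^ i - 2 * (n div p ^ i))"
    unfolding sum.distrib[symmetric]
  proof (rule sum.cong)
    fix i
    have "p ^ i > 0" using p by (simp add: prime_gt_0_nat)
    then show "(2 * n) div p ^ i = 2 * (n div p ^ i) + ((2 * n) div p ^ i - 2 * (n div p ^ i))"
      using double_div[of "p ^ i" n] by auto
  qed simp
  ultimately show ?thesis by (simp add: sum_distrib_left)
qed

text \<open>Each power of p up to 2n contributes 0 or 1 to the exponent, larger powers contribute
  nothing.\<close>

lemma prime_power_le_central_binomial:
  assumes p: "prime (p::nat)" and n: "n > 0"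
  shows "p ^ multiplicity p ((2 * n) choose n) \<le> 2 * n"
proof -
  define N where "N = 2 * n"
  have N: "2 * n < p ^ N" unfolding N_def using prime_ge_2_nat[OF p]
    by (metis less_exp less_le_trans power_mono zero_le)
  define v where "v = multiplicity p ((2 * n) choose n)"
  have "v = (\<Sum>i=1..N. (2 * n) div p ^ i - 2 * (n div p ^ i))"
    unfolding v_def by (rule multiplicity_central_binomial[OF p N])
  also have "\<dots> \<le> (\<Sum>i=1..N. if p ^ i \<le> 2 * n then 1 else 0)"
  proof (rule sum_mono)
    fix i
    have "p ^ i > 0" using p by (simp add: prime_gt_0_nat)
    then show "(2 * n) div p ^ i - 2 * (n div p ^ i) \<le> (if p ^ i \<le> 2 * n then 1 else 0)"
      using double_div[of "p ^ i" n] by auto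
  qed
  also have "\<dots> = card {i \<in> {1..N}. p ^ i \<le> 2 * n}" by (simp add: sum.If_cases Int_def)
  finally have v: "v \<le> card {i \<in> {1..N}. p ^ i \<le> 2 * n}" .
  have "p ^ v \<le> 2 * n"
  proof (rule ccontr)
    assume neg: "\<not> p ^ v \<le> 2 * n"
    then have v0: "v > 0" using n by (cases v) auto
    have "i < v" if "p ^ i \<le> 2 * n" for i
    proof (rule ccontr)
      assume "\<not> i < v"
      then have "p ^ v \<le> p ^ i" using prime_ge_1_nat[OF p] by (intro power_increasing) auto
      then show False using that neg by simp
    qed
    then have "{i \<in> {1..N}. p ^ i \<le> 2 * n} \<subseteq> {1..<v}" by auto
    then have "card {i \<in> {1..N}. p ^ i \<le> 2 * n} \<le> card {1..<v}" by (intro card_mono) auto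
    then show False using v v0 by simp
  qed
  then show ?thesis by (simp add: v_def)
qed

lemma multiplicity_le_1_central_binomial:
  assumes p: "prime (p::nat)" and n: "n > 0" "2 * n < p\<^sup>2"
  shows "multiplicity p ((2 * n) choose n) \<le> 1"
proof (rule ccontr)
  assume "\<not> ?thesis"
  then have "p\<^sup>2 \<le> p ^ multiplicity p ((2 * n) choose n)"
    using prime_ge_1_nat[OF p] by (intro power_increasing) auto
  then show False using prime_power_le_central_binomial[OF p n(1)] n(2) by simp
qed

text \<open>For 2n/3 < p <= n the numerator contains just p and 2p, which cancel against one factor
  p in each copy of n!. The bound n >= 3 gives p^2 > 2n.\<close>

lemma multiplicity_eq_0_central_binomial:
  assumes p: "prime (p::nat)" and n: "n \<ge> 3" "2 * n < 3 * p" "p \<le> n"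
  shows "multiplicity p ((2 * n) choose n) = 0"
proof -
  have p3: "p \<ge> 3" using n by linarith
  have "2 * n < p ^ 2" using mult_right_mono[OF p3, of p] n unfolding power2_eq_square by linarith
  then have "multiplicity p ((2 * n) choose n) = (\<Sum>i=1..2. (2 * n) div p ^ i - 2 * (n div p ^ i))"
    by (rule multiplicity_central_binomial[OF p])
  also have "{1..2::nat} = {1, 2}" by auto
  also have "(2 * n) div p = 2" using n p3 by (intro div_nat_eqI) auto
  moreover have "n div p = 1" using n p3 by (intro div_nat_eqI) auto
  ultimately show ?thesis using \<open>2 * n < p ^ 2\<close> by simp
qed

section \<open>The primorial bound\<close>

definition primes_upto :: "nat \<Rightarrow> nat set" where "primes_upto n = {p. prime p \<and> p \<le> n}"

lemma finite_primes_upto [simp]: "finite (primes_upto n)"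
  by (rule finite_subset[of _ "{..n}"]) (auto simp: primes_upto_def)

lemma prod_primes_dvd:
  fixes x :: nat
  assumes "finite B" "\<And>p. p \<in> B \<Longrightarrow> prime p" "\<And>p. p \<in> B \<Longrightarrow> p dvd x"
  shows "\<Prod>B dvd x"
  using assms
proof (induction B rule: finite_induct)
  case (insert p A)
  have "coprime p (\<Prod>A)"
    using insert by (intro prod_coprime_right) (metis insertCI primes_coprime)
  then show ?case using insert by (simp add: divides_mult)
qed simp

lemma odd_binomial_le: "(2 * m + 1) choose m \<le> 4 ^ m"
proof -
  have "2 * ((2 * m + 1) choose m) = ((2 * m + 1) choose m) + ((2 * m + 1) choose (m + 1))"
    using binomial_symmetric[of m "2 * m + 1"] by simp
  also have "\<dots> = (\<Sum>k\<in>{m, m + 1}. (2 * m + 1) choose k)" by simp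
  also have "\<dots> \<le> (\<Sum>k\<le>2 * m + 1. (2 * m + 1) choose k)" by (rule sum_mono2) auto
  also have "\<dots> = 2 ^ (2 * m + 1)" by (rule choose_row_sum)
  also have "\<dots> = 2 * 4 ^ m" by (simp add: power_mult)
  finally show ?thesis by simp
qed

text \<open>Induction by halving: the primes in (m + 1, 2m + 1] all divide the binomial coefficient
  of 2m + 1 over m, which is at most 4^m.\<close>

lemma primorial_le: "\<Prod>(primes_upto n) \<le> 4 ^ n"
proof (induction n rule: less_induct)
  case (less n)
  consider "n < 2" | "n = 2" | "n > 2" "even n" | "n > 2" "odd n" by linarith
  then show ?case
  proof cases
    case 1
    then have "primes_upto n = {}" by (auto simp: primes_upto_def dest!: prime_ge_2_nat)
    then show ?thesis by simp
  next
    case 2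
    have "primes_upto n = {2}" using 2 prime_ge_2_nat by (auto simp: primes_upto_def intro: antisym)
    then show ?thesis using 2 by simp
  next
    case 3
    have "\<not> prime n" using 3 by (metis prime_odd_nat)
    have "p \<le> n - 1" if "prime p" "p \<le> n" for p
      using that \<open>\<not> prime n\<close> by (cases "p = n") auto
    then have "primes_upto n = primes_upto (n - 1)" by (auto simp: primes_upto_def)
    then have "\<Prod>(primes_upto n) \<le> 4 ^ (n - 1)" using less[of "n - 1"] 3 by simp
    also have "\<dots> \<le> 4 ^ n" by (intro power_increasing) auto
    finally show ?thesis .
  next
    case 4
    then obtain m where m: "n = 2 * m + 1" by (auto elim: oddE)
    define B where "B = {p. prime p \<and> m + 1 < p \<and> p \<le> n}"
    have finB: "finite B" by (rule finite_subset[of _ "{..n}"]) (auto simp: B_def)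
    have "p dvd (2 * m + 1) choose m" if "p \<in> B" for p
    proof -
      have pr: "prime p" "m + 1 < p" "p \<le> 2 * m + 1" using that m by (auto simp: B_def)
      have "fact m * fact (m + 1) * ((2 * m + 1) choose m) = fact (2 * m + 1)"
        using binomial_fact_lemma[of m "2 * m + 1"] by simp
      moreover have "p dvd fact (2 * m + 1)" by (subst prime_dvd_fact_iff) (use pr in auto)
      ultimately have "p dvd fact m * fact (m + 1) * ((2 * m + 1) choose m)" by simp
      moreover have "\<not> p dvd fact m" "\<not> p dvd fact (m + 1)"
        by (subst prime_dvd_fact_iff; use pr in auto)+
      ultimately show ?thesis using pr(1) by (auto simp: prime_dvd_mult_iff simp del: fact_Suc)
    qed
    then have "\<Prod>B dvd (2 * m + 1) choose m"
      using finB by (intro prod_primes_dvd) (auto simp: B_def)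
    then have "\<Prod>B \<le> (2 * m + 1) choose m" by (rule dvd_imp_le) simp
    also have "\<dots> \<le> 4 ^ m" by (rule odd_binomial_le)
    finally have B: "\<Prod>B \<le> 4 ^ m" .
    have "primes_upto n = primes_upto (m + 1) \<union> B" using m by (auto simp: primes_upto_def B_def)
    moreover have "primes_upto (m + 1) \<inter> B = {}" by (auto simp: primes_upto_def B_def)
    ultimately have "\<Prod>(primes_upto n) = \<Prod>(primes_upto (m + 1)) * \<Prod>B"
      using finB by (simp add: prod.union_disjoint)
    also have "\<dots> \<le> 4 ^ (m + 1) * 4 ^ m" using less[of "m + 1"] B m 4 by (intro mult_mono) auto
    also have "\<dots> = 4 ^ n" by (simp add: m flip: power_add)
    finally show ?thesis .
  qed
qed

lemma prod_mono2_nat: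
  fixes f :: "'a \<Rightarrow> nat"
  assumes "finite B" "A \<subseteq> B" "\<And>b. b \<in> B - A \<Longrightarrow> 1 \<le> f b"
  shows "prod f A \<le> prod f B"
proof -
  have "prod f B = prod f (B - A) * prod f A" using assms(1,2) by (metis prod.subset_diff)
  moreover have "1 \<le> prod f (B - A)" using assms(3) by (intro prod_ge_1) auto
  ultimately show ?thesis by simp
qed

section \<open>Chebyshev's lower bound for primes in (n, 2n]\<close>

definition primes_between :: "nat \<Rightarrow> nat \<Rightarrow> nat set" where
  "primes_between a b = {p. prime p \<and> a < p \<and> p \<le> b}"

lemma finite_primes_between [simp]: "finite (primes_between a b)"
  by (rule finite_subset[of _ "{..b}"]) (auto simp: primes_between_def)

text \<open>The central binomial coefficient is at least 4^n / (2n). Its prime factors are split at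
  the square root of 2n, at 2n/3 and at n; \<open>s\<close> bounds the number of those in the first
  range.\<close>

lemma four_power_le:
  assumes n: "n \<ge> 3" and s: "2 * n < (s + 1)\<^sup>2"
  shows "4 ^ n \<le> (2 * n) ^ (s + 1 + card (primes_between n (2 * n))) * 4 ^ (2 * n div 3)"
proof -
  define C where "C = (2 * n) choose n"
  define f where "f p = p ^ multiplicity p C" for p
  have C0: "C > 0" by (simp add: C_def)
  define A1 where "A1 = {p. prime p \<and> p\<^sup>2 \<le> 2 * n}"
  define A2 where "A2 = {p. prime p \<and> 2 * n < p\<^sup>2 \<and> 3 * p \<le> 2 * n}"
  define A3 where "A3 = primes_between n (2 * n)"
  have fp: "f p \<le> 2 * n" if "prime p" for p
    unfolding f_def C_def using prime_power_le_central_binomial[OF that] n by simp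
  have A1s: "A1 \<subseteq> {1..s}"
  proof
    fix p assume p: "p \<in> A1"
    then have "p\<^sup>2 < (s + 1)\<^sup>2" using s by (auto simp: A1_def)
    then have "p < s + 1" by (rule power_less_imp_less_base) simp
    then show "p \<in> {1..s}" using p prime_ge_1_nat[of p] by (auto simp: A1_def)
  qed
  then have fin1: "finite A1" and c1: "card A1 \<le> s" using card_mono[OF _ A1s] finite_subset[OF A1s] by auto
  have A2s: "A2 \<subseteq> primes_upto (2 * n div 3)" by (auto simp: A2_def primes_upto_def)
  then have fin2: "finite A2" by (rule finite_subset) simp
  have "C = (\<Prod>p\<in>prime_factors C. f p)"
    using prime_factorization_nat[of C] C0 by (simp add: f_def)
  also have "\<dots> \<le> (\<Prod>p\<in>A1 \<union> A2 \<union> A3. f p)"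
  proof (rule prod_mono2_nat)
    show "finite (A1 \<union> A2 \<union> A3)" using fin1 fin2 by (simp add: A3_def)
    show "prime_factors C \<subseteq> A1 \<union> A2 \<union> A3"
    proof
      fix p assume p: "p \<in> prime_factors C"
      then have pr: "prime p" and m0: "multiplicity p C \<noteq> 0" by (auto simp: prime_factors_multiplicity)
      have "p ^ 1 \<le> f p" unfolding f_def using m0 prime_ge_1_nat[OF pr] by (intro power_increasing) auto
      then have p2n: "p \<le> 2 * n" using fp[OF pr] by simp
      show "p \<in> A1 \<union> A2 \<union> A3"
      proof (rule ccontr)
        assume np: "p \<notin> A1 \<union> A2 \<union> A3"
        then have "2 * n < 3 * p" "p \<le> n" using pr p2n by (auto simp: A1_def A2_def A3_def primes_between_def)
        then have "multiplicity p C = 0" unfolding C_def using multiplicity_eq_0_central_binomial[OF pr n] by simp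
        then show False using m0 by simp
      qed
    qed
    show "1 \<le> f b" if "b \<in> A1 \<union> A2 \<union> A3 - prime_factors C" for b
      using that prime_ge_1_nat by (auto simp: f_def A1_def A2_def A3_def primes_between_def)
  qed
  also have "\<dots> \<le> (\<Prod>p\<in>A1. f p) * (\<Prod>p\<in>A2. f p) * (\<Prod>p\<in>A3. f p)"
  proof -
    have d: "(A1 \<union> A2) \<inter> A3 = {}" "A1 \<inter> A2 = {}"
    proof -
      have "\<not> n < p" if "p\<^sup>2 \<le> 2 * n" for p
      proof
        assume "n < p"
        then have "n * 3 < p * p" using n by (intro mult_less_le_imp_less) auto
        then show False using that n by (simp add: power2_eq_square)
      qed
      then show "(A1 \<union> A2) \<inter> A3 = {}" "A1 \<inter> A2 = {}" by (auto simp: A1_def A2_def A3_def primes_between_def)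
    qed
    show ?thesis using d fin1 fin2 by (simp add: prod.union_disjoint A3_def)
  qed
  also have "\<dots> \<le> (2 * n) ^ s * 4 ^ (2 * n div 3) * (2 * n) ^ card A3"
  proof (intro mult_mono)
    have "(\<Prod>p\<in>A1. f p) \<le> (\<Prod>p\<in>A1. 2 * n)" using fp by (intro prod_mono) (auto simp: A1_def)
    also have "\<dots> = (2 * n) ^ card A1" by simp
    also have "\<dots> \<le> (2 * n) ^ s" using c1 n by (intro power_increasing) auto
    finally show "(\<Prod>p\<in>A1. f p) \<le> (2 * n) ^ s" .
    have "(\<Prod>p\<in>A2. f p) \<le> (\<Prod>p\<in>A2. p)"
    proof (rule prod_mono)
      fix p assume p: "p \<in> A2"
      then have "f p \<le> p ^ 1" unfolding f_def C_def using n
        by (intro power_increasing multiplicity_le_1_central_binomial) (auto simp: A2_def Suc_le_eq prime_gt_0_nat)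
      then show "0 \<le> f p \<and> f p \<le> p" by simp
    qed
    also have "\<dots> \<le> \<Prod>(primes_upto (2 * n div 3))"
      using A2s by (intro prod_mono2_nat) (auto simp: primes_upto_def Suc_le_eq prime_gt_0_nat)
    also have "\<dots> \<le> 4 ^ (2 * n div 3)" by (rule primorial_le)
    finally show "(\<Prod>p\<in>A2. f p) \<le> 4 ^ (2 * n div 3)" .
    have "(\<Prod>p\<in>A3. f p) \<le> (\<Prod>p\<in>A3. 2 * n)" using fp by (intro prod_mono) (auto simp: A3_def primes_between_def)
    then show "(\<Prod>p\<in>A3. f p) \<le> (2 * n) ^ card A3" by simp
  qed auto
  finally have C: "C \<le> (2 * n) ^ s * 4 ^ (2 * n div 3) * (2 * n) ^ card A3" .
  have "4 ^ n \<le> (2 * n choose n) * (2 * n)"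
  proof -
    have "real (4 ^ n) \<le> real ((2 * n choose n) * (2 * n))"
      using central_binomial_lower_bound[of n] n by (simp add: field_simps)
    then show ?thesis by (simp only: of_nat_le_iff)
  qed
  also have "\<dots> \<le> ((2 * n) ^ s * 4 ^ (2 * n div 3) * (2 * n) ^ card A3) * (2 * n)"
    using C by (simp add: C_def)
  also have "\<dots> = (2 * n) ^ (s + 1 + card A3) * 4 ^ (2 * n div 3)"
    by (simp add: power_add mult_ac)
  finally show ?thesis by (simp add: A3_def)
qed

lemma twentyfour_le_two_power: "8 \<le> j \<Longrightarrow> 24 * (j + 1) \<le> 2 ^ j"
proof (induction j rule: dec_induct)
  case (step j) then show ?case by simp
qed simp

text \<open>Powers of 4 act as integer logarithms: 2n < 2^(2j+2), and the square root of 2n is below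
  2^(j+1). Comparing exponents of 2 turns \<open>four_power_le\<close> into a linear inequality for
  the number of primes.\<close>

lemma four_power_le_card_primes_between:
  assumes j: "j \<ge> 2" and n: "4 ^ j \<le> 2 * n" "2 * n < 4 ^ (j + 1)"
  shows "4 ^ j \<le> 6 * (j + 1) * 2 ^ (j + 1) + 6 * (j + 1) * card (primes_between n (2 * n))"
proof -
  define D where "D = card (primes_between n (2 * n))"
  define s where "s = 2 ^ (j + 1) - (1::nat)"
  have s1: "s + 1 = 2 ^ (j + 1)" by (simp add: s_def)
  have "(4::nat) ^ 2 \<le> 4 ^ j" using j by (intro power_increasing) auto
  then have n3: "n \<ge> 3" using n by simp
  have "(s + 1)\<^sup>2 = 4 ^ (j + 1)" unfolding s1 by (simp add: power2_eq_square power_mult_distrib[symmetric])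
  then have "4 ^ n \<le> (2 * n) ^ (s + 1 + D) * 4 ^ (2 * n div 3)"
    unfolding D_def using four_power_le[OF n3, of s] n by simp
  also have "\<dots> \<le> (2 ^ (2 * j + 2)) ^ (s + 1 + D) * 4 ^ (2 * n div 3)"
  proof -
    have "2 * n \<le> 2 ^ (2 * j + 2)" using n(2) by (simp add: power_mult power_add)
    then show ?thesis by (intro mult_mono power_mono) auto
  qed
  finally have "4 ^ (2 * n div 3) * 4 ^ (n - 2 * n div 3) \<le> (4::nat) ^ (2 * n div 3) * (2 ^ (2 * j + 2)) ^ (s + 1 + D)"
    unfolding power_add[symmetric] mult.commute[of "4 ^ (2 * n div 3)"] by simp
  then have "(4::nat) ^ (n - 2 * n div 3) \<le> (2 ^ (2 * j + 2)) ^ (s + 1 + D)" by simp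
  then have "(2::nat) ^ (2 * (n - 2 * n div 3)) \<le> 2 ^ ((2 * j + 2) * (s + 1 + D))"
    by (simp only: power_mult) simp
  then have le: "2 * (n - 2 * n div 3) \<le> (2 * j + 2) * (s + 1 + D)" by (simp only: power_increasing_iff)
  have "4 ^ j \<le> 2 * n" by (rule n)
  also have "\<dots> \<le> 3 * (2 * (n - 2 * n div 3))" by linarith
  also have "\<dots> \<le> 3 * ((2 * j + 2) * (s + 1 + D))" using le by (rule mult_le_mono2)
  also have "\<dots> = 6 * (j + 1) * 2 ^ (j + 1) + 6 * (j + 1) * D" unfolding s1 by (simp add: algebra_simps)
  finally show ?thesis by (simp only: D_def)
qed

text \<open>From j = 8 on the error term is at most half of 4^j.\<close>

theorem card_primes_between_ge:
  assumes j: "j \<ge> 8" and n: "4 ^ j \<le> 2 * n" "2 * n < 4 ^ (j + 1)"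
  shows "4 ^ j \<le> 12 * (j + 1) * card (primes_between n (2 * n))"
proof -
  have "2 * (6 * (j + 1) * 2 ^ (j + 1)) = 24 * (j + 1) * 2 ^ j" by simp
  also have "\<dots> \<le> 2 ^ j * 2 ^ j" using twentyfour_le_two_power[OF j] by (rule mult_le_mono1)
  also have "\<dots> = 4 ^ j" by (simp flip: power_mult_distrib)
  finally have "2 * (6 * (j + 1) * 2 ^ (j + 1)) \<le> 4 ^ j" .
  moreover have "4 ^ j \<le> 6 * (j + 1) * 2 ^ (j + 1) + 6 * (j + 1) * card (primes_between n (2 * n))"
    using j by (intro four_power_le_card_primes_between n) simp
  ultimately show ?thesis by linarith
qed

section \<open>A prime q with k/2 < q <= k - 3\<close>

lemma prime_if_no_small_divisor:
  fixes p :: nat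
  assumes "1 < p" "p < b * b" "\<forall>d\<in>set [2..<b]. p mod d \<noteq> 0"
  shows "prime p"
proof (rule ccontr)
  assume "\<not> prime p"
  then obtain d where d: "d dvd p" "d \<noteq> 1" "d \<noteq> p" using assms(1) by (auto simp: prime_nat_iff)
  obtain e where e: "p = d * e" using d by (auto elim: dvdE)
  have small: "False" if f: "f dvd p" "f \<noteq> 1" "f * f \<le> p" for f
  proof -
    have "f < b"
    proof (rule ccontr)
      assume "\<not> f < b"
      then have "b * b \<le> f * f" by (intro mult_le_mono) auto
      then show False using f assms by simp
    qed
    moreover have "f \<noteq> 0" using f(1) assms(1) by (cases "f = 0") auto
    moreover have "f \<ge> 2" using f(2) \<open>f \<noteq> 0\<close> by linarith
    ultimately have "f \<in> set [2..<b]" by simp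
    then have "p mod f \<noteq> 0" using assms(3) by blast
    then show False using f(1) by (simp add: dvd_eq_mod_eq_0)
  qed
  have "d * d \<le> p \<or> e * e \<le> p"
    unfolding e by (metis mult_le_mono1 mult_le_mono2 nat_le_linear)
  moreover have "e dvd p" "e \<noteq> 1" using d e by auto
  ultimately show False using small d by blast
qed

text \<open>Since k - 2, k - 1 and k are forbidden, Bertrand's postulate alone is too weak; four
  primes in the upper half are produced so that one remains.\<close>

lemma ex_prime_in_upper_half:
  fixes k :: nat
  assumes "k \<ge> 8" shows "\<exists>q. prime q \<and> k < 2 * q \<and> q + 3 \<le> k"
proof (cases "k < 28066")
  case True
  show ?thesis
  proof (rule ccontr)
    assume neg: "\<not> ?thesis"
    \<comment> \<open>Each prime q of the chain pushes a counterexample up to at least 2q, and the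
      next prime is at most 2q - 3. The chain runs until it has passed 4^7 = 16384, where the
      general estimate starts to apply.\<close>
    have step: "2 * q \<le> k" if "prime q" "q + 3 \<le> k" for q
      using neg that not_le by blast
    have "prime (5::nat)" by (rule prime_if_no_small_divisor[where b = 3]) (simp_all add: upt_rec_numeral)
    from step[OF this] assms have k0: "10 \<le> k" by simp
    have "prime (7::nat)" by (rule prime_if_no_small_divisor[where b = 4]) (simp_all add: upt_rec_numeral)
    from step[OF this] k0 have k1: "14 \<le> k" by simp
    have "prime (11::nat)" by (rule prime_if_no_small_divisor[where b = 4]) (simp_all add: upt_rec_numeral)
    from step[OF this] k1 have k2: "22 \<le> k" by simp
    have "prime (19::nat)" by (rule prime_if_no_small_divisor[where b = 5]) (simp_all add: upt_rec_numeral)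
    from step[OF this] k2 have k3: "38 \<le> k" by simp
    have "prime (31::nat)" by (rule prime_if_no_small_divisor[where b = 6]) (simp_all add: upt_rec_numeral)
    from step[OF this] k3 have k4: "62 \<le> k" by simp
    have "prime (59::nat)" by (rule prime_if_no_small_divisor[where b = 8]) (simp_all add: upt_rec_numeral)
    from step[OF this] k4 have k5: "118 \<le> k" by simp
    have "prime (113::nat)" by (rule prime_if_no_small_divisor[where b = 11]) (simp_all add: upt_rec_numeral)
    from step[OF this] k5 have k6: "226 \<le> k" by simp
    have "prime (223::nat)" by (rule prime_if_no_small_divisor[where b = 15]) (simp_all add: upt_rec_numeral)
    from step[OF this] k6 have k7: "446 \<le> k" by simp
    have "prime (443::nat)" by (rule prime_if_no_small_divisor[where b = 22]) (simp_all add: upt_rec_numeral)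
    from step[OF this] k7 have k8: "886 \<le> k" by simp
    have "prime (883::nat)" by (rule prime_if_no_small_divisor[where b = 30]) (simp_all add: upt_rec_numeral)
    from step[OF this] k8 have k9: "1766 \<le> k" by simp
    have "prime (1759::nat)" by (rule prime_if_no_small_divisor[where b = 42]) (simp_all add: upt_rec_numeral)
    from step[OF this] k9 have k10: "3518 \<le> k" by simp
    have "prime (3511::nat)" by (rule prime_if_no_small_divisor[where b = 60]) (simp_all add: upt_rec_numeral)
    from step[OF this] k10 have k11: "7022 \<le> k" by simp
    have "prime (7019::nat)" by (rule prime_if_no_small_divisor[where b = 84]) (simp_all add: upt_rec_numeral)
    from step[OF this] k11 have k12: "14038 \<le> k" by simp
    have "prime (14033::nat)" by (rule prime_if_no_small_divisor[where b = 119]) (simp_all add: upt_rec_numeral)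
    from step[OF this] k12 have k13: "28066 \<le> k" by simp
    show False using k13 True by simp
  qed
next
  case False
  define n where "n = k div 2"
  have n: "2 * n \<ge> 16384" "2 * n \<le> k" "k \<le> 2 * n + 1" using False by (auto simp: n_def)
  obtain j where j: "4 ^ j \<le> 2 * n" "2 * n < 4 ^ (j + 1)"
    using ex_power_ivl1[of 4 "2 * n"] n by auto
  have j7: "j \<ge> 7"
  proof (rule ccontr)
    assume "\<not> j \<ge> 7"
    then have "(4::nat) ^ (j + 1) \<le> 4 ^ 7" by (intro power_increasing) auto
    then show False using j n by simp
  qed
  define P where "P = primes_between n (2 * n)"
  \<comment> \<open>At j = 7 the error term still exceeds half of 4^j, but the inequality with
    explicit error leaves far more than four primes.\<close>
  have "4 \<le> card P"
  proof (cases "j = 7")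
    case True
    then show ?thesis using four_power_le_card_primes_between[OF _ j] by (simp add: P_def)
  next
    case False
    then have j8: "j \<ge> 8" using j7 by simp
    have "12 * (j + 1) * 4 \<le> 2 * 2 ^ j" using twentyfour_le_two_power[OF j8] by simp
    also have "\<dots> \<le> 2 ^ j * 2 ^ j" using j8 power_increasing[of 1 j "2::nat"] by simp
    also have "\<dots> = 4 ^ j" by (simp flip: power_mult_distrib)
    also have "\<dots> \<le> 12 * (j + 1) * card P" unfolding P_def by (rule card_primes_between_ge[OF j8 j])
    finally show ?thesis by (rule mult_left_le_imp_le) simp
  qed
  moreover have "card {k - 2, k - 1, k} \<le> 3" by (simp add: card_insert_if)
  ultimately have "\<not> P \<subseteq> {k - 2, k - 1, k}" using card_mono[of "{k - 2, k - 1, k}" P] by auto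
  then obtain q where "q \<in> P" "q \<noteq> k - 2" "q \<noteq> k - 1" "q \<noteq> k" by blast
  then have "prime q \<and> k < 2 * q \<and> q + 3 \<le> k" using n by (auto simp: P_def primes_between_def)
  then show ?thesis by blast
qed

text \<open>The upper half of each interval (4^j, 4^(j+1)] contains at least 4^(j+1) / (12 (j + 2))
  primes, so it contributes at least 1 / (12 (j + 2)). The logarithm is a lower bound for the
  resulting harmonic sum.\<close>

lemma sum_inverse_primes_ge:
  assumes J: "8 \<le> J" "J \<le> J'"
  shows "(\<Sum>p\<in>primes_between (4 ^ J) (4 ^ J'). 1 / real p) \<ge> ln (real (J' + 2) / real (J + 2)) / 12"
  using J(2)
proof (induction J' rule: dec_induct)
  case base
  then show ?case by (simp add: sum_nonneg)
next
  case (step j)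
  define B where "B = primes_between (2 * 4 ^ j) (4 ^ (j + 1))"
  define A where "A = primes_between (4 ^ J) (4 ^ j)"
  have AB: "A \<inter> B = {}" by (auto simp: A_def B_def primes_between_def)
  have JJ: "(4::nat) ^ J \<le> 4 ^ j" using step by (intro power_increasing) auto
  then have sub: "A \<union> B \<subseteq> primes_between (4 ^ J) (4 ^ (Suc j))"
  proof (intro Un_least subsetI)
    fix p assume p: "p \<in> B"
    then have "2 * 4 ^ j < p" by (simp add: B_def primes_between_def)
    then have "4 ^ J < p" using JJ by linarith
    then show "p \<in> primes_between (4 ^ J) (4 ^ Suc j)" using p by (simp add: B_def primes_between_def)
  qed (auto simp: A_def primes_between_def)
  have D: "4 ^ (j + 1) \<le> 12 * (j + 2) * card B"
    using card_primes_between_ge[of "j + 1" "2 * 4 ^ j"] J step by (simp add: B_def)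
  have "ln (real (Suc j + 2) / real (j + 2)) \<le> 1 / real (j + 2)"
  proof -
    have "real (Suc j + 2) / real (j + 2) = 1 + 1 / real (j + 2)" by (simp add: field_simps)
    then show ?thesis using ln_add_one_self_le_self[of "1 / real (j + 2)"] by simp
  qed
  also have "\<dots> / 12 \<le> card B / 4 ^ (j + 1)"
  proof -
    have "real (4 ^ (j + 1)) \<le> real (12 * (j + 2) * card B)" using D by (simp only: of_nat_le_iff)
    then show ?thesis by (simp add: field_simps)
  qed
  finally have "ln (real (Suc j + 2) / real (j + 2)) / 12 \<le> card B / 4 ^ (j + 1)" by simp
  also have "\<dots> = (\<Sum>p\<in>B. 1 / 4 ^ (j + 1))" by simp
  also have "\<dots> \<le> (\<Sum>p\<in>B. 1 / real p)"
  proof (rule sum_mono)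
    fix p assume "p \<in> B"
    then have "p \<le> 4 ^ (j + 1)" "p > 0" by (auto simp: B_def primes_between_def)
    then have "real p \<le> real (4 ^ (j + 1))" "real p > 0" by (simp_all only: of_nat_le_iff of_nat_0_less_iff)
    then show "1 / 4 ^ (j + 1) \<le> 1 / real p" by (simp add: frac_le)
  qed
  finally have B: "ln (real (Suc j + 2) / real (j + 2)) / 12 \<le> (\<Sum>p\<in>B. 1 / real p)" .
  have "ln (real (Suc j + 2) / real (J + 2)) = ln (real (j + 2) / real (J + 2)) + ln (real (Suc j + 2) / real (j + 2))"
    by (simp add: ln_div)
  then have "ln (real (Suc j + 2) / real (J + 2)) / 12 \<le> (\<Sum>p\<in>A. 1 / real p) + (\<Sum>p\<in>B. 1 / real p)"
    using step.IH B by (simp add: A_def)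
  also have "\<dots> = (\<Sum>p\<in>A \<union> B. 1 / real p)" using AB by (simp add: sum.union_disjoint A_def B_def)
  also have "\<dots> \<le> (\<Sum>p\<in>primes_between (4 ^ J) (4 ^ Suc j). 1 / real p)"
    using sub by (intro sum_mono2) auto
  finally show ?case .
qed

section \<open>A second moment bound for residue classes\<close>

lemma card_residue_class_le:
  fixes M :: nat assumes "M > 0"
  shows "real (card {m \<in> {1..x}. m mod M = r}) \<le> real x / real M + 1"
proof -
  have "card {m \<in> {1..x}. m mod M = r} \<le> card {..x div M}"
  proof (rule card_inj_on_le)
    show "inj_on (\<lambda>m. m div M) {m \<in> {1..x}. m mod M = r}"
      by (rule inj_onI) (metis (mono_tags, lifting) div_mult_mod_eq mem_Collect_eq)
    show "(\<lambda>m. m div M) ` {m \<in> {1..x}. m mod M = r} \<subseteq> {..x div M}" by (auto intro: div_le_mono)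
  qed simp
  also have "\<dots> = x div M + 1" by simp
  finally have "real (card {m \<in> {1..x}. m mod M = r}) \<le> real (x div M) + 1" by simp
  then show ?thesis using of_nat_div_le_of_nat[of x M, where 'a = real] by linarith
qed

lemma card_residue_class_ge:
  fixes M :: nat assumes M: "M > 0" and r: "r < M"
  shows "real (card {m \<in> {1..x}. m mod M = r}) \<ge> real x / real M - 1"
proof -
  \<comment> \<open>The range starts at 1, so for residue 0 the representatives are shifted by one
    period.\<close>
  define h where "h i = (if r = 0 then M * (i + 1) else M * i + r)" for i
  have "card {..<x div M} \<le> card {m \<in> {1..x}. m mod M = r}"
  proof (rule card_inj_on_le)
    show "inj_on h {..<x div M}" using M by (auto simp: inj_on_def h_def)
    show "h ` {..<x div M} \<subseteq> {m \<in> {1..x}. m mod M = r}"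
    proof
      fix m assume "m \<in> h ` {..<x div M}"
      then obtain i where i: "i < x div M" "m = h i" by auto
      have "M * (i + 1) \<le> M * (x div M)" using i by (intro mult_le_mono2) simp
      also have "\<dots> \<le> x" by simp
      finally have "M * i + M \<le> x" by simp
      then show "m \<in> {m \<in> {1..x}. m mod M = r}" using i r M by (auto simp: h_def)
    qed
  qed simp
  then have "real (x div M) \<le> real (card {m \<in> {1..x}. m mod M = r})" by simp
  moreover have "real x / real M < real (x div M) + 1"
  proof -
    have "x < M * (x div M + 1)" using M by (simp add: dividend_less_times_div)
    then have "real x < real M * (real (x div M) + 1)" by (metis of_nat_1 of_nat_add of_nat_less_iff of_nat_mult)
    then show ?thesis using M by (simp add: field_simps)
  qed
  ultimately show ?thesis by linarith
qed

lemma card_residue_set: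
  fixes M :: nat assumes M: "M > 0" and S: "S \<subseteq> {..<M}"
  shows "\<bar>real (card {m \<in> {1..x}. m mod M \<in> S}) - real x * (card S / real M)\<bar> \<le> card S"
proof -
  have finS: "finite S" using S finite_subset by blast
  have "{m \<in> {1..x}. m mod M \<in> S} = (\<Union>r\<in>S. {m \<in> {1..x}. m mod M = r})" by auto
  also have "card \<dots> = (\<Sum>r\<in>S. card {m \<in> {1..x}. m mod M = r})"
    using finS by (intro card_UN_disjoint) auto
  finally have eq: "real (card {m \<in> {1..x}. m mod M \<in> S}) = (\<Sum>r\<in>S. real (card {m \<in> {1..x}. m mod M = r}))" by simp
  have "real (card {m \<in> {1..x}. m mod M \<in> S}) - real x * (card S / real M) =
    (\<Sum>r\<in>S. real (card {m \<in> {1..x}. m mod M = r}) - real x / real M)"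
    unfolding eq by (simp add: sum_subtractf)
  also have "\<bar>\<dots>\<bar> \<le> (\<Sum>r\<in>S. \<bar>real (card {m \<in> {1..x}. m mod M = r}) - real x / real M\<bar>)" by (rule sum_abs)
  also have "\<dots> \<le> (\<Sum>r\<in>S. 1)"
  proof (rule sum_mono)
    fix r assume "r \<in> S"
    then have "r < M" using S by auto
    then show "\<bar>real (card {m \<in> {1..x}. m mod M = r}) - real x / real M\<bar> \<le> 1"
      using card_residue_class_le[OF M, of x r] card_residue_class_ge[OF M, of r x] by linarith
  qed
  finally show ?thesis by simp
qed

text \<open>By the Chinese remainder theorem each pair of classes lies within a single class modulo
  M * N.\<close>

lemma card_two_residue_sets:
  fixes M N :: nat assumes M: "M > 0" "N > 0" "coprime M N" and S: "S \<subseteq> {..<M}" "T \<subseteq> {..<N}"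
  shows "real (card {m \<in> {1..x}. m mod M \<in> S \<and> m mod N \<in> T}) \<le>
    real x * (card S / M) * (card T / N) + real (card S) * real (card T)"
proof -
  have fin: "finite S" "finite T" using S finite_subset by blast+
  have one: "real (card {m \<in> {1..x}. m mod M = r \<and> m mod N = s}) \<le> real x / (M * N) + 1" for r s
  proof (cases "{m \<in> {1..x}. m mod M = r \<and> m mod N = s} = {}")
    case False
    then obtain c where c: "c mod M = r" "c mod N = s" by auto
    have "m mod (M * N) = c mod (M * N)" if m: "m mod M = r" "m mod N = s" for m
    proof -
      have "int m mod int M = int c mod int M" "int m mod int N = int c mod int N"
        using m c by (simp_all flip: of_nat_mod)
      then have "int M dvd int m - int c" "int N dvd int m - int c" by (simp_all add: mod_eq_dvd_iff)
      moreover have "coprime (int M) (int N)" using M by simp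
      ultimately have "int M * int N dvd int m - int c" by (rule divides_mult)
      then have "int m mod int (M * N) = int c mod int (M * N)" by (simp add: mod_eq_dvd_iff)
      then show ?thesis by (simp flip: of_nat_mod add: of_nat_eq_iff del: of_nat_mult)
    qed
    then have "{m \<in> {1..x}. m mod M = r \<and> m mod N = s} \<subseteq> {m \<in> {1..x}. m mod (M * N) = c mod (M * N)}" by auto
    then have "card {m \<in> {1..x}. m mod M = r \<and> m mod N = s} \<le> card {m \<in> {1..x}. m mod (M * N) = c mod (M * N)}"
      by (intro card_mono) auto
    also have "real (card {m \<in> {1..x}. m mod (M * N) = c mod (M * N)}) \<le> real x / real (M * N) + 1"
      using M by (intro card_residue_class_le) simp
    finally show ?thesis by simp
  next
    case True
    show ?thesis unfolding True by simp
  qed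
  have "{m \<in> {1..x}. m mod M \<in> S \<and> m mod N \<in> T} = (\<Union>z\<in>S \<times> T. {m \<in> {1..x}. m mod M = fst z \<and> m mod N = snd z})" by auto
  also have "card \<dots> \<le> (\<Sum>z\<in>S \<times> T. card {m \<in> {1..x}. m mod M = fst z \<and> m mod N = snd z})"
    using fin by (intro card_UN_le) simp
  finally have "real (card {m \<in> {1..x}. m mod M \<in> S \<and> m mod N \<in> T}) \<le>
    (\<Sum>z\<in>S \<times> T. real (card {m \<in> {1..x}. m mod M = fst z \<and> m mod N = snd z}))"
    by (simp flip: of_nat_sum)
  also have "\<dots> \<le> (\<Sum>z\<in>S \<times> T. real x / (M * N) + 1)" using one by (intro sum_mono)
  also have "\<dots> = real x * (card S / M) * (card T / N) + real (card S) * real (card T)"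
    using M by (simp add: card_cartesian_product field_simps)
  finally show ?thesis .
qed

text \<open>Turan's method. \<open>X m\<close> counts the q whose condition holds at m. Conditions
  for distinct primes are nearly independent, so the variance is about \<mu>, while an m satisfying
  none deviates from the mean by \<mu>; Chebyshev's inequality gives x/\<mu>.\<close>

theorem second_moment_bound:
  fixes Q :: "nat set" and S :: "nat \<Rightarrow> nat set" and x z :: nat
  defines "\<mu> \<equiv> (\<Sum>q\<in>Q. card (S q) / (real q)\<^sup>2)"
  assumes Q: "\<And>q. q \<in> Q \<Longrightarrow> prime q \<and> q \<le> z" and S: "\<And>q. q \<in> Q \<Longrightarrow> S q \<subseteq> {..<q\<^sup>2}" and \<mu>: "\<mu> > 0"
  shows "real (card {m \<in> {1..x}. \<forall>q\<in>Q. m mod q\<^sup>2 \<notin> S q}) \<le> x / \<mu> + 4 * real z ^ 6 / \<mu>\<^sup>2"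
proof -
  have Qs: "Q \<subseteq> {1..z}" using Q by (auto simp: Suc_le_eq prime_gt_0_nat)
  then have finQ: "finite Q" using finite_subset by blast
  define n where "n = card Q"
  have nz: "real n \<le> z" using card_mono[OF _ Qs] by (simp add: n_def)
  have "Q \<noteq> {}" using \<mu> by (auto simp: \<mu>_def)
  then have z1: "real z \<ge> 1" using Qs by force
  define \<rho> where "\<rho> q = card (S q) / (real q)\<^sup>2" for q
  have \<rho>: "0 \<le> \<rho> q" "\<rho> q \<le> 1" "real (card (S q)) \<le> real z ^ 2" if q: "q \<in> Q" for q
  proof -
    have c: "card (S q) \<le> q\<^sup>2" using card_mono[OF _ S[OF q]] by simp
    then have c': "real (card (S q)) \<le> (real q)\<^sup>2" by (metis of_nat_le_iff of_nat_power)
    have "q > 0" using Q[OF q] by (simp add: prime_gt_0_nat)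
    then show "0 \<le> \<rho> q" "\<rho> q \<le> 1" using c' by (auto simp: \<rho>_def)
    have "(real q)\<^sup>2 \<le> real z ^ 2" using Q[OF q] by (intro power_mono) auto
    then show "real (card (S q)) \<le> real z ^ 2" using c' by linarith
  qed
  have \<mu>': "\<mu> = sum \<rho> Q" by (simp add: \<mu>_def \<rho>_def)
  have "\<mu> \<le> (\<Sum>q\<in>Q. 1)" unfolding \<mu>' using \<rho> by (intro sum_mono) auto
  then have \<mu>z: "\<mu> \<le> z" using nz by (simp add: n_def)
  define e where "e q m = (if m mod q\<^sup>2 \<in> S q then 1 else 0 :: real)" for q m
  define X where "X m = (\<Sum>q\<in>Q. e q m)" for m
  define B where "B = {m \<in> {1..x}. \<forall>q\<in>Q. m mod q\<^sup>2 \<notin> S q}"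
  have Ne: "(\<Sum>m=1..x. e q m) = card {m \<in> {1..x}. m mod q\<^sup>2 \<in> S q}" for q
    by (simp add: e_def sum.If_cases Int_def)
  have N: "\<bar>(\<Sum>m=1..x. e q m) - x * \<rho> q\<bar> \<le> real z ^ 2" if q: "q \<in> Q" for q
  proof -
    have "q\<^sup>2 > 0" using Q[OF q] by (simp add: prime_gt_0_nat)
    from card_residue_set[OF this S[OF q], of x]
    have "\<bar>(\<Sum>m=1..x. e q m) - x * \<rho> q\<bar> \<le> real (card (S q))"
      unfolding Ne \<rho>_def by simp
    then show ?thesis using \<rho>(3)[OF q] by linarith
  qed
  have N2: "(\<Sum>m=1..x. e q m * e r m) \<le> x * (\<rho> q * \<rho> r) + real z ^ 4" if qr: "q \<in> Q" "r \<in> Q" "q \<noteq> r" for q r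
  proof -
    have pos: "q\<^sup>2 > 0" "r\<^sup>2 > 0" using Q[OF qr(1)] Q[OF qr(2)] by (simp_all add: prime_gt_0_nat)
    have "coprime q r" using Q qr primes_coprime by blast
    then have cop: "coprime (q\<^sup>2) (r\<^sup>2)" by simp
    have "(\<Sum>m=1..x. e q m * e r m) = (\<Sum>m=1..x. if m mod q\<^sup>2 \<in> S q \<and> m mod r\<^sup>2 \<in> S r then 1 else 0)"
      by (rule sum.cong) (auto simp: e_def)
    also have "\<dots> = card {m \<in> {1..x}. m mod q\<^sup>2 \<in> S q \<and> m mod r\<^sup>2 \<in> S r}" by (simp add: sum.If_cases Int_def)
    also have "\<dots> \<le> real x * (card (S q) / real (q\<^sup>2)) * (card (S r) / real (r\<^sup>2)) + real (card (S q)) * real (card (S r))"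
      by (rule card_two_residue_sets[OF pos cop S[OF qr(1)] S[OF qr(2)]])
    also have "real (card (S q)) * real (card (S r)) \<le> real z ^ 2 * real z ^ 2"
      using \<rho>(3) qr by (intro mult_mono) auto
    also have "\<dots> = real z ^ 4" by (simp flip: power_add)
    finally show ?thesis by (simp add: \<rho>_def mult.assoc)
  qed
  have S1: "(\<Sum>m=1..x. X m) = (\<Sum>q\<in>Q. \<Sum>m=1..x. e q m)" unfolding X_def by (rule sum.swap)
  have S1u: "(\<Sum>m=1..x. X m) \<le> x * \<mu> + n * real z ^ 2"
  proof -
    have "(\<Sum>m=1..x. X m) \<le> (\<Sum>q\<in>Q. x * \<rho> q + real z ^ 2)" unfolding S1 using N by (intro sum_mono) (force simp: abs_le_iff)
    then show ?thesis by (simp add: sum.distrib \<mu>' sum_distrib_left n_def)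
  qed
  have S1l: "(\<Sum>m=1..x. X m) \<ge> x * \<mu> - n * real z ^ 2"
  proof -
    have "(\<Sum>q\<in>Q. x * \<rho> q - real z ^ 2) \<le> (\<Sum>m=1..x. X m)" unfolding S1 using N by (intro sum_mono) (force simp: abs_le_iff)
    then show ?thesis by (simp add: sum_subtractf \<mu>' sum_distrib_left n_def)
  qed
  have S2: "(\<Sum>m=1..x. (X m)\<^sup>2) \<le> x * \<mu> + n * real z ^ 2 + (x * \<mu>\<^sup>2 + real n ^ 2 * real z ^ 4)"
  proof -
    \<comment> \<open>The indicator takes the values 0 and 1, so the diagonal terms reproduce
      \<open>X m\<close>; only pairs of distinct primes need independence.\<close>
    have "(X m)\<^sup>2 = X m + (\<Sum>q\<in>Q. \<Sum>r\<in>Q - {q}. e q m * e r m)" for m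
    proof -
      have "(X m)\<^sup>2 = (\<Sum>q\<in>Q. \<Sum>r\<in>Q. e q m * e r m)" by (simp add: X_def power2_eq_square sum_product)
      also have "\<dots> = (\<Sum>q\<in>Q. e q m * e q m + (\<Sum>r\<in>Q - {q}. e q m * e r m))"
        using finQ by (intro sum.cong refl sum.remove) auto
      also have "\<dots> = (\<Sum>q\<in>Q. e q m * e q m) + (\<Sum>q\<in>Q. \<Sum>r\<in>Q - {q}. e q m * e r m)" by (rule sum.distrib)
      also have "(\<Sum>q\<in>Q. e q m * e q m) = X m" unfolding X_def by (rule sum.cong) (auto simp: e_def)
      finally show ?thesis .
    qed
    then have "(\<Sum>m=1..x. (X m)\<^sup>2) = (\<Sum>m=1..x. X m) + (\<Sum>m=1..x. \<Sum>q\<in>Q. \<Sum>r\<in>Q - {q}. e q m * e r m)"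
      by (simp add: sum.distrib)
    also have "(\<Sum>m=1..x. \<Sum>q\<in>Q. \<Sum>r\<in>Q - {q}. e q m * e r m) = (\<Sum>q\<in>Q. \<Sum>m=1..x. \<Sum>r\<in>Q - {q}. e q m * e r m)"
      by (rule sum.swap)
    also have "\<dots> = (\<Sum>q\<in>Q. \<Sum>r\<in>Q - {q}. \<Sum>m=1..x. e q m * e r m)"
      by (intro sum.cong refl sum.swap)
    also have "\<dots> \<le> (\<Sum>q\<in>Q. \<Sum>r\<in>Q - {q}. x * (\<rho> q * \<rho> r) + real z ^ 4)"
      using N2 by (intro sum_mono) auto
    also have "\<dots> \<le> (\<Sum>q\<in>Q. \<Sum>r\<in>Q. x * (\<rho> q * \<rho> r) + real z ^ 4)"
      using finQ \<rho> by (intro sum_mono sum_mono2) auto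
    also have "\<dots> = x * (sum \<rho> Q * sum \<rho> Q) + real n * (real n * real z ^ 4)"
      by (simp add: sum.distrib n_def flip: sum_distrib_left sum_distrib_right)
    also have "\<dots> = x * \<mu>\<^sup>2 + real n ^ 2 * real z ^ 4"
      by (simp add: \<mu>' power2_eq_square)
    finally show ?thesis using S1u by linarith
  qed
  have "card B * \<mu>\<^sup>2 = (\<Sum>m\<in>B. (X m - \<mu>)\<^sup>2)"
  proof -
    have "X m = 0" if "m \<in> B" for m unfolding X_def using that by (intro sum.neutral) (auto simp: B_def e_def)
    then show ?thesis by simp
  qed
  also have "\<dots> \<le> (\<Sum>m=1..x. (X m - \<mu>)\<^sup>2)" by (rule sum_mono2) (auto simp: B_def)
  also have "\<dots> = (\<Sum>m=1..x. (X m)\<^sup>2) - 2 * \<mu> * (\<Sum>m=1..x. X m) + x * \<mu>\<^sup>2"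
    by (simp add: power2_diff sum.distrib sum_subtractf sum_distrib_left mult_ac)
  also have "\<dots> \<le> x * \<mu> + n * real z ^ 2 + (x * \<mu>\<^sup>2 + real n ^ 2 * real z ^ 4) - 2 * \<mu> * (x * \<mu> - n * real z ^ 2) + x * \<mu>\<^sup>2"
    using S2 mult_left_mono[OF S1l, of "2 * \<mu>"] \<mu> by linarith
  also have "\<dots> = x * \<mu> + (n * real z ^ 2 + real n ^ 2 * real z ^ 4 + 2 * (\<mu> * (n * real z ^ 2)))"
    by (simp add: algebra_simps power2_eq_square)
  \<comment> \<open>There are at most z primes, each with at most z^2 residues, so the three errors
    are bounded by z^3, z^6 and 2 z^4.\<close>
  also have "\<dots> \<le> x * \<mu> + 4 * real z ^ 6"
  proof -
    have a: "n * real z ^ 2 \<le> real z ^ 3" 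
      using mult_right_mono[OF nz, of "real z ^ 2"] by (simp add: power2_eq_square power3_eq_cube mult.assoc)
    have "real n ^ 2 \<le> real z ^ 2" using nz by (intro power_mono) auto
    then have b: "real n ^ 2 * real z ^ 4 \<le> real z ^ 2 * real z ^ 4" by (intro mult_right_mono) auto
    have c: "\<mu> * (n * real z ^ 2) \<le> z * real z ^ 3" using a \<mu>z \<mu> by (intro mult_mono) auto
    have "real z ^ 3 \<le> real z ^ 6" "real z ^ 4 \<le> real z ^ 6" using z1 by (auto intro!: power_increasing)
    moreover have "real z ^ 2 * real z ^ 4 = real z ^ 6" "z * real z ^ 3 = real z ^ 4"
      by (simp_all flip: power_add power_Suc)
    ultimately show ?thesis using a b c by linarith
  qed
  finally have "card B * \<mu>\<^sup>2 \<le> x * \<mu> + 4 * real z ^ 6" .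
  then have "card B \<le> (x * \<mu> + 4 * real z ^ 6) / \<mu>\<^sup>2" using \<mu> by (simp add: field_simps)
  also have "\<dots> = x / \<mu> + 4 * real z ^ 6 / \<mu>\<^sup>2" using \<mu> by (simp add: add_divide_distrib power2_eq_square)
  finally show ?thesis by (simp add: B_def)
qed

section \<open>The exceptional set\<close>

definition exact_residues :: "nat \<Rightarrow> nat \<Rightarrow> nat set" where
  "exact_residues j p = {r. r < p\<^sup>2 \<and> r mod p = j \<and> r \<noteq> j}"

text \<open>The hypotheses of \<open>newton_data_small\<close>, read modulo q^2, with a lower bound
  \<open>N\<close> of k in place of k, so that one set serves a whole block of degrees.\<close>

definition window_residues :: "nat \<Rightarrow> nat \<Rightarrow> nat set" where
  "window_residues N q = {r. r < q\<^sup>2 \<and> r mod q \<le> N - q \<and> q \<le> r}"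

lemma exact_residuesD:
  assumes "m mod p\<^sup>2 \<in> exact_residues j p" "j < p"
  shows "p dvd m - j" "\<not> p\<^sup>2 dvd m - j"
proof -
  have r: "m mod p\<^sup>2 mod p = j" "m mod p\<^sup>2 \<noteq> j" using assms by (auto simp: exact_residues_def)
  have mp: "m mod p = j" using r(1) by (simp add: mod_mod_cancel)
  then have jm: "j \<le> m" using mod_less_eq_dividend by blast
  show "p dvd m - j" using mp by (auto simp: dvd_minus_mod)
  show "\<not> p\<^sup>2 dvd m - j"
  proof
    assume "p\<^sup>2 dvd m - j"
    then have "m mod p\<^sup>2 = j mod p\<^sup>2" using mod_eq_dvd_iff_nat[OF jm] by simp
    also have "\<dots> = j" using assms(2) by (intro mod_less) (simp add: power2_eq_square, metis Suc_leI less_le_trans mult_le_mono1 mult_1 not_gr_zero not_less0 One_nat_def)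
    finally show False using r by simp
  qed
qed

lemma card_exact_residues:
  assumes "j < p" shows "p - 1 \<le> card (exact_residues j p)"
proof -
  have "card {1..<p} \<le> card (exact_residues j p)"
  proof (rule card_inj_on_le)
    show "inj_on (\<lambda>i. j + p * i) {1..<p}" using assms by (auto simp: inj_on_def)
    show "(\<lambda>i. j + p * i) ` {1..<p} \<subseteq> exact_residues j p"
    proof
      fix r assume "r \<in> (\<lambda>i. j + p * i) ` {1..<p}"
      then obtain i where i: "1 \<le> i" "i < p" "r = j + p * i" by auto
      have "r < p * (i + 1)" using i assms by simp
      also have "\<dots> \<le> p * p" using i by (intro mult_le_mono2) simp
      finally show "r \<in> exact_residues j p" using i assms by (auto simp: exact_residues_def power2_eq_square)
    qed
    show "finite (exact_residues j p)" by (rule finite_subset[of _ "{..<p\<^sup>2}"]) (auto simp: exact_residues_def)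
  qed
  then show ?thesis by simp
qed

lemma card_window_residues:
  assumes "N < 2 * q" "q \<le> N" shows "(N - q + 1) * (q - 1) \<le> card (window_residues N q)"
proof -
  have "card ({..N - q} \<times> {1..<q}) \<le> card (window_residues N q)"
  proof (rule card_inj_on_le)
    have lt: "a < q" if "a \<le> N - q" for a using that assms by simp
    show "inj_on (\<lambda>(a, i). a + q * i) ({..N - q} \<times> {1..<q})"
    proof (rule inj_onI)
      fix u w assume uw: "u \<in> {..N - q} \<times> {1..<q}" "w \<in> {..N - q} \<times> {1..<q}"
        "(\<lambda>(a, i). a + q * i) u = (\<lambda>(a, i). a + q * i) w"
      obtain a i b l where u: "u = (a, i)" "w = (b, l)" by (cases u; cases w)
      have ab: "a < q" "b < q" using uw lt by (auto simp: u)
      have eq: "a + q * i = b + q * l" using uw by (simp add: u)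
      have "a = (a + q * i) mod q" using ab by simp
      also have "\<dots> = b" unfolding eq using ab by simp
      finally show "u = w" using eq ab by (simp add: u)
    qed
    show "(\<lambda>(a, i). a + q * i) ` ({..N - q} \<times> {1..<q}) \<subseteq> window_residues N q"
    proof
      fix r assume "r \<in> (\<lambda>(a, i). a + q * i) ` ({..N - q} \<times> {1..<q})"
      then obtain a i where i: "a \<le> N - q" "1 \<le> i" "i < q" "r = a + q * i" by auto
      have "r < q * (i + 1)" using i lt[of a] by simp
      also have "\<dots> \<le> q * q" using i by (intro mult_le_mono2) simp
      finally have "r < q\<^sup>2" by (simp add: power2_eq_square)
      moreover have "q * 1 \<le> q * i" using i by (intro mult_le_mono2) simp
      then have "q \<le> a + q * i" by linarith
      ultimately show "r \<in> window_residues N q" using i lt[of a] by (simp add: window_residues_def)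
    qed
    show "finite (window_residues N q)" by (rule finite_subset[of _ "{..<q\<^sup>2}"]) (auto simp: window_residues_def)
  qed
  then show ?thesis by (simp add: card_cartesian_product)
qed

lemma second_moment_bound':
  fixes Q :: "nat set" and S :: "nat \<Rightarrow> nat set" and x z :: nat
  assumes Q: "\<And>q. q \<in> Q \<Longrightarrow> prime q \<and> q \<le> z" and S: "\<And>q. q \<in> Q \<Longrightarrow> S q \<subseteq> {..<q\<^sup>2}"
    and M: "0 < M" "M \<le> (\<Sum>q\<in>Q. card (S q) / (real q)\<^sup>2)"
  shows "real (card {m \<in> {1..x}. \<forall>q\<in>Q. m mod q\<^sup>2 \<notin> S q}) \<le> x / M + 4 * real z ^ 6 / M\<^sup>2"
proof -
  define \<mu> where "\<mu> = (\<Sum>q\<in>Q. card (S q) / (real q)\<^sup>2)"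
  have \<mu>: "M \<le> \<mu>" "0 < \<mu>" using M by (auto simp: \<mu>_def)
  have "real (card {m \<in> {1..x}. \<forall>q\<in>Q. m mod q\<^sup>2 \<notin> S q}) \<le> x / \<mu> + 4 * real z ^ 6 / \<mu>\<^sup>2"
    unfolding \<mu>_def using Q S \<mu>(2)[unfolded \<mu>_def] by (rule second_moment_bound)
  also have "x / \<mu> \<le> x / M" using M \<mu> by (intro divide_left_mono) auto
  also have "4 * real z ^ 6 / \<mu>\<^sup>2 \<le> 4 * real z ^ 6 / M\<^sup>2"
    using M \<mu> by (intro divide_left_mono power_mono mult_pos_pos) auto
  finally show ?thesis by simp
qed

section \<open>Sizes of the exceptional sets\<close>

definition no_exact_prime :: "nat \<Rightarrow> nat \<Rightarrow> nat \<Rightarrow> nat \<Rightarrow> nat set" where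
  "no_exact_prime x J J' j = {m \<in> {1..x}. \<forall>p\<in>primes_between (4 ^ J) (4 ^ J'). m mod p\<^sup>2 \<notin> exact_residues j p}"

text \<open>The 24 is twice the 12 of \<open>sum_inverse_primes_ge\<close>, because the density (p -
  1)/p^2 is estimated from below by 1/(2p).\<close>

lemma card_no_exact_prime:
  assumes J: "8 \<le> J" "J \<le> J'" and j: "j \<le> 4 ^ J" and M: "0 < M" "M \<le> ln (real (J' + 2) / real (J + 2)) / 24"
  shows "real (card (no_exact_prime x J J' j)) \<le> x / M + 4 * real (4 ^ J') ^ 6 / M\<^sup>2"
  unfolding no_exact_prime_def
proof (rule second_moment_bound')
  define P where "P = primes_between (4 ^ J) (4 ^ J')"
  have "M \<le> (\<Sum>p\<in>P. 1 / real p) / 2"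
    using sum_inverse_primes_ge[OF J] M by (simp add: P_def)
  also have "\<dots> = (\<Sum>p\<in>P. 1 / real p / 2)" by (rule sum_divide_distrib)
  also have "\<dots> \<le> (\<Sum>p\<in>P. card (exact_residues j p) / (real p)\<^sup>2)"
  proof (rule sum_mono)
    fix p assume p: "p \<in> P"
    then have jp: "j < p" and p2: "2 \<le> p" using j by (auto simp: P_def primes_between_def prime_ge_2_nat)
    have "real p / 2 \<le> real (p - 1)" using p2 by simp
    also have "\<dots> \<le> card (exact_residues j p)" using card_exact_residues[OF jp] by (simp only: of_nat_le_iff)
    finally have "(real p / 2) / (real p)\<^sup>2 \<le> card (exact_residues j p) / (real p)\<^sup>2" by (rule divide_right_mono) simp
    moreover have "(real p / 2) / (real p)\<^sup>2 = 1 / real p / 2" using p2 by (simp add: power2_eq_square)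
    ultimately show "1 / real p / 2 \<le> card (exact_residues j p) / (real p)\<^sup>2" by simp
  qed
  finally show "M \<le> (\<Sum>q\<in>primes_between (4 ^ J) (4 ^ J'). card (exact_residues j q) / (real q)\<^sup>2)" by (simp add: P_def)
qed (use M in \<open>auto simp: primes_between_def exact_residues_def\<close>)

text \<open>Meant for all k with s^4 <= k < (s + 1)^4. The margin 8 s^3 at the bottom secures k < 2q
  throughout the block. The margin s^3 at the top leaves more than s^3 admissible residues modulo q,
  a proportion of at least 1/s.\<close>

definition window_primes :: "nat \<Rightarrow> nat set" where
  "window_primes s = primes_between (s ^ 4 div 2 + 8 * s ^ 3) (s ^ 4 - s ^ 3)"

definition no_window_prime :: "nat \<Rightarrow> nat \<Rightarrow> nat set" where
  "no_window_prime x s = {m \<in> {1..x}. \<forall>q\<in>window_primes s. m mod q\<^sup>2 \<notin> window_residues (s ^ 4) q}"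

text \<open>The constant is 8 * 12 * 11: a factor 12 (j + 1) from the prime count, 8 from s^4 <= 8 *
  4^j, and 11 s^3 as the number of primes wanted before the margins are cut off.\<close>

lemma log_bound: "\<exists>s0. \<forall>s\<ge>s0. \<forall>j. 2 ^ j \<le> s ^ 2 \<longrightarrow> 1056 * (j + 1) \<le> (s :: nat)"
proof -
  have "eventually (\<lambda>s. 1056 * (2 * ln (real s) / ln 2 + 1) \<le> real s) at_top" by real_asymp
  then obtain s0 where s0: "\<And>s. s \<ge> s0 \<Longrightarrow> 1056 * (2 * ln (real s) / ln 2 + 1) \<le> real s"
    by (auto simp: eventually_at_top_linorder)
  have "1056 * (j + 1) \<le> s" if s: "s \<ge> max s0 1" and j: "2 ^ j \<le> s ^ 2" for s j
  proof -
    have "real (2 ^ j) \<le> real (s ^ 2)" using j by (simp only: of_nat_le_iff)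
    then have "ln (2 ^ j) \<le> ln (real s ^ 2)" using s by simp
    then have "real j * ln 2 \<le> 2 * ln (real s)" using s by (simp add: ln_realpow)
    then have "real j \<le> 2 * ln (real s) / ln 2" by (simp add: field_simps)
    then have "1056 * (real j + 1) \<le> 1056 * (2 * ln (real s) / ln 2 + 1)" by simp
    also have "\<dots> \<le> real s" using s0[of s] s by simp
    finally have "1056 * (real j + 1) \<le> real s" .
    then have "real (1056 * (j + 1)) \<le> real s" by simp
    then show ?thesis by (simp only: of_nat_le_iff)
  qed
  then show ?thesis by blast
qed

lemma card_window_primes: "\<exists>s0. \<forall>s\<ge>s0. 2 * s ^ 3 \<le> card (window_primes s)"
proof -
  obtain s0 where s0: "\<And>s j. s \<ge> s0 \<Longrightarrow> 2 ^ j \<le> s ^ 2 \<Longrightarrow> 1056 * (j + 1) \<le> s" using log_bound by blast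
  have "2 * s ^ 3 \<le> card (window_primes s)" if s: "s \<ge> max s0 20" for s
  proof -
    define n where "n = s ^ 4 div 2"
    have n: "2 * n \<le> s ^ 4" "s ^ 4 \<le> 2 * n + 1" by (auto simp: n_def)
    have "20 ^ 4 \<le> s ^ 4" using s by (intro power_mono) auto
    then have n2: "2 * n \<ge> 65536" using n by simp
    obtain j where j: "4 ^ j \<le> 2 * n" "2 * n < 4 ^ (j + 1)"
      using ex_power_ivl1[of 4 "2 * n"] n2 by auto
    have j8: "j \<ge> 8"
    proof (rule ccontr)
      assume "\<not> j \<ge> 8"
      then have "(4::nat) ^ (j + 1) \<le> 4 ^ 8" by (intro power_increasing) auto
      then show False using j n2 by simp
    qed
    define D where "D = card (primes_between n (2 * n))"
    have "(2 ^ j) ^ 2 \<le> (s ^ 2) ^ 2"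
    proof -
      have "(2 ^ j) ^ 2 = (4::nat) ^ j" by (simp add: power2_eq_square flip: power_mult_distrib)
      moreover have "(s ^ 2) ^ 2 = s ^ 4" by (simp flip: power_mult)
      ultimately show ?thesis using j n by linarith
    qed
    then have "2 ^ j \<le> s ^ 2" by (rule power2_le_imp_le) simp
    then have js: "1056 * (j + 1) \<le> s" using s0 s by simp
    have "s ^ 4 \<le> 8 * 4 ^ j" using n j by simp
    then have "1056 * (j + 1) * s ^ 3 \<le> 8 * (12 * (j + 1) * D)"
    proof -
      have "1056 * (j + 1) * s ^ 3 \<le> s * s ^ 3" using js by (rule mult_le_mono1)
      also have "\<dots> = s ^ 4" by (simp add: power_numeral_reduce)
      also have "\<dots> \<le> 8 * 4 ^ j" by fact
      also have "\<dots> \<le> 8 * (12 * (j + 1) * D)"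
        unfolding D_def using card_primes_between_ge[OF j8 j] by (rule mult_le_mono2)
      finally show ?thesis .
    qed
    then have "(96 * (j + 1)) * (11 * s ^ 3) \<le> (96 * (j + 1)) * D" by (simp add: algebra_simps)
    then have D: "11 * s ^ 3 \<le> D" by (rule mult_left_le_imp_le) simp
    \<comment> \<open>The two margins remove at most 8 s^3 + s^3 of the 11 s^3 primes.\<close>
    have "primes_between n (2 * n) \<subseteq> window_primes s \<union> ({n<..n + 8 * s ^ 3} \<union> {s ^ 4 - s ^ 3<..s ^ 4})"
      using n by (auto simp: primes_between_def window_primes_def n_def)
    then have "D \<le> card (window_primes s \<union> ({n<..n + 8 * s ^ 3} \<union> {s ^ 4 - s ^ 3<..s ^ 4}))"
      unfolding D_def by (intro card_mono) (auto simp: window_primes_def)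
    also have "\<dots> \<le> card (window_primes s) + (card {n<..n + 8 * s ^ 3} + card {s ^ 4 - s ^ 3<..s ^ 4})"
      by (intro order_trans[OF card_Un_le] add_left_mono card_Un_le)
    also have "\<dots> \<le> card (window_primes s) + 9 * s ^ 3" by simp
    finally show ?thesis using D by simp
  qed
  then show ?thesis by blast
qed

text \<open>At least 2 s^3 primes of density at least 1/(2s) give the mean s^2, hence a proportion
  1/s^2 that is summable over the blocks. Blocks between consecutive squares would give a mean of
  order s / log s and a divergent series.\<close>

lemma card_no_window_prime:
  assumes s: "s \<ge> 2" "2 * s ^ 3 \<le> card (window_primes s)"
  shows "real (card (no_window_prime x s)) \<le> x / real s ^ 2 + 4 * real (s ^ 4) ^ 6"
proof -
  have "real (card (no_window_prime x s)) \<le> x / real s ^ 2 + 4 * real (s ^ 4) ^ 6 / (real s ^ 2)\<^sup>2"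
    unfolding no_window_prime_def
  proof (rule second_moment_bound')
    have "real (2 * s ^ 3) \<le> card (window_primes s)" using s(2) by (simp only: of_nat_le_iff)
    then have "real s ^ 2 \<le> (\<Sum>q\<in>window_primes s. 1 / (2 * real s))"
      using s by (simp add: field_simps power_numeral_reduce)
    also have "\<dots> \<le> (\<Sum>q\<in>window_primes s. card (window_residues (s ^ 4) q) / (real q)\<^sup>2)"
    proof (rule sum_mono)
      fix q assume q: "q \<in> window_primes s"
      have pr: "prime q" "s ^ 4 div 2 + 8 * s ^ 3 < q" "q \<le> s ^ 4 - s ^ 3"
        using q by (auto simp: window_primes_def primes_between_def)
      have s34: "s ^ 3 \<le> s ^ 4" using s by (intro power_increasing) auto
      have q1: "s ^ 4 < 2 * q" "q \<le> s ^ 4" "s ^ 3 \<le> s ^ 4 - q" "q \<ge> 2"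
        using pr s34 prime_ge_2_nat[OF pr(1)] by auto
      have "s ^ 3 * (q - 1) \<le> (s ^ 4 - q + 1) * (q - 1)" using q1 by (intro mult_le_mono1) simp
      also have "\<dots> \<le> card (window_residues (s ^ 4) q)" by (rule card_window_residues[OF q1(1,2)])
      finally have c: "real (s ^ 3 * (q - 1)) \<le> card (window_residues (s ^ 4) q)" by (simp only: of_nat_le_iff)
      have qr: "0 < real q" "real q \<le> real s ^ 4" using q1 by (simp_all flip: of_nat_power)
      have "real s ^ 3 * (real q / 2) \<le> real s ^ 3 * real (q - 1)" using q1 by (intro mult_left_mono) auto
      also have "\<dots> \<le> card (window_residues (s ^ 4) q)" using c by simp
      finally have c2: "real s ^ 3 * (real q / 2) / (real q)\<^sup>2 \<le> card (window_residues (s ^ 4) q) / (real q)\<^sup>2"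
        by (rule divide_right_mono) simp
      have "1 / (2 * real s) = real s ^ 3 / (2 * real s ^ 4)" using s by (simp add: power_numeral_reduce)
      also have "\<dots> \<le> real s ^ 3 / (2 * real q)" using qr s by (intro divide_left_mono mult_pos_pos) auto
      also have "\<dots> = real s ^ 3 * (real q / 2) / (real q)\<^sup>2" using qr by (simp add: power2_eq_square)
      finally show "1 / (2 * real s) \<le> card (window_residues (s ^ 4) q) / (real q)\<^sup>2" using c2 by simp
    qed
    finally show "real s ^ 2 \<le> (\<Sum>q\<in>window_primes s. card (window_residues (s ^ 4) q) / (real q)\<^sup>2)" .
  qed (use s in \<open>auto simp: window_primes_def primes_between_def window_residues_def\<close>)
  also have "4 * real (s ^ 4) ^ 6 / (real s ^ 2)\<^sup>2 \<le> 4 * real (s ^ 4) ^ 6 / 1"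
    using s by (intro divide_left_mono one_le_power) auto
  finally show ?thesis by simp
qed

text \<open>The shifts j < s0^4 cover every demand on large primes: 0 and 1 for all k, and k - q for
  the k below s0^4. From s0^4 on, the block containing k supplies q.\<close>

lemma full_symmetric_if_not_bad:
  assumes m: "m \<in> {1..x}" and k: "8 \<le> k" "k \<le> K" "K \<le> m" "K \<le> 4 ^ J"
    and s0: "s0 \<ge> 2" "s0 ^ 4 \<le> 4 ^ J"
    and good1: "\<And>j. j < s0 ^ 4 \<Longrightarrow> m \<notin> no_exact_prime x J J' j"
    and good2: "\<And>s. s0 \<le> s \<Longrightarrow> s ^ 4 \<le> K \<Longrightarrow> m \<notin> no_window_prime x s"
  shows "galois_is_full_symmetric (trimmed_exp (m - k) m)"
proof -
  interpret trimmed m k by standard (use k in auto)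
  have exact: "\<exists>p. prime p \<and> p > k \<and> p dvd m - j \<and> \<not> p\<^sup>2 dvd m - j" if j: "j < s0 ^ 4" for j
  proof -
    obtain p where p: "p \<in> primes_between (4 ^ J) (4 ^ J')" "m mod p\<^sup>2 \<in> exact_residues j p"
      using good1[OF j] m by (auto simp: no_exact_prime_def)
    then have "prime p" "4 ^ J < p" by (auto simp: primes_between_def)
    then show ?thesis using exact_residuesD[OF p(2)] j s0 k by (intro exI[of _ p]) auto
  qed
  have s16: "2 ^ 4 \<le> s0 ^ 4" using s0 by (intro power_mono) auto
  obtain p0 where p0: "prime p0" "p0 > k" "p0 dvd m" "\<not> p0\<^sup>2 dvd m" using exact[of 0] s16 s0(1) by auto
  obtain p1 where p1: "prime p1" "p1 > k" "p1 dvd m - 1" "\<not> p1\<^sup>2 dvd m - 1" using exact[of 1] s16 s0(1) by auto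
  have "\<exists>p r q. prime q \<and> k < 2 * q \<and> q + 3 \<le> k \<and> newton_data p r q"
  proof (cases "k < s0 ^ 4")
    case True
    obtain q where q: "prime q" "k < 2 * q" "q + 3 \<le> k" using ex_prime_in_upper_half[OF k(1)] by blast
    obtain p where p: "prime p" "p > k" "p dvd m - (k - q)" "\<not> p\<^sup>2 dvd m - (k - q)"
    proof -
      have "k - q < s0 ^ 4" using True by simp
      from exact[OF this] show ?thesis using that by blast
    qed
    have "newton_data p (k - q) (k - (k - q))"
      using p q by (intro newton_data_large) (auto simp: prime_gt_0_nat)
    moreover have "k - (k - q) = q" using q by simp
    ultimately show ?thesis using q by metis
  next
    case False
    \<comment> \<open>The integer fourth root of k, which names its block.\<close>
    define s where "s = (GREATEST s. s ^ 4 \<le> k)"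
    have bd: "t \<le> k" if "t ^ 4 \<le> k" for t :: nat
      using that self_le_power[of t 4] by (cases "t = 0") auto
    have sk: "s ^ 4 \<le> k" unfolding s_def
      by (rule GreatestI_nat[where k = 0 and b = k]) (use bd in auto)
    have sS: "k < (s + 1) ^ 4"
    proof (rule ccontr)
      assume "\<not> ?thesis"
      then have "s + 1 \<le> s" unfolding s_def by (intro Greatest_le_nat[where b = k]) (use bd in auto)
      then show False by simp
    qed
    have ss0: "s0 \<le> s"
    proof -
      have "s0 ^ 4 < (s + 1) ^ 4" using False sS by simp
      then have "s0 < s + 1" by (rule power_less_imp_less_base) simp
      then show ?thesis by simp
    qed
    have "m \<notin> no_window_prime x s" using good2[OF ss0] sk k by simp
    then obtain q where q: "q \<in> window_primes s" "m mod q\<^sup>2 \<in> window_residues (s ^ 4) q"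
      using m by (auto simp: no_window_prime_def)
    have pr: "prime q" "s ^ 4 div 2 + 8 * s ^ 3 < q" "q \<le> s ^ 4 - s ^ 3"
      using q by (auto simp: window_primes_def primes_between_def)
    have s2: "s \<ge> 2" using s0 ss0 by simp
    have "2 ^ 3 \<le> s ^ 3" using s2 by (rule power_mono) simp
    moreover have "s ^ 2 \<le> s ^ 3" "s \<le> s ^ 3" "s ^ 3 \<le> s ^ 4"
      using s2 by (auto intro!: power_increasing self_le_power)
    ultimately have a: "s ^ 2 \<le> s ^ 3" "s \<le> s ^ 3" "8 \<le> s ^ 3" "s ^ 3 \<le> s ^ 4" by simp_all
    have "(s + 1) ^ 4 = s ^ 4 + 4 * s ^ 3 + 6 * s ^ 2 + 4 * s + 1"
      by (simp add: power4_eq_xxxx power3_eq_cube power2_eq_square algebra_simps)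
    \<comment> \<open>Here 14 = 4 + 6 + 4; half of it, with the rounding in
      \<open>s ^ 4 div 2\<close>, stays below the margin 8 s^3.\<close>
    then have "(s + 1) ^ 4 \<le> s ^ 4 + 14 * s ^ 3 + 1" using a by linarith
    then have k2q: "k < 2 * q" using sS pr a by linarith
    have q3: "q + 3 \<le> k" using pr a sk by linarith
    have mq: "m mod q\<^sup>2 mod q \<le> s ^ 4 - q" "q \<le> m mod q\<^sup>2" using q by (auto simp: window_residues_def)
    have "m mod q \<le> s ^ 4 - q" using mq(1) by (simp add: mod_mod_cancel)
    then have "m mod q + q \<le> k" using pr a sk by linarith
    from newton_data_small[OF pr(1) k2q this mq(2)] show ?thesis using pr(1) k2q q3 by blast
  qed
  then show ?thesis using full_symmetric[OF p0 p1] by blast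
qed

section \<open>Numerical bounds and the final estimate\<close>

lemma sum_inverse_squares_le:
  assumes "2 \<le> a" "a \<le> b + 1" shows "(\<Sum>s=a..b. 1 / real s ^ 2) \<le> 1 / (real a - 1)"
proof -
  have "(\<Sum>s=a..b. 1 / real s ^ 2) \<le> 1 / (real a - 1) - 1 / real b" if "a \<le> b" for b
    using that
  proof (induction b rule: dec_induct)
    case base
    have "1 / real a ^ 2 \<le> 1 / (real a * (real a - 1))"
      using assms by (intro divide_left_mono) (auto simp: power2_eq_square)
    also have "\<dots> = 1 / (real a - 1) - 1 / real a" using assms by (simp add: field_simps)
    finally show ?case by simp
  next
    case (step b)
    have "1 / real (Suc b) ^ 2 \<le> 1 / (real (Suc b) * real b)"
      using assms step by (intro divide_left_mono) (auto simp: power2_eq_square)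
    also have "\<dots> = 1 / real b - 1 / real (Suc b)" using assms step by (simp add: field_simps)
    finally have "1 / real (Suc b) ^ 2 \<le> 1 / real b - 1 / real (Suc b)" .
    then show ?case using step by (simp del: of_nat_Suc)
  qed
  note h = this
  show ?thesis
  proof (cases "a \<le> b")
    case True
    have "0 \<le> 1 / real b" by simp
    then show ?thesis using h[OF True] by linarith
  next
    case False then show ?thesis using assms by simp
  qed
qed

lemma power_le_if_ln_le:
  assumes "K > 0" "x > 0" "real n * ln (real K) \<le> ln (real x)" shows "K ^ n \<le> x"
proof -
  have "ln (real K ^ n) \<le> ln (real x)" using assms by (simp add: ln_realpow)
  then have "real K ^ n \<le> real x" using assms by (subst (asm) ln_le_cancel_iff) auto
  then have "real (K ^ n) \<le> real x" by simp
  then show ?thesis by (simp only: of_nat_le_iff)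
qed

lemma power_le_sqrt:
  assumes "K ^ (2 * n) \<le> x" shows "real K ^ n \<le> sqrt (real x)"
proof (rule real_le_rsqrt)
  have "real (K ^ (2 * n)) \<le> real x" using assms by (simp only: of_nat_le_iff)
  then show "(real K ^ n)\<^sup>2 \<le> real x" by (simp add: power_mult[symmetric] mult.commute)
qed

text \<open>Three kinds of m are discarded: those below K, those failing one of s0^4 large-prime
  conditions, and those failing a block. The exponents 14 and 12 keep the errors below multiples of
  sqrt x: at most K blocks with error 4 K^6 each, and an error 4 z^6 with z = 4^J' for each
  shift.\<close>

lemma card_bad_le:
  fixes x K J J' s0 :: nat and M :: real
  defines "good \<equiv> {m \<in> {1..x}. \<forall>k. 8 \<le> k \<and> k \<le> K \<longrightarrow> k \<le> m \<and> galois_is_full_symmetric (trimmed_exp (m - k) m)}"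
  assumes x: "x > 0" and K: "K > 0" "K ^ 14 \<le> x" "K \<le> 4 ^ J"
    and J: "8 \<le> J" "J \<le> J'" "(4 ^ J') ^ 12 \<le> x"
    and s0: "s0 \<ge> 2" "s0 ^ 4 \<le> 4 ^ J" "\<And>s. s \<ge> s0 \<Longrightarrow> 2 * s ^ 3 \<le> card (window_primes s)"
    and M: "1 \<le> M" "M \<le> ln (real (J' + 2) / real (J + 2)) / 24"
  shows "real (card ({1..x} - good)) / x \<le>
    5 / sqrt x + real s0 ^ 4 * (1 / M + 4 / sqrt x) + 1 / (real s0 - 1)"
proof -
  define T where "T = {s. s0 \<le> s \<and> s ^ 4 \<le> K}"
  have Tsub: "T \<subseteq> {s0..K}"
  proof
    fix s assume s: "s \<in> T"
    then have "s \<le> s ^ 4" using s0 by (intro self_le_power) (auto simp: T_def)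
    then show "s \<in> {s0..K}" using s by (simp add: T_def)
  qed
  then have finT: "finite T" using finite_subset by blast
  have K7: "real K ^ 7 \<le> sqrt x" using power_le_sqrt[of K 7 x] K by simp
  have J6: "real (4 ^ J') ^ 6 \<le> sqrt x" using power_le_sqrt[of "4 ^ J'" 6 x] J by simp
  have sq: "sqrt x > 0" "sqrt x * sqrt x = x" using x by auto
  have "{1..x} - good \<subseteq> {..<K} \<union> ((\<Union>j\<in>{..<s0 ^ 4}. no_exact_prime x J J' j) \<union> (\<Union>s\<in>T. no_window_prime x s))"
  proof
    fix m assume m: "m \<in> {1..x} - good"
    show "m \<in> {..<K} \<union> ((\<Union>j\<in>{..<s0 ^ 4}. no_exact_prime x J J' j) \<union> (\<Union>s\<in>T. no_window_prime x s))"
    proof (rule ccontr)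
      assume n: "\<not> ?thesis"
      have mx: "m \<in> {1..x}" using m by blast
      have Km: "K \<le> m" using n by auto
      have "k \<le> m \<and> galois_is_full_symmetric (trimmed_exp (m - k) m)" if k: "8 \<le> k" "k \<le> K" for k
        using full_symmetric_if_not_bad[OF mx k Km K(3) s0(1,2)] n k Km by (auto simp: T_def)
      then have "m \<in> good" using mx by (simp add: good_def)
      then show False using m by blast
    qed
  qed
  then have "card ({1..x} - good) \<le> card ({..<K} \<union> ((\<Union>j\<in>{..<s0 ^ 4}. no_exact_prime x J J' j) \<union> (\<Union>s\<in>T. no_window_prime x s)))"
    using finT by (intro card_mono) (auto simp: no_exact_prime_def no_window_prime_def)
  also have "\<dots> \<le> card {..<K} + (card (\<Union>j\<in>{..<s0 ^ 4}. no_exact_prime x J J' j) + card (\<Union>s\<in>T. no_window_prime x s))"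
    by (intro order_trans[OF card_Un_le] add_left_mono card_Un_le)
  also have "\<dots> \<le> K + ((\<Sum>j<s0 ^ 4. card (no_exact_prime x J J' j)) + (\<Sum>s\<in>T. card (no_window_prime x s)))"
    using finT by (intro add_mono card_UN_le) auto
  finally have "real (card ({1..x} - good)) \<le>
      real (K + ((\<Sum>j<s0 ^ 4. card (no_exact_prime x J J' j)) + (\<Sum>s\<in>T. card (no_window_prime x s))))"
    by (simp only: of_nat_le_iff)
  also have "\<dots> = K + ((\<Sum>j<s0 ^ 4. real (card (no_exact_prime x J J' j))) + (\<Sum>s\<in>T. real (card (no_window_prime x s))))"
    by simp
  also have "(\<Sum>j<s0 ^ 4. real (card (no_exact_prime x J J' j))) \<le> (\<Sum>j<s0 ^ 4. x / M + 4 * sqrt x)"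
  proof (rule sum_mono)
    fix j assume "j \<in> {..<s0 ^ 4}"
    then have "j \<le> 4 ^ J" using s0 by simp
    then have "real (card (no_exact_prime x J J' j)) \<le> x / M + 4 * real (4 ^ J') ^ 6 / M\<^sup>2"
      using card_no_exact_prime[OF J(1,2)] M by simp
    also have "4 * real (4 ^ J') ^ 6 / M\<^sup>2 \<le> 4 * real (4 ^ J') ^ 6 / 1"
      using M by (intro divide_left_mono one_le_power) auto
    finally show "real (card (no_exact_prime x J J' j)) \<le> x / M + 4 * sqrt x" using J6 by simp
  qed
  also have "(\<Sum>s\<in>T. real (card (no_window_prime x s))) \<le> (\<Sum>s\<in>T. x * (1 / real s ^ 2) + 4 * real K ^ 6)"
  proof (rule sum_mono)
    fix s assume s: "s \<in> T"
    then have s': "s \<ge> s0" "s \<ge> 2" "s ^ 4 \<le> K" using s0 by (auto simp: T_def)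
    have "real (card (no_window_prime x s)) \<le> x / real s ^ 2 + 4 * real (s ^ 4) ^ 6"
      by (rule card_no_window_prime[OF s'(2) s0(3)[OF s'(1)]])
    also have "real (s ^ 4) ^ 6 \<le> real K ^ 6" using s'(3) by (intro power_mono) (simp_all only: of_nat_le_iff of_nat_0_le_iff)
    finally show "real (card (no_window_prime x s)) \<le> x * (1 / real s ^ 2) + 4 * real K ^ 6" by simp
  qed
  also have "\<dots> \<le> x * (1 / (real s0 - 1)) + 4 * real K ^ 7"
  proof -
    have "(\<Sum>s\<in>T. 1 / real s ^ 2) \<le> (\<Sum>s=s0..s0 + K. 1 / real s ^ 2)"
      using Tsub by (intro sum_mono2) auto
    also have "\<dots> \<le> 1 / (real s0 - 1)" using s0 by (intro sum_inverse_squares_le) auto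
    finally have a: "x * (\<Sum>s\<in>T. 1 / real s ^ 2) \<le> x * (1 / (real s0 - 1))" by (intro mult_left_mono) auto
    have "card T \<le> card {1..K}" using Tsub s0 by (intro card_mono) auto
    then have "real (card T) * (4 * real K ^ 6) \<le> real K * (4 * real K ^ 6)" by (intro mult_right_mono) auto
    also have "\<dots> = 4 * real K ^ 7" by (simp add: power_numeral_reduce)
    finally show ?thesis using a by (simp add: sum.distrib sum_distrib_left)
  qed
  finally have "real (card ({1..x} - good)) \<le>
     K + (real s0 ^ 4 * (x / M + 4 * sqrt x) + (x * (1 / (real s0 - 1)) + 4 * real K ^ 7))" by simp
  moreover have "real K \<le> real K ^ 7" using K by (intro self_le_power) auto
  ultimately have "real (card ({1..x} - good)) \<le> 5 * sqrt x + real s0 ^ 4 * (x / M + 4 * sqrt x) + x * (1 / (real s0 - 1))"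
    using K7 by linarith
  then have "real (card ({1..x} - good)) / x \<le> (5 * sqrt x + real s0 ^ 4 * (x / M + 4 * sqrt x) + x * (1 / (real s0 - 1))) / x"
    by (rule divide_right_mono) simp
  also have "\<dots> = 5 * (sqrt x / x) + real s0 ^ 4 * (1 / M + 4 * (sqrt x / x)) + 1 / (real s0 - 1)"
    using x M by (simp add: field_simps)
  also have "sqrt x / x = 1 / sqrt x" using sq by (simp add: field_simps)
  finally show ?thesis by simp
qed

theorem theorem1:
  fixes kmax :: "nat \<Rightarrow> nat"
  assumes "\<And>x. kmax x > 0"
    and "((\<lambda>x. ln (real (kmax x)) / ln (real x)) \<longlongrightarrow> 0) at_top"
  shows "((\<lambda>x. real (card {m \<in> {1..x}. \<forall>k. 8 \<le> k \<and> k \<le> kmax x \<longrightarrow>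
              k \<le> m \<and> galois_is_full_symmetric (trimmed_exp (m - k) m)}) / real x)
          \<longlongrightarrow> 1) at_top"
proof (rule tendstoI)
  fix \<epsilon> :: real assume \<epsilon>: "\<epsilon> > 0"
  define good where "good x = {m \<in> {1..x}. \<forall>k. 8 \<le> k \<and> k \<le> kmax x \<longrightarrow>
              k \<le> m \<and> galois_is_full_symmetric (trimmed_exp (m - k) m)}" for x
  obtain s1 where s1: "\<And>s. s \<ge> s1 \<Longrightarrow> 2 * s ^ 3 \<le> card (window_primes s)" using card_window_primes by blast
  \<comment> \<open>\<open>s0\<close> depends on the tolerance only. It makes the tail of the block
    series small while the number s0^4 of large-prime conditions stays fixed as x grows.\<close>
  define s0 where "s0 = max (max s1 2) (nat \<lceil>2 / \<epsilon>\<rceil> + 2)"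
  have s0: "s0 \<ge> 2" "s0 \<ge> s1" by (auto simp: s0_def)
  have "1 / (real s0 - 1) < \<epsilon> / 2"
  proof -
    have "2 / \<epsilon> \<le> real (nat \<lceil>2 / \<epsilon>\<rceil>)" by (rule real_nat_ceiling_ge)
    also have "\<dots> < real s0 - 1" by (simp add: s0_def)
    finally show ?thesis using \<epsilon> s0 by (simp add: field_simps)
  qed
  note s0\<epsilon> = this
  define c where "c = max 8 (s0 ^ 4)"
  define u where "u x = ln (real (kmax x)) / ln (real x)" for x
  \<comment> \<open>4^J exceeds both the largest degree and s0^4, and 4^J' is the largest power of 4
    up to x^(1/12); the large primes are taken from between.\<close>
  define J where "J x = c + nat \<lceil>ln (real (kmax x)) / ln 4\<rceil>" for x
  define J' where "J' x = nat \<lfloor>ln (real x) / (12 * ln 4)\<rfloor>" for x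
  \<comment> \<open>An explicit upper bound for (J + 2)/(J' + 2). The 3 collects the 2 and the
    rounding up in \<open>J\<close>. It tends to 0 by the growth condition on \<open>kmax\<close>,
    so M tends to infinity.\<close>
  define w where "w x = 12 * u x + 12 * (real c + 3) * ln 4 / ln (real x)" for x
  define M where "M x = ln (1 / w x) / 24" for x
  have u0: "u \<longlonglongrightarrow> 0" unfolding u_def using assms(2) .
  have lnx: "filterlim (\<lambda>x. ln (real x)) at_top sequentially" by real_asymp
  have "(\<lambda>x. 12 * (real c + 3) * ln 4 / ln (real x)) \<longlonglongrightarrow> 0"
    by (rule real_tendsto_divide_at_top[OF tendsto_const lnx])
  then have "(\<lambda>x. 12 * u x + 12 * (real c + 3) * ln 4 / ln (real x)) \<longlonglongrightarrow> 12 * 0 + 0"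
    by (intro tendsto_intros u0)
  then have w0: "w \<longlonglongrightarrow> 0" by (simp add: w_def [abs_def])
  have ev2: "eventually (\<lambda>x::nat. x \<ge> 2) sequentially" by (rule eventually_ge_at_top)
  have wpos: "w x > 0" if "x \<ge> 2" for x
  proof -
    have "ln (real x) > 0" using that by simp
    moreover have "u x \<ge> 0" unfolding u_def using that assms(1)[of x] by (intro divide_nonneg_nonneg) auto
    ultimately show ?thesis unfolding w_def by (intro add_nonneg_pos divide_pos_pos mult_pos_pos) auto
  qed
  have "eventually (\<lambda>x. w x \<in> {0<..} \<and> w x \<noteq> 0) sequentially"
    using ev2 by (rule eventually_mono) (use wpos in force)
  then have "filterlim w (at_right 0) sequentially" using w0 by (simp add: filterlim_at)
  then have "filterlim (\<lambda>x. inverse (w x)) at_top sequentially"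
    by (rule filterlim_compose[OF filterlim_inverse_at_top_right])
  then have "filterlim (\<lambda>x. ln (inverse (w x))) at_top sequentially"
    by (rule filterlim_compose[OF ln_at_top])
  from filterlim_tendsto_pos_mult_at_top[OF tendsto_const[of "1 / 24"] _ this]
  have "filterlim (\<lambda>x. (1 / 24) * ln (inverse (w x))) at_top sequentially" by simp
  then have Mtop: "filterlim M at_top sequentially" by (simp add: M_def [abs_def] inverse_eq_divide)
  have sqrt_top: "filterlim (\<lambda>x. sqrt (real x)) at_top sequentially" by real_asymp
  have "(\<lambda>x. 5 / sqrt x + real s0 ^ 4 * (1 / M x + 4 / sqrt x)) \<longlonglongrightarrow> 0 + real s0 ^ 4 * (0 + 0)"
    by (intro tendsto_intros real_tendsto_divide_at_top[OF tendsto_const] Mtop sqrt_top)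
  then have "eventually (\<lambda>x. 5 / sqrt x + real s0 ^ 4 * (1 / M x + 4 / sqrt x) < \<epsilon> / 2) sequentially"
    using \<epsilon> by (intro order_tendstoD(2)) auto
  moreover have "eventually (\<lambda>x. u x < 1 / 14) sequentially" using u0 by (rule order_tendstoD) simp
  moreover have "eventually (\<lambda>x. M x \<ge> 1) sequentially" using Mtop by (simp add: filterlim_at_top)
  ultimately show "eventually (\<lambda>x. dist (real (card {m \<in> {1..x}. \<forall>k. 8 \<le> k \<and> k \<le> kmax x \<longrightarrow>
              k \<le> m \<and> galois_is_full_symmetric (trimmed_exp (m - k) m)}) / real x) 1 < \<epsilon>) at_top"
    using ev2
  proof eventually_elim
    case (elim x)
    have lx: "ln (real x) > 0" using elim by simp
    have K0: "kmax x > 0" by (rule assms(1))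
    then have lK: "ln (real (kmax x)) \<ge> 0" by simp
    have K14: "kmax x ^ 14 \<le> x"
      using elim lx K0 by (intro power_le_if_ln_le) (auto simp: u_def field_simps)
    have l4: "ln (4::real) > 0" by simp
    have ceil: "ln (real (kmax x)) / ln 4 \<le> real (nat \<lceil>ln (real (kmax x)) / ln 4\<rceil>)" by (rule real_nat_ceiling_ge)
    have ceil2: "real (nat \<lceil>ln (real (kmax x)) / ln 4\<rceil>) \<le> ln (real (kmax x)) / ln 4 + 1"
      using lK l4 by (simp add: divide_nonneg_nonneg)
    have KJ: "kmax x \<le> 4 ^ J x"
    proof -
      have "ln (real (kmax x)) \<le> real (nat \<lceil>ln (real (kmax x)) / ln 4\<rceil>) * ln 4"
        using ceil l4 by (simp add: pos_divide_le_eq)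
      also have "\<dots> \<le> real (J x) * ln 4" using l4 by (intro mult_right_mono) (auto simp: J_def)
      finally have "ln (real (kmax x)) \<le> ln (4 ^ J x)" by (simp add: ln_realpow)
      then have "real (kmax x) \<le> 4 ^ J x" using K0 by (subst (asm) ln_le_cancel_iff) auto
      then have "real (kmax x) \<le> real (4 ^ J x)" by simp
      then show ?thesis by (simp only: of_nat_le_iff)
    qed
    have cJ: "c \<le> J x" "8 \<le> J x" by (auto simp: J_def c_def)
    have sJ: "s0 ^ 4 \<le> 4 ^ J x"
    proof -
      have "s0 ^ 4 \<le> J x" using cJ by (simp add: c_def)
      also have "J x \<le> 2 ^ J x" using less_exp[of "J x"] by (rule less_imp_le)
      also have "\<dots> \<le> 4 ^ J x" by (rule power_mono) auto
      finally show ?thesis .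
    qed
    have J12: "(4 ^ J' x) ^ 12 \<le> x"
    proof -
      have "real (J' x) \<le> ln (real x) / (12 * ln 4)" unfolding J'_def using lx l4 by (intro of_nat_floor) simp
      then have "12 * (real (J' x) * ln 4) \<le> ln (real x)" using l4 by (simp add: pos_le_divide_eq mult_ac)
      then show ?thesis using elim by (intro power_le_if_ln_le) (auto simp: ln_realpow)
    qed
    have J1: "real (J x + 2) \<le> ln (real (kmax x)) / ln 4 + (c + 3)" using ceil2 by (simp add: J_def)
    have J2: "ln (real x) / (12 * ln 4) \<le> real (J' x + 2)" unfolding J'_def by linarith
    have wx: "w x > 0" using wpos elim by simp
    have ratio: "1 / w x \<le> real (J' x + 2) / real (J x + 2)"
    proof -
      have "real (J x + 2) \<le> w x * (ln (real x) / (12 * ln 4))"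
      proof -
        have "w x * (ln (real x) / (12 * ln 4)) = ln (real (kmax x)) / ln 4 + (c + 3)"
          using lx l4 by (simp add: w_def u_def field_simps)
        then show ?thesis using J1 by simp
      qed
      also have "\<dots> \<le> w x * real (J' x + 2)" using J2 wx by (intro mult_left_mono) auto
      finally show ?thesis using wx by (simp add: field_simps)
    qed
    have MJ: "M x \<le> ln (real (J' x + 2) / real (J x + 2)) / 24"
      unfolding M_def using ratio wx by (intro divide_right_mono) (auto intro!: ln_mono)
    \<comment> \<open>M >= 1 makes the logarithm of the ratio positive, so the range of large primes
      is not degenerate.\<close>
    have JJ: "J x \<le> J' x"
    proof (rule ccontr)
      assume "\<not> J x \<le> J' x"
      then have "real (J' x + 2) / real (J x + 2) \<le> 1" by simp
      then have "ln (real (J' x + 2) / real (J x + 2)) \<le> ln 1" by (subst ln_le_cancel_iff) auto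
      then have "M x \<le> 0" using MJ unfolding ln_one by linarith
      then show False using elim by linarith
    qed
    have "real (card ({1..x} - good x)) / x \<le> 5 / sqrt x + real s0 ^ 4 * (1 / M x + 4 / sqrt x) + 1 / (real s0 - 1)"
      unfolding good_def using elim K0 K14 KJ cJ JJ J12 s0 sJ s1 MJ
      by (intro card_bad_le[where J = "J x" and J' = "J' x"]) auto
    then have bad: "real (card ({1..x} - good x)) / x < \<epsilon>" using elim s0\<epsilon> by linarith
    have gx: "good x \<subseteq> {1..x}" unfolding good_def by (rule Collect_restrict)
    then have "card ({1..x} - good x) = x - card (good x)"
      by (subst card_Diff_subset) (auto intro: finite_subset)
    moreover have "card (good x) \<le> x" using card_mono[OF _ gx] by simp
    ultimately have "real (card ({1..x} - good x)) = real x - real (card (good x))" by simp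
    then have "1 - real (card (good x)) / x < \<epsilon>" "real (card (good x)) / x \<le> 1"
      using bad elim \<open>card (good x) \<le> x\<close> by (auto simp: diff_divide_distrib)
    then show ?case unfolding good_def[symmetric] by (simp add: dist_real_def)
  qed
qed

end
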